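(* Let $d\ge 2$ and let $Z$ be a set of $\binom{d+2}{2}-1$ general points in $\mathbb{P}^3$ (over $\mathbb{C}$). The expected codimension of the $d$-Weddle scheme of $Z$ is $2$. If the $d$-Weddle scheme of $Z$ has the expected codimension, then it is an arithmetically Cohen–Macaulay curve of degree $$\binom{\binom{d+2}{3}+1}{2}.$$ This curve includes the $\binom{\binom{d+2}{2}-1}{2}$ lines joining two points of $Z$. In particular, it is never irreducible.
   Context: "General" points means: for all sets corresponding to a nonempty Zariski open subset of the parameter space. Definition of the $d$-Weddle scheme. Let $Z=\{P_1,\dots,P_r\}\subset\mathbb{P}^3$ and $R=\mathbb{C}[x_0,\dots,x_3]$. Let $M_j$ run over the monomials of degree $d$ and $m_i$ over those of degree $d-1$. The interpolation matrix $\Lambda(Z+dQ,d)$, with $Q=[x_0:\dots:x_3]$, has columns indexed by the $M_j$; its first $r$ rows have entries $M_j(P_i)$ (for fixed coordinate representatives), and its remaining rows, indexed by the $m_i$, have entries $\partial_{m_i}M_j$, where $\partial_m$ is the iterated partial derivative with exponents given by $m$. (For $P\in\mathbb{P}^3$, the kernel of the matrix specialized at $Q=P$ is $[I(Z)\cap I(P)^d]_d$, the space of degree $d$ cones with vertex $P$ containing $Z$.) Let $\rho$ be its rank for general $Q$. The $d$-Weddle scheme of $Z$ is the subscheme of $\mathbb{P}^3$ defined by the saturation of the ideal generated by the $\rho\times\rho$ minors of $\Lambda(Z+dQ,d)$. Expected codimension. Let $L_i$ be the linear form dual to $P_i$ (i.e. $L_i=\sum_k p_{k}x_k$ if $P_i=[p_{0}:\dots:p_{3}]$)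 and $L_P$ the form dual to $P$. The same scheme is defined by minors of the matrix of linear forms (in the coordinates of $P$) representing multiplication $\times L_P:[R/(L_1^d,\dots,L_r^d)]_{d-1}\to[R/(L_1^d,\dots,L_r^d)]_d$. For the scheme defined by the maximal minors of a $q\times p$ matrix of linear forms the expected codimension is $|p-q|+1$ (more generally, for the $(k+1)\times(k+1)$ minors it is $(p-k)(q-k)$). *)

theory Defs
  imports
    "HOL-Analysis.Analysis"
    "HOL-Algebra.Algebraic_Closure_Type"
    "HOL-Library.Poly_Mapping"
    "Jordan_Normal_Form.DL_Rank_Submatrix"
begin

section \<open>Polynomials\<close>

text \<open>
  A polynomial with variables in \<open>'v\<close> is a finitely supported map from exponent vectors
  to coefficients; the product is convolution.
\<close>

type_synonym 'v cpoly = "('v \<Rightarrow>\<^sub>0 nat) \<Rightarrow>\<^sub>0 complex"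

definition eval :: "('v \<Rightarrow> complex) \<Rightarrow> 'v cpoly \<Rightarrow> complex" where
  "eval x f = (\<Sum>m\<in>Poly_Mapping.keys f. Poly_Mapping.lookup f m *
     (\<Prod>v\<in>Poly_Mapping.keys m. x v ^ Poly_Mapping.lookup m v))"

definition cscale :: "complex \<Rightarrow> 'v cpoly \<Rightarrow> 'v cpoly" where
  "cscale c f = Poly_Mapping.single 0 c * f"

abbreviation cdim :: "'v cpoly set \<Rightarrow> nat" where
  "cdim \<equiv> vector_space.dim cscale"

text \<open>\<open>mpoly4\<close> is the ring \<open>R = \<complex>[x\<^sub>0, \<dots>, x\<^sub>3]\<close>; \<open>(0::4), \<dots>, (3::4)\<close> index its variables.\<close>

type_synonym mpoly4 = "4 cpoly"

abbreviation R4 :: "mpoly4 ring" where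
  "R4 \<equiv> ring_of_type_algebra"

definition monom4 :: "(4 \<Rightarrow>\<^sub>0 nat) \<Rightarrow> mpoly4" where
  "monom4 m = Poly_Mapping.single m 1"

definition mdeg :: "(4 \<Rightarrow>\<^sub>0 nat) \<Rightarrow> nat" where
  "mdeg m = (\<Sum>k\<in>UNIV. Poly_Mapping.lookup m k)"

text \<open>The graded piece \<open>[R]\<^sub>t\<close>, including zero.\<close>

definition forms :: "nat \<Rightarrow> mpoly4 set" where
  "forms t = {f. \<forall>m\<in>Poly_Mapping.keys f. mdeg m = t}"

definition hom_component :: "nat \<Rightarrow> mpoly4 \<Rightarrow> mpoly4" where
  "hom_component t f =
     (\<Sum>m\<in>{m\<in>Poly_Mapping.keys f. mdeg m = t}. Poly_Mapping.single m (Poly_Mapping.lookup f m))"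

definition homogeneous_ideal :: "mpoly4 set \<Rightarrow> bool" where
  "homogeneous_ideal I \<longleftrightarrow> ideal I R4 \<and> (\<forall>f\<in>I. \<forall>t. hom_component t f \<in> I)"

definition irrelevant_ideal :: "mpoly4 set" where
  "irrelevant_ideal = {f. Poly_Mapping.lookup f 0 = 0}"

definition partial_deriv :: "4 \<Rightarrow> mpoly4 \<Rightarrow> mpoly4" where
  "partial_deriv k f = (\<Sum>m\<in>Poly_Mapping.keys f.
     Poly_Mapping.single (m - Poly_Mapping.single k 1)
       (of_nat (Poly_Mapping.lookup m k) * Poly_Mapping.lookup f m))"

definition iter_deriv :: "(4 \<Rightarrow>\<^sub>0 nat) \<Rightarrow> mpoly4 \<Rightarrow> mpoly4" where
  "iter_deriv m f =
     (partial_deriv 0 ^^ Poly_Mapping.lookup m 0)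
       ((partial_deriv 1 ^^ Poly_Mapping.lookup m 1)
         ((partial_deriv 2 ^^ Poly_Mapping.lookup m 2)
           ((partial_deriv 3 ^^ Poly_Mapping.lookup m 3) f)))"


section \<open>General points\<close>

text \<open>
  A tuple of \<open>r\<close> points of \<open>\<pp>\<^sup>3\<close> is given by coordinate representatives \<open>P i \<noteq> 0\<close>, \<open>i < r\<close>.
  Closed subsets of \<open>(\<pp>\<^sup>3)\<^sup>r\<close> are common zero sets of multihomogeneous polynomials in the
  variables \<open>(i, k)\<close>, where \<open>(i, k)\<close> is the \<open>k\<close>-th coordinate of the \<open>i\<close>-th point.
  The condition \<open>e i = 0\<close> for \<open>i \<ge> r\<close> says that no variable \<open>(i, k)\<close> with \<open>i \<ge> r\<close> occurs.
\<close>

definition multihomogeneous :: "nat \<Rightarrow> (nat \<times> 4) cpoly \<Rightarrow> bool" where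
  "multihomogeneous r f \<longleftrightarrow>
     (\<exists>e. (\<forall>i\<ge>r. e i = 0) \<and>
          (\<forall>m\<in>Poly_Mapping.keys f. \<forall>i. (\<Sum>k\<in>UNIV. Poly_Mapping.lookup m (i, k)) = e i))"

definition zariski_open :: "nat \<Rightarrow> (nat \<Rightarrow> complex ^ 4) set \<Rightarrow> bool" where
  "zariski_open r U \<longleftrightarrow>
     (\<exists>F. (\<forall>f\<in>F. multihomogeneous r f) \<and>
          U = {P. (\<forall>i<r. P i \<noteq> 0) \<and> (\<exists>f\<in>F. eval (\<lambda>(i, k). vec_nth (P i) k) f \<noteq> 0)})"

definition for_general_points :: "nat \<Rightarrow> ((nat \<Rightarrow> complex ^ 4) \<Rightarrow> bool) \<Rightarrow> bool" where
  "for_general_points r \<Phi> \<longleftrightarrow> (\<exists>U. zariski_open r U \<and> U \<noteq> {} \<and> (\<forall>P\<in>U. \<Phi> P))"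

text \<open>The value taken by \<open>\<nu>\<close> at a general point of \<open>\<pp>\<^sup>3\<close>.\<close>

definition general_value :: "(complex ^ 4 \<Rightarrow> nat) \<Rightarrow> nat" where
  "general_value \<nu> = (THE n. for_general_points 1 (\<lambda>Q. \<nu> (Q 0) = n))"


section \<open>Closed subschemes of projective 3-space\<close>

text \<open>
  A closed subscheme of \<open>\<pp>\<^sup>3\<close> is represented by its saturated homogeneous ideal \<open>I\<close>.
  The ideal power \<open>m\<^sup>n\<close> of the irrelevant ideal \<open>m\<close> is generated by the monomials of degree
  \<open>n\<close>, so the following is \<open>(I : m\<^sup>\<infinity>)\<close>.
\<close>

definition saturation :: "mpoly4 set \<Rightarrow> mpoly4 set" where
  "saturation I = {f. \<exists>n. \<forall>m. mdeg m = n \<longrightarrow> monom4 m * f \<in> I}"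

text \<open>The points of the scheme \<open>Proj (R/I)\<close>.\<close>

definition proj_points :: "mpoly4 set \<Rightarrow> mpoly4 set set" where
  "proj_points I =
     {\<pp>. primeideal \<pp> R4 \<and> homogeneous_ideal \<pp> \<and> \<not> irrelevant_ideal \<subseteq> \<pp> \<and> I \<subseteq> \<pp>}"

text \<open>The supremum of the lengths of chains; it is \<open>-\<infinity>\<close> for the empty set.\<close>

definition chain_dim :: "'a set set \<Rightarrow> ereal" where
  "chain_dim S = Sup {ereal (real n) | n.
     \<exists>c. (\<forall>i\<le>n. c i \<in> S) \<and> (\<forall>i<n. c i \<subset> c (Suc i))}"

definition scheme_dim :: "mpoly4 set \<Rightarrow> ereal" where
  "scheme_dim I = chain_dim (proj_points I)"

definition scheme_codim :: "mpoly4 set \<Rightarrow> ereal" where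
  "scheme_codim I = 3 - scheme_dim I"

definition scheme_irreducible :: "mpoly4 set \<Rightarrow> bool" where
  "scheme_irreducible I \<longleftrightarrow>
     proj_points I \<noteq> {} \<and>
     (\<forall>J K. homogeneous_ideal J \<longrightarrow> homogeneous_ideal K \<longrightarrow>
        proj_points I \<subseteq> proj_points J \<union> proj_points K \<longrightarrow>
        proj_points I \<subseteq> proj_points J \<or> proj_points I \<subseteq> proj_points K)"

text \<open>\<open>dim\<^sub>\<complex> [R/I]\<^sub>t\<close>\<close>

definition hilbert_fun :: "mpoly4 set \<Rightarrow> nat \<Rightarrow> nat" where
  "hilbert_fun I t = cdim (forms t) - cdim (I \<inter> forms t)"

text \<open>
  The degree is \<open>n!\<close> times the leading coefficient of the Hilbert polynomial, where \<open>n\<close> is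
  the degree of that polynomial (the dimension of the scheme).
\<close>

definition has_degree :: "mpoly4 set \<Rightarrow> nat \<Rightarrow> bool" where
  "has_degree I e \<longleftrightarrow>
     (\<exists>H :: real poly.
        (\<forall>\<^sub>F t in sequentially. real (hilbert_fun I t) = poly H (real t)) \<and>
        fact (Polynomial.degree H) * Polynomial.lead_coeff H = real e)"

definition krull_dim_quot :: "mpoly4 set \<Rightarrow> ereal" where
  "krull_dim_quot I = chain_dim {\<pp>. primeideal \<pp> R4 \<and> I \<subseteq> \<pp>}"

definition regular_sequence_mod :: "mpoly4 set \<Rightarrow> mpoly4 list \<Rightarrow> bool" where
  "regular_sequence_mod I fs \<longleftrightarrow>
     genideal R4 (I \<union> set fs) \<noteq> UNIV \<and>
     (\<forall>k<length fs. \<forall>g. fs ! k * g \<in> genideal R4 (I \<union> set (take k fs)) \<longrightarrow>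
        g \<in> genideal R4 (I \<union> set (take k fs)))"

text \<open>The depth of the graded ring \<open>R/I\<close> with respect to its irrelevant ideal.\<close>

definition depth_quot :: "mpoly4 set \<Rightarrow> ereal" where
  "depth_quot I = Sup {ereal (real (length fs)) | fs.
     set fs \<subseteq> irrelevant_ideal \<and> regular_sequence_mod I fs}"

text \<open>
  For a graded algebra \<open>R/I\<close>, Cohen--Macaulayness can be tested at the irrelevant ideal.
\<close>

definition arithmetically_CM :: "mpoly4 set \<Rightarrow> bool" where
  "arithmetically_CM I \<longleftrightarrow> depth_quot I = krull_dim_quot I"


section \<open>The Weddle scheme\<close>

definition monomials :: "nat \<Rightarrow> (4 \<Rightarrow>\<^sub>0 nat) list" where
  "monomials t = sorted_list_of_set {m. mdeg m = t}"

text \<open>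
  The matrix \<open>\<Lambda>(Z + dQ, d)\<close> for \<open>Z = {P 0, \<dots>, P (r - 1)}\<close>, with entries in \<open>R\<close>, the
  coordinates of \<open>Q\<close> being the variables.
\<close>

definition interpolation_matrix :: "nat \<Rightarrow> nat \<Rightarrow> (nat \<Rightarrow> complex ^ 4) \<Rightarrow> mpoly4 mat" where
  "interpolation_matrix d r P =
     mat (r + length (monomials (d - 1))) (length (monomials d)) (\<lambda>(i, j).
       if i < r
       then Poly_Mapping.single 0 (eval (vec_nth (P i)) (monom4 (monomials d ! j)))
       else iter_deriv (monomials (d - 1) ! (i - r)) (monom4 (monomials d ! j)))"

definition weddle_rank :: "nat \<Rightarrow> nat \<Rightarrow> (nat \<Rightarrow> complex ^ 4) \<Rightarrow> nat" where
  "weddle_rank d r P = general_value (\<lambda>Q.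
     vec_space.rank (dim_row (interpolation_matrix d r P))
       (map_mat (eval (vec_nth Q)) (interpolation_matrix d r P)))"

definition minors_ideal :: "nat \<Rightarrow> mpoly4 mat \<Rightarrow> mpoly4 set" where
  "minors_ideal n A = genideal R4 {Determinant.det (submatrix A I J) | I J.
     I \<subseteq> {..<dim_row A} \<and> J \<subseteq> {..<dim_col A} \<and> card I = n \<and> card J = n}"

definition weddle_ideal :: "nat \<Rightarrow> nat \<Rightarrow> (nat \<Rightarrow> complex ^ 4) \<Rightarrow> mpoly4 set" where
  "weddle_ideal d r P =
     saturation (minors_ideal (weddle_rank d r P) (interpolation_matrix d r P))"


section \<open>Expected codimension\<close>

definition dual_form :: "complex ^ 4 \<Rightarrow> mpoly4" where
  "dual_form v = (\<Sum>k\<in>UNIV. Poly_Mapping.single (Poly_Mapping.single k 1) (vec_nth v k))"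

definition powers_ideal :: "nat \<Rightarrow> nat \<Rightarrow> (nat \<Rightarrow> complex ^ 4) \<Rightarrow> mpoly4 set" where
  "powers_ideal d r P = genideal R4 {dual_form (P i) ^ d | i. i < r}"

text \<open>
  The rank of \<open>\<times>L : [R/J]\<^bsub>d-1\<^esub> \<rightarrow> [R/J]\<^sub>d\<close>: its image is \<open>(L \<cdot> [R]\<^bsub>d-1\<^esub> + [J]\<^sub>d) / [J]\<^sub>d\<close>.
\<close>

definition mult_rank :: "mpoly4 set \<Rightarrow> nat \<Rightarrow> mpoly4 \<Rightarrow> nat" where
  "mult_rank J d L =
     cdim {L * f + g | f g. f \<in> forms (d - 1) \<and> g \<in> J \<inter> forms d} - cdim (J \<inter> forms d)"

text \<open>
  \<open>(p - k)(q - k)\<close> for the \<open>(k + 1) \<times> (k + 1)\<close> minors of the \<open>q \<times> p\<close> matrix of linear forms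
  representing \<open>\<times>L\<^sub>Q\<close> on \<open>R/(L\<^sub>1\<^sup>d, \<dots>, L\<^sub>r\<^sup>d)\<close>, where \<open>k + 1\<close> is the rank of this matrix for general \<open>Q\<close>.
\<close>

definition expected_codim :: "nat \<Rightarrow> nat \<Rightarrow> (nat \<Rightarrow> complex ^ 4) \<Rightarrow> int" where
  "expected_codim d r P =
     (let J = powers_ideal d r P;
          p = int (hilbert_fun J (d - 1));
          q = int (hilbert_fun J d);
          k = int (general_value (\<lambda>Q. mult_rank J d (dual_form Q))) - 1
      in (p - k) * (q - k))"


section \<open>Points and lines\<close>

text \<open>Points and lines of \<open>\<pp>\<^sup>3\<close> as linear subspaces of \<open>\<complex>\<^sup>4\<close> of dimension 1 and 2.\<close>

definition point_set :: "nat \<Rightarrow> (nat \<Rightarrow> complex ^ 4) \<Rightarrow> (complex ^ 4) set set" where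
  "point_set r P = {vec.span {P i} | i. i < r}"

definition joining_lines :: "nat \<Rightarrow> (nat \<Rightarrow> complex ^ 4) \<Rightarrow> (complex ^ 4) set set" where
  "joining_lines r P = {vec.span {P i, P j} | i j. i < j \<and> j < r}"

definition vanishing_ideal :: "(complex ^ 4) set \<Rightarrow> mpoly4 set" where
  "vanishing_ideal V = {f. \<forall>v\<in>V. eval (vec_nth v) f = 0}"

text \<open>Inclusion of closed subschemes reverses the inclusion of saturated ideals.\<close>

definition scheme_contains_line :: "mpoly4 set \<Rightarrow> (complex ^ 4) set \<Rightarrow> bool" where
  "scheme_contains_line I l \<longleftrightarrow> I \<subseteq> vanishing_ideal l"

end

theory Submission
  imports Defs "HOL-Library.Function_Algebras"
begin

text \<open>
  Let \<open>N\<close> be the number of monomials of degree \<open>d\<close> and \<open>n = (d + 2 choose 3)\<close> the number of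
  monomials of degree \<open>d - 1\<close>. As \<open>Z\<close> consists of \<open>r = N - 1 - n\<close> points, the interpolation matrix
  has \<open>N - 1\<close> rows and \<open>N\<close> columns: \<open>r\<close> rows of constants and \<open>n\<close> rows of linear forms. Up to
  nonzero factors, its rows at a point \<open>Q\<close> are the coefficient vectors of the forms \<open>L\<^sub>i\<^sup>d\<close> and
  of the monomials of degree \<open>d - 1\<close> times \<open>L\<^sub>Q\<close>. For general \<open>Z\<close> they are independent at
  \<open>Q = [1:0:0:0]\<close>, hence at a general \<open>Q\<close>; this is a determinantal condition on \<open>Z\<close>, satisfied by
  the points \<open>[0 : 1 : 2\<^sup>i : 2\<^bsup>i(d+1)\<^esup>]\<close> because it is a Vandermonde condition for them
  (\<open>nondegenerate\<close>, \<open>vandermonde_points\<close>). Therefore the Weddle scheme is the scheme of maximal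
  minors, and multiplication by \<open>L\<^sub>Q\<close> is given by an \<open>(n + 1) \<times> n\<close> matrix of rank \<open>n\<close>: the
  expected codimension is \<open>2\<close>.

  Let \<open>I\<close> be the ideal of maximal minors and suppose that its zero locus has dimension \<open>1\<close>. Then
  some line misses it (\<open>good_of_scheme_dim\<close>): a homogeneous ideal that is maximal among those whose
  zero locus meets every linear subspace of codimension \<open>k\<close> is prime, and from such primes one builds
  chains of \<open>k + 1\<close> points. Complete the equations of the line to coordinates \<open>l\<^sub>0, \<dots>, l\<^sub>3\<close>. Modulo
  \<open>(l\<^sub>0, l\<^sub>1)\<close> the ideal \<open>I\<close> contains powers of \<open>l\<^sub>2\<close> and \<open>l\<^sub>3\<close>, which form a regular sequence, and
  Cramer's rule shows that the syzygies of the minors modulo \<open>(l\<^sub>0, l\<^sub>1)\<close> are the combinations of the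
  rows. Induction on the degree lifts this statement from \<open>R/(l\<^sub>0, l\<^sub>1)\<close> to \<open>R/(l\<^sub>0)\<close> and to \<open>R\<close>
  (\<open>hilbert_burch\<close>): the Hilbert--Burch complex
  \<open>0 \<rightarrow> R(-n)\<^bsup>r\<^esup> \<oplus> R(-n-1)\<^bsup>n\<^esup> \<rightarrow> R(-n)\<^bsup>N\<^esup> \<rightarrow> I \<rightarrow> 0\<close> is exact, and since the syzygies modulo \<open>l\<^sub>0\<close>
  and \<open>(l\<^sub>0, l\<^sub>1)\<close> lift, \<open>l\<^sub>0, l\<^sub>1\<close> is a regular sequence on \<open>R/I\<close>.

  This gives everything else. The ideal \<open>I\<close> is saturated, because \<open>l\<^sub>0\<close> is a nonzerodivisor modulo
  \<open>I\<close>. Counting dimensions along the complex yields the Hilbert polynomial, which is linear with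
  leading coefficient \<open>(n + 1 choose 2)\<close> (\<open>hilbert_fun_minor_ideal\<close>). The depth of \<open>R/I\<close> is at
  least \<open>2\<close>; in general it is at most the Krull dimension (\<open>depth_le_krull\<close>), and the Krull dimension
  is at most \<open>2\<close>, since a chain of primes of length \<open>3\<close> would force cubic growth of the space of
  polynomials of degree at most \<open>t\<close> modulo \<open>I\<close>, which grows quadratically (\<open>krull_le_2\<close>).

  If \<open>Q\<close> lies on the line joining \<open>P\<^sub>a\<close> and \<open>P\<^sub>b\<close>, then a nontrivial combination of \<open>L\<^sub>a\<^sup>d\<close> and
  \<open>L\<^sub>b\<^sup>d\<close> is divisible by \<open>L\<^sub>Q\<close>, so the rows at \<open>Q\<close> are dependent and all maximal minors vanish
  (\<open>minor_vanishes_collinear\<close>). Finally, the generic point of an irreducible scheme that contains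
  two lines through \<open>P\<^sub>a\<close> would start a chain generic point, line, \<open>P\<^sub>a\<close>, and the dimension would be
  at least \<open>2\<close> (\<open>I_not_irreducible\<close>).
\<close>

section \<open>Polynomials as finitely supported functions\<close>

abbreviation "lookup \<equiv> Poly_Mapping.lookup"
abbreviation "keys \<equiv> Poly_Mapping.keys"
abbreviation "single \<equiv> Poly_Mapping.single"

lemma cpoly_sum_single: "f = (\<Sum>m\<in>keys f. single m (lookup f m))"
  by (rule poly_mapping_eqI)
     (auto simp: lookup_sum lookup_single when_def sum.delta in_keys_iff)

lemma cpoly_induct [case_names single add]:
  assumes single: "\<And>m c. P (single m c)"
    and add: "\<And>f g. P f \<Longrightarrow> P g \<Longrightarrow> P (f + g)"
  shows "P (f :: 'v cpoly)"
proof -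
  have "P (\<Sum>m\<in>S. single m (lookup f m))" if "finite S" for S
    using that
  proof induction
    case empty
    have "P (single 0 0)" by (rule single)
    then show ?case by simp
  next
    case (insert x F)
    then show ?case by (simp add: single add)
  qed
  then show ?thesis using cpoly_sum_single[of f] by (metis finite_keys)
qed

definition monom_val :: "('v \<Rightarrow> 'b::comm_ring_1) \<Rightarrow> ('v \<Rightarrow>\<^sub>0 nat) \<Rightarrow> 'b" where
  "monom_val y m = (\<Prod>v\<in>keys m. y v ^ lookup m v)"

text \<open>Substitution, with coefficients transported by \<open>h\<close>; it covers both evaluation at a
  point and linear changes of coordinates.\<close>

definition substitute :: "(complex \<Rightarrow> 'b::comm_ring_1) \<Rightarrow> ('v \<Rightarrow> 'b) \<Rightarrow> 'v cpoly \<Rightarrow> 'b" where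
  "substitute h y f = (\<Sum>m\<in>keys f. h (lookup f m) * monom_val y m)"

lemma eval_eq_substitute: "eval x = substitute (\<lambda>c. c) x"
  by (auto simp: eval_def substitute_def monom_val_def)

lemma monom_val_superset:
  assumes "finite S" "keys m \<subseteq> S"
  shows "monom_val y m = (\<Prod>v\<in>S. y v ^ lookup m v)"
  unfolding monom_val_def
  by (rule prod.mono_neutral_left) (use assms in \<open>auto simp: in_keys_iff\<close>)

lemma monom_val_0 [simp]: "monom_val y 0 = 1"
  by (simp add: monom_val_def)

lemma monom_val_single: "monom_val y (single v k) = y v ^ k"
  by (subst monom_val_superset[of "{v}"]) auto

lemma monom_val_add: "monom_val y (m + m') = monom_val y m * monom_val y m'"
proof -
  let ?S = "keys m \<union> keys m'"
  have "keys (m + m') \<subseteq> ?S" by (rule keys_add)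
  then show ?thesis
    by (simp add: monom_val_superset[of ?S] lookup_add power_add prod.distrib)
qed

locale coeff_hom = comm_ring_hom h for h :: "complex \<Rightarrow> 'b::comm_ring_1"
begin

lemma substitute_superset:
  assumes "finite S" "keys f \<subseteq> S"
  shows "substitute h y f = (\<Sum>m\<in>S. h (lookup f m) * monom_val y m)"
  unfolding substitute_def
  by (rule sum.mono_neutral_left) (use assms in \<open>auto simp: in_keys_iff\<close>)

lemma substitute_single: "substitute h y (single m c) = h c * monom_val y m"
  by (subst substitute_superset[of "{m}"]) auto

lemma substitute_add: "substitute h y (f + g) = substitute h y f + substitute h y g"
proof -
  let ?S = "keys f \<union> keys g"
  have "keys (f + g) \<subseteq> ?S" by (rule keys_add)
  then show ?thesis
    by (simp add: substitute_superset[of ?S] lookup_add hom_add sum.distrib algebra_simps)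
qed

lemma substitute_mult: "substitute h y (f * g) = substitute h y f * substitute h y g"
proof (induction f rule: cpoly_induct)
  case (single m c)
  show ?case
    by (induction g rule: cpoly_induct)
       (simp_all add: mult_single substitute_single substitute_add monom_val_add hom_mult algebra_simps)
next
  case (add f f')
  then show ?case by (simp add: substitute_add algebra_simps)
qed

lemma substitute_ring_hom: "comm_ring_hom (substitute h y)"
proof
  show "substitute h y 0 = 0" by (simp add: substitute_def)
  show "substitute h y 1 = 1" using substitute_single[of y 0 1] by simp
qed (simp_all add: substitute_add substitute_mult)

end

lemma const_ring_hom: "coeff_hom (single 0 :: complex \<Rightarrow> 'v cpoly)"
  by unfold_locales (auto simp: single_add mult_single)

lemma id_ring_hom: "coeff_hom (\<lambda>c::complex. c)"
  by unfold_locales auto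

interpretation eval: comm_ring_hom "eval x" for x :: "'v \<Rightarrow> complex"
  unfolding eval_eq_substitute by (rule coeff_hom.substitute_ring_hom[OF id_ring_hom])

lemma eval_single: "eval x (single m c) = c * monom_val x m"
  unfolding eval_eq_substitute by (rule coeff_hom.substitute_single[OF id_ring_hom])

lemma lookup_cscale [simp]: "lookup (cscale c f) m = c * lookup f m"
  unfolding cscale_def
  by (simp add: mult_map_scale_conv_mult[symmetric] Poly_Mapping.map.rep_eq when_def)

lemma eval_cscale: "eval x (cscale c f) = c * eval x f"
  by (simp add: cscale_def eval.hom_mult eval_single)

lemma vector_space_cscale: "vector_space (cscale :: complex \<Rightarrow> 'v cpoly \<Rightarrow> 'v cpoly)"
  by unfold_locales
     (auto intro!: poly_mapping_eqI simp: lookup_add algebra_simps)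

interpretation cs: vector_space "cscale :: complex \<Rightarrow> 'v cpoly \<Rightarrow> 'v cpoly"
  by (rule vector_space_cscale)

lemma cscale_mult_left: "cscale c f * g = cscale c (f * g)"
  by (simp add: cscale_def mult.assoc)

lemma cscale_mult_right: "f * cscale c g = cscale c (f * g)"
  by (simp add: cscale_def mult.left_commute)

lemma cpoly_sum_cscale: "f = (\<Sum>m\<in>keys f. cscale (lookup f m) (single m 1))"
  using cpoly_sum_single[of f] by (simp add: cscale_def mult_single)

subsection \<open>Restriction to a set of monomials\<close>

definition restr :: "('v \<Rightarrow>\<^sub>0 nat) set \<Rightarrow> 'v cpoly \<Rightarrow> 'v cpoly" where
  "restr S f = (\<Sum>m\<in>{m\<in>keys f. m \<in> S}. single m (lookup f m))"

lemma lookup_restr: "lookup (restr S f) m = (if m \<in> S then lookup f m else 0)"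
  by (auto simp: restr_def lookup_sum lookup_single when_def sum.delta in_keys_iff)

lemma hom_component_eq_restr: "hom_component t f = restr {m. mdeg m = t} f"
  by (simp add: hom_component_def restr_def)

lemma restr_add: "restr S (f + g) = restr S f + restr S g"
  by (rule poly_mapping_eqI) (simp add: lookup_restr lookup_add)

lemma restr_0 [simp]: "restr S 0 = 0"
  by (rule poly_mapping_eqI) (simp add: lookup_restr)

lemma restr_sum: "restr S (sum f A) = (\<Sum>i\<in>A. restr S (f i))"
  by (rule poly_mapping_eqI) (simp add: lookup_restr lookup_sum)

lemma restr_single: "restr S (single m c) = (if m \<in> S then single m c else 0)"
  by (rule poly_mapping_eqI) (auto simp: lookup_restr lookup_single when_def)

lemma keys_restr: "keys (restr S f) = keys f \<inter> S"
  by (auto simp: in_keys_iff lookup_restr split: if_splits)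

lemma restr_id: "keys f \<subseteq> S \<Longrightarrow> restr S f = f"
  by (rule poly_mapping_eqI) (auto simp: lookup_restr in_keys_iff)

subsection \<open>Grading\<close>

lemma mdeg_0 [simp]: "mdeg 0 = 0"
  by (simp add: mdeg_def)

lemma mdeg_add: "mdeg (m + m') = mdeg m + mdeg m'"
  by (simp add: mdeg_def lookup_add sum.distrib)

lemma mdeg_single [simp]: "mdeg (single k a) = a"
  by (simp add: mdeg_def lookup_single when_def)

lemma forms_iff: "f \<in> forms t \<longleftrightarrow> (\<forall>m. lookup f m \<noteq> 0 \<longrightarrow> mdeg m = t)"
  by (auto simp: forms_def in_keys_iff)

lemma forms_subspace: "cs.subspace (forms t)"
proof (rule cs.subspaceI)
  fix f g :: mpoly4 and c
  show "0 \<in> forms t" by (simp add: forms_iff)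
  show "f + g \<in> forms t" if "f \<in> forms t" "g \<in> forms t"
    using that keys_add[of f g] by (auto simp: forms_def)
  show "cscale c f \<in> forms t" if "f \<in> forms t"
    using that by (auto simp: forms_iff)
qed

lemma forms_0 [simp]: "0 \<in> forms t" by (simp add: forms_def)

lemma forms_add: "f \<in> forms t \<Longrightarrow> g \<in> forms t \<Longrightarrow> f + g \<in> forms t"
  using forms_subspace cs.subspace_add by blast

lemma forms_diff: "f \<in> forms t \<Longrightarrow> g \<in> forms t \<Longrightarrow> f - g \<in> forms t"
  using forms_subspace cs.subspace_diff by blast

lemma forms_cscale: "f \<in> forms t \<Longrightarrow> cscale c f \<in> forms t"
  using forms_subspace cs.subspace_scale by blast

lemma forms_sum: "(\<And>i. i \<in> A \<Longrightarrow> f i \<in> forms t) \<Longrightarrow> sum f A \<in> forms t"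
  using cs.subspace_sum[OF forms_subspace] by blast

lemma forms_single: "single m c \<in> forms (mdeg m)"
  by (auto simp: forms_def split: if_splits)

lemma forms_mult:
  assumes "f \<in> forms s" "g \<in> forms t" shows "f * g \<in> forms (s + t)"
  using assms keys_mult[of f g] unfolding forms_def by (fastforce simp: mdeg_add)

lemma forms_0_iff: "f \<in> forms 0 \<longleftrightarrow> (\<exists>c. f = single 0 c)"
proof
  assume f: "f \<in> forms 0"
  have "mdeg m = 0 \<Longrightarrow> m = 0" for m :: "4 \<Rightarrow>\<^sub>0 nat"
    by (rule poly_mapping_eqI) (simp add: mdeg_def)
  with f have "f = single 0 (lookup f 0)"
    by (intro poly_mapping_eqI) (auto simp: forms_iff lookup_single when_def)
  then show "\<exists>c. f = single 0 c" by blast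
next
  assume "\<exists>c. f = single 0 c"
  then show "f \<in> forms 0" using forms_single[of 0] by auto
qed

lemma forms_1 [simp]: "1 \<in> forms 0"
  using forms_0_iff single_one by metis

lemma forms_power: "f \<in> forms s \<Longrightarrow> f ^ k \<in> forms (k * s)"
  by (induction k) (auto intro: forms_mult)

lemma hom_component_forms: "hom_component t f \<in> forms t"
  by (auto simp: hom_component_eq_restr forms_def keys_restr)

lemma hom_component_id: "f \<in> forms t \<Longrightarrow> hom_component t f = f"
  by (auto simp: hom_component_eq_restr forms_def intro!: restr_id)

lemma hom_component_add: "hom_component t (f + g) = hom_component t f + hom_component t g"
  by (simp add: hom_component_eq_restr restr_add)

lemma hom_component_sum: "hom_component t (sum f A) = (\<Sum>i\<in>A. hom_component t (f i))"
  by (simp add: hom_component_eq_restr restr_sum)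

text \<open>Stated for restriction to any set of degrees, so that homogeneous components and truncations
  are both instances.\<close>

lemma restr_mult_form:
  assumes "g \<in> forms e" and "\<And>m. m \<in> S \<longleftrightarrow> T (mdeg m)" and "\<And>m. m \<in> S' \<longleftrightarrow> T (mdeg m + e)"
  shows "restr S (g * f) = g * restr S' f"
proof (induction f rule: cpoly_induct)
  case (single m c)
  show ?case
  proof (cases "T (mdeg m + e)")
    case True
    then have "keys (g * single m c) \<subseteq> S"
      using assms keys_mult[of g "single m c"] by (fastforce simp: forms_def mdeg_add add.commute split: if_splits)
    then show ?thesis using True assms by (simp add: restr_id restr_single)
  next
    case False
    then have "keys (g * single m c) \<inter> S = {}"
      using assms keys_mult[of g "single m c"] by (fastforce simp: forms_def mdeg_add add.commute split: if_splits)
    then have "restr S (g * single m c) = 0"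
      using keys_restr[of S "g * single m c"]
      by (metis keys_eq_empty)
    then show ?thesis using False assms by (simp add: restr_single)
  qed
next
  case (add f f')
  then show ?case by (simp add: restr_add algebra_simps)
qed

lemma hom_component_mult_form:
  assumes "g \<in> forms e"
  shows "hom_component t (g * f) = (if e \<le> t then g * hom_component (t - e) f else 0)"
proof (cases "e \<le> t")
  case True
  have "restr {m. mdeg m = t} (g * f) = g * restr {m. mdeg m = t - e} f"
    by (rule restr_mult_form[OF assms, where T = "\<lambda>a. a = t"]) (use True in auto)
  then show ?thesis using True by (simp add: hom_component_eq_restr)
next
  case False
  then have "restr {m. mdeg m = t} (g * f) = g * restr {} f"
    by (intro restr_mult_form[OF assms, where T = "\<lambda>a. a = t"]) auto
  also have "restr {} f = 0" by (rule poly_mapping_eqI) (simp add: lookup_restr)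
  finally show ?thesis using False by (simp add: hom_component_eq_restr)
qed

definition trunc :: "nat \<Rightarrow> mpoly4 \<Rightarrow> mpoly4" where
  "trunc t = restr {m. mdeg m \<le> t}"

definition polys_le :: "nat \<Rightarrow> mpoly4 set" where
  "polys_le t = {f. \<forall>m\<in>keys f. mdeg m \<le> t}"

lemma trunc_add: "trunc t (f + g) = trunc t f + trunc t g"
  by (simp add: trunc_def restr_add)

lemma trunc_sum: "trunc t (sum f A) = (\<Sum>i\<in>A. trunc t (f i))"
  by (simp add: trunc_def restr_sum)

lemma trunc_mult_form:
  assumes "g \<in> forms e"
  shows "trunc t (g * f) = (if e \<le> t then g * trunc (t - e) f else 0)"
proof (cases "e \<le> t")
  case True
  have "restr {m. mdeg m \<le> t} (g * f) = g * restr {m. mdeg m \<le> t - e} f"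
    by (rule restr_mult_form[OF assms, where T = "\<lambda>a. a \<le> t"]) (use True in auto)
  then show ?thesis using True by (simp add: trunc_def)
next
  case False
  then have "restr {m. mdeg m \<le> t} (g * f) = g * restr {} f"
    by (intro restr_mult_form[OF assms, where T = "\<lambda>a. a \<le> t"]) auto
  also have "restr {} f = 0" by (rule poly_mapping_eqI) (simp add: lookup_restr)
  finally show ?thesis using False by (simp add: trunc_def)
qed

lemma trunc_id: "f \<in> polys_le t \<Longrightarrow> trunc t f = f"
  unfolding trunc_def polys_le_def by (rule restr_id) auto

lemma trunc_polys_le: "trunc t f \<in> polys_le t"
  by (auto simp: trunc_def polys_le_def keys_restr)

lemma polys_le_exists: "\<exists>t. f \<in> polys_le t"
proof
  show "f \<in> polys_le (Max (insert 0 (mdeg ` keys f)))"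
    by (auto simp: polys_le_def)
qed

lemma polys_le_mono: "s \<le> t \<Longrightarrow> polys_le s \<subseteq> polys_le t"
  by (force simp: polys_le_def)

lemma polys_le_subspace: "cs.subspace (polys_le t)"
proof (rule cs.subspaceI)
  fix f g :: mpoly4 and c
  show "0 \<in> polys_le t" by (simp add: polys_le_def)
  show "f + g \<in> polys_le t" if "f \<in> polys_le t" "g \<in> polys_le t"
    using that keys_add[of f g] by (auto simp: polys_le_def)
  show "cscale c f \<in> polys_le t" if "f \<in> polys_le t"
    using that by (auto simp: polys_le_def in_keys_iff)
qed

lemma forms_polys_le: "forms t \<subseteq> polys_le t"
  by (auto simp: forms_def polys_le_def)

lemma polys_le_mult: "f \<in> polys_le s \<Longrightarrow> g \<in> polys_le t \<Longrightarrow> f * g \<in> polys_le (s + t)"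
  using keys_mult[of f g] unfolding polys_le_def by (fastforce simp: mdeg_add intro: add_mono)

lemma polys_le_sum_components:
  assumes "f \<in> polys_le t" shows "f = (\<Sum>s\<le>t. hom_component s f)"
proof (rule poly_mapping_eqI)
  fix m
  have "lookup (\<Sum>s\<le>t. hom_component s f) m = (\<Sum>s\<le>t. if mdeg m = s then lookup f m else 0)"
    by (simp add: lookup_sum hom_component_eq_restr lookup_restr)
  also have "\<dots> = lookup f m"
    using assms by (auto simp: sum.delta' polys_le_def in_keys_iff)
  finally show "lookup f m = lookup (\<Sum>s\<le>t. hom_component s f) m" by simp
qed

lemma eval_form_scale:
  assumes "f \<in> forms t"
  shows "eval (\<lambda>k. a * x k) f = a ^ t * eval x f"
proof -
  have "monom_val (\<lambda>k. a * x k) m = a ^ mdeg m * monom_val x m" for m :: "4 \<Rightarrow>\<^sub>0 nat"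
    by (simp add: monom_val_superset[of UNIV] power_mult_distrib prod.distrib mdeg_def power_sum)
  then show ?thesis
    using assms by (auto simp: eval_eq_substitute substitute_def forms_def sum_distrib_left intro!: sum.cong)
qed

section \<open>Ideals\<close>

definition is_idl :: "mpoly4 set \<Rightarrow> bool" where
  "is_idl I \<longleftrightarrow> 0 \<in> I \<and> (\<forall>a\<in>I. \<forall>b\<in>I. a + b \<in> I) \<and> (\<forall>a\<in>I. \<forall>r. r * a \<in> I)"

lemma is_idlD:
  assumes "is_idl I"
  shows "0 \<in> I" "a \<in> I \<Longrightarrow> b \<in> I \<Longrightarrow> a + b \<in> I" "a \<in> I \<Longrightarrow> r * a \<in> I" "a \<in> I \<Longrightarrow> a * r \<in> I"
    "a \<in> I \<Longrightarrow> - a \<in> I" "a \<in> I \<Longrightarrow> b \<in> I \<Longrightarrow> a - b \<in> I"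
proof -
  show 0: "0 \<in> I" and add: "a \<in> I \<Longrightarrow> b \<in> I \<Longrightarrow> a + b \<in> I" and mul: "a \<in> I \<Longrightarrow> r * a \<in> I" for a b r
    using assms by (auto simp: is_idl_def)
  show "a \<in> I \<Longrightarrow> a * r \<in> I" using mul[of a r] by (simp add: mult.commute)
  show neg: "a \<in> I \<Longrightarrow> - a \<in> I" for a using mul[of a "-1"] by simp
  show "a \<in> I \<Longrightarrow> b \<in> I \<Longrightarrow> a - b \<in> I" using add[of a "-b"] neg[of b] by simp
qed

lemma is_idl_sum: "is_idl I \<Longrightarrow> (\<And>i. i \<in> A \<Longrightarrow> f i \<in> I) \<Longrightarrow> sum f A \<in> I"
  by (induction A rule: infinite_finite_induct) (simp_all add: is_idlD(1) is_idlD(2))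

lemma is_idl_cscale: "is_idl I \<Longrightarrow> a \<in> I \<Longrightarrow> cscale c a \<in> I"
  unfolding cscale_def by (rule is_idlD(3))

lemma is_idl_subspace: "is_idl I \<Longrightarrow> cs.subspace I"
  by (intro cs.subspaceI is_idl_cscale is_idlD(1) is_idlD(2))

lemma cring_R4: "cring R4" by (rule cring_from_type_algebra)

lemma R4_simps [simp]:
  "carrier R4 = UNIV" "monoid.mult R4 = (*)" "ring.add R4 = (+)" "monoid.one R4 = 1" "ring.zero R4 = 0"
  by (auto simp: ring_of_type_algebra_def fun_eq_iff)

lemma ideal_R4_iff: "ideal I R4 \<longleftrightarrow> is_idl I"
proof
  assume I: "ideal I R4"
  interpret ideal I R4 by (rule I)
  show "is_idl I" unfolding is_idl_def
    using additive_subgroup.zero_closed[OF is_additive_subgroup] additive_subgroup.a_closed[OF is_additive_subgroup] I_l_closed by auto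
next
  assume I: "is_idl I"
  interpret R: cring R4 by (rule cring_R4)
  have inv: "inv\<^bsub>add_monoid R4\<^esub> a = - a" for a
    using R.minus_equality[of "- a" a] by (simp add: a_inv_def)
  show "ideal I R4"
  proof (rule idealI)
    show "ring R4" by (rule R.ring_axioms)
    show "subgroup I (add_monoid R4)"
      by (rule subgroup.intro) (use is_idlD(1,2,5)[OF I] in \<open>auto simp: inv[simplified]\<close>)
  qed (use is_idlD(3,4)[OF I] in auto)
qed

lemma primeideal_R4_iff:
  "primeideal I R4 \<longleftrightarrow> is_idl I \<and> I \<noteq> UNIV \<and> (\<forall>a b. a * b \<in> I \<longrightarrow> a \<in> I \<or> b \<in> I)"
proof
  assume I: "primeideal I R4"
  interpret primeideal I R4 by (rule I)
  have "is_idl I" using is_ideal ideal_R4_iff by simp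
  then show "is_idl I \<and> I \<noteq> UNIV \<and> (\<forall>a b. a * b \<in> I \<longrightarrow> a \<in> I \<or> b \<in> I)"
    using I_notcarr I_prime by auto
next
  assume "is_idl I \<and> I \<noteq> UNIV \<and> (\<forall>a b. a * b \<in> I \<longrightarrow> a \<in> I \<or> b \<in> I)"
  then show "primeideal I R4"
    by (intro primeidealI) (auto simp: ideal_R4_iff cring_R4)
qed

lemma genideal_R4: "genideal R4 S = \<Inter>{I. is_idl I \<and> S \<subseteq> I}"
  by (simp add: genideal_def ideal_R4_iff)

lemma genideal_is_idl: "is_idl (genideal R4 S)"
  unfolding genideal_R4 is_idl_def by auto

lemma genideal_incl: "S \<subseteq> genideal R4 S"
  unfolding genideal_R4 by auto

lemma genideal_least: "is_idl I \<Longrightarrow> S \<subseteq> I \<Longrightarrow> genideal R4 S \<subseteq> I"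
  unfolding genideal_R4 by auto

lemma genideal_eqI:
  assumes "is_idl I" "S \<subseteq> I" "\<And>J. is_idl J \<Longrightarrow> S \<subseteq> J \<Longrightarrow> I \<subseteq> J"
  shows "genideal R4 S = I"
  using assms genideal_least genideal_incl genideal_is_idl by (metis subset_antisym)

lemma homogeneous_ideal_iff:
  "homogeneous_ideal I \<longleftrightarrow> is_idl I \<and> (\<forall>f\<in>I. \<forall>t. hom_component t f \<in> I)"
  by (simp add: homogeneous_ideal_def ideal_R4_iff)

text \<open>Generators are indexed by numbers below \<open>k\<close>, not collected in a set, because elements of such
  an ideal are manipulated through their coefficients.\<close>

definition adjoin :: "mpoly4 set \<Rightarrow> nat \<Rightarrow> (nat \<Rightarrow> mpoly4) \<Rightarrow> mpoly4 set" where
  "adjoin J k l = {a + (\<Sum>i<k. l i * g i) | a g. a \<in> J}"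

lemma adjoinI: "a \<in> J \<Longrightarrow> a + (\<Sum>i<k. l i * g i) \<in> adjoin J k l"
  by (auto simp: adjoin_def)

lemma adjoin_is_idl:
  assumes "is_idl J" shows "is_idl (adjoin J k l)"
  unfolding is_idl_def
proof (intro conjI ballI allI)
  show "0 \<in> adjoin J k l"
    using adjoinI[of 0 J l "\<lambda>_. 0" k] is_idlD(1)[OF assms] by simp
next
  fix x y assume "x \<in> adjoin J k l" "y \<in> adjoin J k l"
  then obtain a g b h where "x = a + (\<Sum>i<k. l i * g i)" "a \<in> J" "y = b + (\<Sum>i<k. l i * h i)" "b \<in> J"
    by (auto simp: adjoin_def)
  moreover from this have "a + b \<in> J" using is_idlD(2)[OF assms] by blast
  ultimately show "x + y \<in> adjoin J k l"
    using adjoinI[of "a + b" J l "\<lambda>i. g i + h i" k] by (simp add: sum.distrib distrib_left add_ac)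
next
  fix x r assume "x \<in> adjoin J k l"
  then obtain a g where "x = a + (\<Sum>i<k. l i * g i)" "a \<in> J"
    by (auto simp: adjoin_def)
  moreover from this have "r * a \<in> J" using is_idlD(3)[OF assms] by blast
  ultimately show "r * x \<in> adjoin J k l"
    using adjoinI[of "r * a" J l "\<lambda>i. r * g i" k]
    by (simp add: sum_distrib_left distrib_left mult.left_commute)
qed

lemma adjoin_0 [simp]: "adjoin J 0 l = J" by (auto simp: adjoin_def)

lemma adjoin_superset: "J \<subseteq> adjoin J k l"
proof
  fix a assume "a \<in> J"
  then show "a \<in> adjoin J k l" using adjoinI[of a J l "\<lambda>_. 0" k] by simp
qed

lemma adjoin_gen: assumes "is_idl J" "i < k" shows "l i \<in> adjoin J k l"
proof -
  have "(\<Sum>j<k. l j * (if j = i then 1 else 0)) = l i"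
    using assms(2) by (simp add: if_distrib cong: if_cong)
  then show ?thesis using adjoinI[OF is_idlD(1)[OF assms(1)], of l "\<lambda>j. if j = i then 1 else 0" k] by simp
qed

lemma adjoin_least: "is_idl K \<Longrightarrow> J \<subseteq> K \<Longrightarrow> (\<And>i. i < k \<Longrightarrow> l i \<in> K) \<Longrightarrow> adjoin J k l \<subseteq> K"
  by (fastforce simp: adjoin_def intro!: is_idlD(2) is_idl_sum is_idlD(4))

lemma adjoin_mono: "J \<subseteq> K \<Longrightarrow> adjoin J k l \<subseteq> adjoin K k l"
  by (auto simp: adjoin_def)

lemma genideal_adjoin:
  assumes "is_idl J" shows "genideal R4 (J \<union> l ` {..<k}) = adjoin J k l"
proof (rule genideal_eqI)
  show "J \<union> l ` {..<k} \<subseteq> adjoin J k l"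
    using adjoin_superset[of J k l] adjoin_gen[OF assms] by auto
  show "adjoin J k l \<subseteq> K" if "is_idl K" "J \<union> l ` {..<k} \<subseteq> K" for K
    using that by (intro adjoin_least) auto
qed (rule adjoin_is_idl[OF assms])

lemma adjoin_homogeneous:
  assumes "homogeneous_ideal J" and l: "\<And>i. i < k \<Longrightarrow> l i \<in> forms (e i)"
  shows "homogeneous_ideal (adjoin J k l)"
  unfolding homogeneous_ideal_iff
proof (intro conjI ballI allI)
  show id: "is_idl (adjoin J k l)" using assms(1) by (auto simp: homogeneous_ideal_iff intro: adjoin_is_idl)
  fix x t assume "x \<in> adjoin J k l"
  then obtain a g where x: "x = a + (\<Sum>i<k. l i * g i)" "a \<in> J" by (auto simp: adjoin_def)
  have "hom_component t a \<in> adjoin J k l"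
    using x assms(1) subsetD[OF adjoin_superset] by (simp add: homogeneous_ideal_iff)
  moreover have "hom_component t (l i * g i) \<in> adjoin J k l" if "i < k" for i
  proof -
    have "l i * h \<in> adjoin J k l" for h
      by (rule is_idlD(4)[OF id adjoin_gen[OF _ that]]) (use assms(1) in \<open>simp add: homogeneous_ideal_iff\<close>)
    then show ?thesis
      using hom_component_mult_form[OF l[OF that], of t "g i"] is_idlD(1)[OF id] by simp
  qed
  ultimately show "hom_component t x \<in> adjoin J k l"
    unfolding x(1) hom_component_add hom_component_sum
    by (intro is_idlD(2)[OF id] is_idl_sum[OF id]) auto
qed

section \<open>Dimensions of finite-dimensional subspaces\<close>

text \<open>A locale without axioms of its own: it keeps the facts below apart from the global
  instance of \<^locale>\<open>vector_space\<close> for real vector spaces.\<close>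

locale fd_space = vector_space scale
  for scale :: "'a::field \<Rightarrow> 'b::ab_group_add \<Rightarrow> 'b"
begin

definition fin_dim :: "'b set \<Rightarrow> bool" where
  "fin_dim V \<longleftrightarrow> (\<exists>B. finite B \<and> V \<subseteq> span B)"

lemma fin_dim_subset: "fin_dim W \<Longrightarrow> V \<subseteq> W \<Longrightarrow> fin_dim V"
  unfolding fin_dim_def by blast

lemma fin_dim_basis:
  assumes "fin_dim V"
  obtains B where "B \<subseteq> V" "finite B" "independent B" "V \<subseteq> span B" "card B = dim V"
proof -
  obtain B where B: "B \<subseteq> V" "independent B" "V \<subseteq> span B" "card B = dim V"
    using basis_exists by blast
  obtain C where C: "finite C" "V \<subseteq> span C" using assms by (auto simp: fin_dim_def)
  have "finite B" using independent_span_bound[OF C(1) B(2)] B(1) C(2) by blast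
  then show thesis using B that by blast
qed

lemma fin_dim_sum:
  assumes "fin_dim V" "fin_dim W"
  shows "fin_dim {v + w | v w. v \<in> V \<and> w \<in> W}"
proof -
  obtain B C where B: "finite B" "V \<subseteq> span B" and C: "finite C" "W \<subseteq> span C"
    using assms by (auto simp: fin_dim_def)
  have "V \<subseteq> span (B \<union> C)" "W \<subseteq> span (B \<union> C)"
    using B C span_mono[of B "B \<union> C"] span_mono[of C "B \<union> C"] by auto
  then have "{v + w | v w. v \<in> V \<and> w \<in> W} \<subseteq> span (B \<union> C)"
    by (auto intro!: span_add)
  then show ?thesis using B C unfolding fin_dim_def by (intro exI[of _ "B \<union> C"]) auto
qed

lemma dim_mono_fin:
  assumes "V \<subseteq> W" "fin_dim W" shows "dim V \<le> dim W"
proof -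
  obtain B where B: "finite B" "W \<subseteq> span B" "card B = dim W"
    by (rule fin_dim_basis[OF assms(2)])
  then show ?thesis using dim_le_card[of V B] assms(1) by auto
qed

lemma card_le_dim_fin:
  assumes "fin_dim V" "B \<subseteq> V" "independent B" shows "card B \<le> dim V"
  using dim_mono_fin[OF assms(2,1)] dim_eq_card_independent[OF assms(3)] by simp

lemma dim_eq_imp_eq:
  assumes "subspace V" "V \<subseteq> W" "fin_dim W" "dim W \<le> dim V" shows "V = W"
proof (rule ccontr)
  assume "V \<noteq> W"
  then obtain w where w: "w \<in> W" "w \<notin> V" using assms(2) by blast
  obtain B where B: "B \<subseteq> V" "finite B" "independent B" "V \<subseteq> span B" "card B = dim V"
    by (rule fin_dim_basis[OF fin_dim_subset[OF assms(3,2)]])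
  have "span B \<subseteq> V" using B(1) assms(1) span_minimal by blast
  then have "w \<notin> span B" using w by blast
  then have "independent (insert w B)" using B(3) independent_insertI by blast
  moreover have "card (insert w B) = Suc (dim V)"
    using B \<open>w \<notin> span B\<close> span_base by (metis card_insert_disjoint)
  ultimately show False
    using card_le_dim_fin[OF assms(3), of "insert w B"] B(1) assms(2,4) w(1) by auto
qed

lemma independent_span_Int:
  assumes "independent (A \<union> B)" "A \<inter> B = {}" "x \<in> span A" "x \<in> span B"
  shows "x = 0"
proof -
  have A: "representation (A \<union> B) x = representation A x"
    using representation_extend[OF assms(1,3)] by auto
  have B: "representation (A \<union> B) x = representation B x"
    using representation_extend[OF assms(1,4)] by auto
  have "representation (A \<union> B) x b = 0" for b
    using A B assms(2) representation_ne_zero[of A x b] representation_ne_zero[of B x b] by fastforce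
  then show ?thesis
    using sum_nonzero_representation_eq[OF assms(1) subsetD[OF span_mono[of A "A \<union> B"] assms(3)]]
    by simp
qed

lemma exists_quotient_map:
  assumes "subspace A"
  obtains h where "Vector_Spaces.linear scale scale h" "\<And>x. h x = 0 \<longleftrightarrow> x \<in> A"
proof -
  interpret vp: vector_space_pair scale scale ..
  have id: "Vector_Spaces.linear scale scale (\<lambda>x. x)" by (rule linear_id[unfolded id_def])
  obtain g where g: "range g \<subseteq> A" "Vector_Spaces.linear scale scale g" "\<forall>v\<in>A. g v = v"
    using vp.linear_exists_left_inverse_on[OF id assms] by auto
  show thesis
  proof
    show "Vector_Spaces.linear scale scale (\<lambda>x. x - g x)"
      by (rule vp.linear_compose_sub[OF id g(2)])
    show "x - g x = 0 \<longleftrightarrow> x \<in> A" for x using g by (metis eq_iff_diff_eq_0 rangeI subsetD)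
  qed
qed

end

locale fd_space_pair = vs1: fd_space s1 + vs2: fd_space s2
  for s1 :: "'a::field \<Rightarrow> 'b::ab_group_add \<Rightarrow> 'b"
  and s2 :: "'a::field \<Rightarrow> 'c::ab_group_add \<Rightarrow> 'c"
begin

sublocale vector_space_pair s1 s2 ..

lemma fin_dim_image:
  assumes "Vector_Spaces.linear s1 s2 f" "vs1.fin_dim V" shows "vs2.fin_dim (f ` V)"
proof -
  obtain B where "finite B" "V \<subseteq> vs1.span B" using assms by (auto simp: vs1.fin_dim_def)
  then have "finite (f ` B)" "f ` V \<subseteq> vs2.span (f ` B)"
    using linear_span_image[OF assms(1), of B] by auto
  then show ?thesis unfolding vs2.fin_dim_def by blast
qed

text \<open>For finite-dimensional subspaces of arbitrary vector spaces: the polynomial ring itself is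
  infinite-dimensional.\<close>

lemma rank_nullity:
  assumes lin: "Vector_Spaces.linear s1 s2 f" and V: "vs1.subspace V" "vs1.fin_dim V"
  shows "vs1.dim V = vs2.dim (f ` V) + vs1.dim {v\<in>V. f v = 0}"
proof -
  let ?K = "{v\<in>V. f v = 0}"
  have "vs1.fin_dim ?K" by (rule vs1.fin_dim_subset[OF V(2)]) auto
  then obtain B where B: "B \<subseteq> ?K" "finite B" "vs1.independent B" "?K \<subseteq> vs1.span B" "card B = vs1.dim ?K"
    by (rule vs1.fin_dim_basis)
  obtain C where C: "B \<subseteq> C" "C \<subseteq> V" "vs1.independent C" "V \<subseteq> vs1.span C"
    using vs1.maximal_independent_subset_extend[of B V] B by blast
  have dimV: "vs1.dim V = card C" using vs1.basis_card_eq_dim[OF C(2,4,3)] by simp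
  have "finite C"
  proof -
    obtain E where "finite E" "V \<subseteq> vs1.span E" using V(2) by (auto simp: vs1.fin_dim_def)
    then show ?thesis using vs1.independent_span_bound[of E C] C by blast
  qed
  let ?D = "C - B"
  have inj0: "x = 0" if "x \<in> vs1.span ?D" "f x = 0" for x
  proof -
    have "x \<in> V" using that(1) C(2) V(1) vs1.span_minimal[of ?D V] by blast
    then have "x \<in> vs1.span B" using that B(4) by auto
    moreover have "?D \<union> B = C" using C(1) by blast
    ultimately show ?thesis using vs1.independent_span_Int[of ?D B x] C(3) that(1) by auto
  qed
  have inj: "inj_on f (vs1.span ?D)"
    using linear_inj_on_iff_eq_0[OF lin vs1.subspace_span] inj0 by blast
  have "vs1.independent ?D" using C(3) vs1.independent_mono by blast
  then have indep: "vs2.independent (f ` ?D)"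
    using linear_independent_injective_image[OF lin] inj by blast
  have f0: "f b = 0" if "b \<in> B" for b using that B(1) by auto
  have "f ` V \<subseteq> vs2.span (f ` C)" using C(4) linear_span_image[OF lin, of C] by auto
  also have "f ` C \<subseteq> vs2.span (f ` ?D)"
  proof
    fix y assume "y \<in> f ` C"
    then obtain c where c: "c \<in> C" "y = f c" by blast
    show "y \<in> vs2.span (f ` ?D)"
    proof (cases "c \<in> B")
      case True
      then show ?thesis using f0[of c] c vs2.span_zero by simp
    next
      case False
      then show ?thesis using c by (intro vs2.span_base) blast
    qed
  qed
  then have "vs2.span (f ` C) \<subseteq> vs2.span (f ` ?D)" by (rule vs2.span_minimal) (rule vs2.subspace_span)
  finally have span: "f ` V \<subseteq> vs2.span (f ` ?D)" .
  have "card (f ` ?D) = vs2.dim (f ` V)"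
    by (rule vs2.basis_card_eq_dim[OF _ span indep]) (use C(2) in auto)
  moreover have "card (f ` ?D) = card ?D"
    by (rule card_image) (rule inj_on_subset[OF inj], rule vs1.span_superset)
  moreover have "card C = card ?D + card B"
    using card_Diff_subset[OF B(2) C(1)] card_mono[OF \<open>finite C\<close> C(1)] by simp
  ultimately show ?thesis using dimV B(5) by simp
qed

lemma dim_image_inj:
  assumes "Vector_Spaces.linear s1 s2 f" "vs1.subspace V" "vs1.fin_dim V"
    and "\<And>v. v \<in> V \<Longrightarrow> f v = 0 \<Longrightarrow> v = 0"
  shows "vs2.dim (f ` V) = vs1.dim V"
proof -
  have "{v\<in>V. f v = 0} = {0}"
    using assms(4) linear_0[OF assms(1)] vs1.subspace_0[OF assms(2)] by auto
  moreover have "vs1.dim {0} = 0"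
    using vs1.dim_le_card[of "{0}" "{}"] by simp
  ultimately show ?thesis using rank_nullity[OF assms(1-3)] by simp
qed

end

text \<open>The map induces an injection \<open>B/A \<rightarrow> B'/A'\<close>. Quotient spaces are avoided by composing with a
  linear map \<open>h\<close> whose kernel is \<open>A'\<close> and comparing ranks.\<close>

lemma (in fd_space_pair) dim_quotient_mono:
  assumes lin: "Vector_Spaces.linear s1 s2 f"
    and A: "vs1.subspace A" "A \<subseteq> B" and B: "vs1.subspace B" "vs1.fin_dim B"
    and A': "vs2.subspace A'" "A' \<subseteq> B'" and B': "vs2.subspace B'" "vs2.fin_dim B'"
    and "\<And>x. x \<in> B \<Longrightarrow> f x \<in> B'" and "\<And>x. x \<in> B \<Longrightarrow> f x \<in> A' \<Longrightarrow> x \<in> A"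
  shows "vs1.dim B + vs2.dim A' \<le> vs2.dim B' + vs1.dim A"
proof -
  obtain h where h: "Vector_Spaces.linear s2 s2 h" "\<And>x. h x = 0 \<longleftrightarrow> x \<in> A'"
    using vs2.exists_quotient_map[OF A'(1)] by blast
  interpret p22: fd_space_pair s2 s2 ..
  have "{v\<in>B'. h v = 0} = A'" using h(2) A'(2) by auto
  then have 1: "vs2.dim B' = vs2.dim (h ` B') + vs2.dim A'"
    using p22.rank_nullity[OF h(1) B'] by simp
  have lin2: "Vector_Spaces.linear s1 s2 (h \<circ> f)" 
    using lin h(1) unfolding Vector_Spaces.linear_iff by simp
  have 2: "vs1.dim B = vs2.dim ((h \<circ> f) ` B) + vs1.dim {v\<in>B. (h \<circ> f) v = 0}"
    by (rule rank_nullity[OF lin2 B])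
  have "vs1.dim {v\<in>B. (h \<circ> f) v = 0} \<le> vs1.dim A"
    by (rule vs1.dim_mono_fin) (use assms h in \<open>auto intro: vs1.fin_dim_subset\<close>)
  moreover have "vs2.dim ((h \<circ> f) ` B) \<le> vs2.dim (h ` B')"
    by (rule vs2.dim_mono_fin) (use assms h in \<open>auto intro: p22.fin_dim_image\<close>)
  ultimately show ?thesis using 1 2 by linarith
qed

interpretation cs: fd_space "cscale :: complex \<Rightarrow> 'v cpoly \<Rightarrow> 'v cpoly" ..
interpretation csp: fd_space_pair "cscale :: complex \<Rightarrow> 'v cpoly \<Rightarrow> 'v cpoly"
  "cscale :: complex \<Rightarrow> 'v cpoly \<Rightarrow> 'v cpoly" ..

lemma linear_cpoly_mult: "Vector_Spaces.linear cscale cscale (\<lambda>g. f * g)"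
  unfolding Vector_Spaces.linear_iff
  by (auto simp: vector_space_cscale distrib_left cscale_mult_right)

subsection \<open>Spaces spanned by monomials\<close>

lemma monomials_span:
  assumes "keys f \<subseteq> S" shows "f \<in> cs.span ((\<lambda>m. single m 1) ` S)"
proof -
  have "(\<Sum>m\<in>keys f. cscale (lookup f m) (single m 1)) \<in> cs.span ((\<lambda>m. single m 1) ` S)"
    by (rule cs.span_sum, rule cs.span_scale, rule cs.span_base) (use assms in auto)
  then show ?thesis using cpoly_sum_cscale[of f] by simp
qed

lemma (in fd_space) independent_family:
  assumes I: "finite I" and indep: "\<And>c. (\<Sum>i\<in>I. scale (c i) (v i)) = 0 \<Longrightarrow> \<forall>i\<in>I. c i = 0"
  shows "inj_on v I" "independent (v ` I)"
proof -
  show inj: "inj_on v I"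
  proof (rule inj_onI, rule ccontr)
    fix i j assume ij: "i \<in> I" "j \<in> I" "v i = v j" "i \<noteq> j"
    let ?c = "\<lambda>k. (if k = i then 1 else 0) - (if k = j then 1 else 0)"
    have "(\<Sum>k\<in>I. scale (?c k) (v k)) =
        (\<Sum>k\<in>I. (if k = i then v k else 0)) - (\<Sum>k\<in>I. (if k = j then v k else 0))"
      unfolding sum_subtractf[symmetric] by (rule sum.cong) (auto simp: scale_left_diff_distrib)
    also have "\<dots> = 0" using ij I by (simp add: sum.delta)
    finally show False using indep[of ?c] ij by auto
  qed
  show "independent (v ` I)"
  proof (rule independent_if_scalars_zero)
    show "finite (v ` I)" using I by simp
    fix f x assume s: "(\<Sum>x\<in>v ` I. scale (f x) x) = 0" and x: "x \<in> v ` I"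
    have "(\<Sum>i\<in>I. scale (f (v i)) (v i)) = 0"
      using s by (simp add: sum.reindex[OF inj])
    then show "f x = 0" using indep[of "\<lambda>i. f (v i)"] x by auto
  qed
qed

lemma (in fd_space) dim_span_family:
  assumes "finite I" "\<And>c. (\<Sum>i\<in>I. scale (c i) (v i)) = 0 \<Longrightarrow> \<forall>i\<in>I. c i = 0"
  shows "dim (span (v ` I)) = card I"
  using dim_span_eq_card_independent[OF independent_family(2)[OF assms]]
    card_image[OF independent_family(1)[OF assms]] by simp

lemma dim_keys_subset:
  assumes "finite S"
  shows "cs.fin_dim {f :: 'v cpoly. keys f \<subseteq> S}" "cdim {f :: 'v cpoly. keys f \<subseteq> S} = card S"
proof -
  let ?v = "\<lambda>m::'v \<Rightarrow>\<^sub>0 nat. single m (1::complex)"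
  have span: "cs.span (?v ` S) = {f. keys f \<subseteq> S}"
  proof
    have "cs.subspace {f :: 'v cpoly. keys f \<subseteq> S}"
    proof (rule cs.subspaceI)
      fix x y :: "'v cpoly" and c
      assume "x \<in> {f. keys f \<subseteq> S}"
      then show "cscale c x \<in> {f. keys f \<subseteq> S}" by (auto simp: in_keys_iff subset_iff)
      assume "y \<in> {f. keys f \<subseteq> S}"
      then show "x + y \<in> {f. keys f \<subseteq> S}" using \<open>x \<in> {f. keys f \<subseteq> S}\<close> keys_add[of x y] by blast
    qed auto
    then show "cs.span (?v ` S) \<subseteq> {f. keys f \<subseteq> S}" by (intro cs.span_minimal) auto
  qed (use monomials_span in blast)
  show "cs.fin_dim {f :: 'v cpoly. keys f \<subseteq> S}"
    unfolding cs.fin_dim_def using assms span by (intro exI[of _ "?v ` S"]) auto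
  have "cdim (cs.span (?v ` S)) = card S"
  proof (rule cs.dim_span_family[OF assms])
    fix c :: "('v \<Rightarrow>\<^sub>0 nat) \<Rightarrow> complex" assume s: "(\<Sum>m\<in>S. cscale (c m) (?v m)) = 0"
    have "lookup (\<Sum>m\<in>S. cscale (c m) (?v m)) m = c m" if "m \<in> S" for m
    proof -
      have "lookup (\<Sum>m\<in>S. cscale (c m) (?v m)) m = (\<Sum>k\<in>S. if k = m then c k else 0)"
        unfolding lookup_sum by (rule sum.cong) (auto simp: lookup_single when_def)
      then show ?thesis using that assms by (simp add: sum.delta)
    qed
    then show "\<forall>m\<in>S. c m = 0" using s by simp
  qed
  then show "cdim {f :: 'v cpoly. keys f \<subseteq> S} = card S" using span by simp
qed

lemma mdeg_4: "mdeg m = lookup m 1 + lookup m 2 + lookup m 3 + lookup m 4"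
  by (simp add: mdeg_def sum_4)

lemma card_mdeg_eq:
  shows "finite {m. mdeg m = t}" "card {m. mdeg m = t} = (t + 3) choose 3"
proof -
  let ?L = "{l::nat list. length l = 4 \<and> sum_list l = t}"
  let ?f = "\<lambda>m::4 \<Rightarrow>\<^sub>0 nat. [lookup m 1, lookup m 2, lookup m 3, lookup m 4]"
  have "bij_betw ?f {m. mdeg m = t} ?L"
    unfolding bij_betw_def
  proof
    show "inj_on ?f {m. mdeg m = t}"
      by (rule inj_onI, rule poly_mapping_eqI) (simp, metis exhaust_4)
    show "?f ` {m. mdeg m = t} = ?L"
    proof (intro subset_antisym subsetI)
      fix l assume l: "l \<in> ?L"
      then obtain a b c e where abc: "l = [a, b, c, e]"
        by (auto simp: numeral_eq_Suc length_Suc_conv)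
      let ?m = "single (1::4) a + single 2 b + single 3 c + single 4 e"
      have "?f ?m = l" by (simp add: abc lookup_add lookup_single when_def)
      moreover have "mdeg ?m = t" using l by (simp add: abc mdeg_add)
      ultimately show "l \<in> ?f ` {m. mdeg m = t}" by (metis (mono_tags) image_eqI mem_Collect_eq)
    qed (auto simp: mdeg_4)
  qed
  then have bij: "bij_betw ?f {m. mdeg m = t} ?L" .
  have cardL: "card ?L = (t + 3) choose t"
    using card_length_sum_list[of 4 t] by (simp add: add.commute)
  have "t + 3 choose t > 0" by simp
  then have "finite ?L" using cardL by (metis card.infinite less_irrefl)
  then show "finite {m. mdeg m = t}" using bij bij_betw_finite by blast
  have "card {m. mdeg m = t} = (t + 3) choose t" using bij_betw_same_card[OF bij] cardL by simp
  also have "\<dots> = (t + 3) choose 3" using binomial_symmetric[of 3 "t + 3"] by simp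
  finally show "card {m. mdeg m = t} = (t + 3) choose 3" .
qed

lemma forms_eq_keys: "forms t = {f. keys f \<subseteq> {m. mdeg m = t}}"
  by (auto simp: forms_def)

lemma fin_dim_forms: "cs.fin_dim (forms t)"
  unfolding forms_eq_keys by (rule dim_keys_subset(1)[OF card_mdeg_eq(1)])

lemma dim_forms: "cdim (forms t) = (t + 3) choose 3"
  unfolding forms_eq_keys using dim_keys_subset(2)[OF card_mdeg_eq(1)] card_mdeg_eq(2) by simp

lemma fin_dim_polys_le: "cs.fin_dim (polys_le t)"
proof -
  have "{m. mdeg m \<le> t} = (\<Union>s\<le>t. {m. mdeg m = s})" by auto
  then have "finite {m. mdeg m \<le> t}" using card_mdeg_eq(1) by simp
  moreover have "polys_le t = {f. keys f \<subseteq> {m. mdeg m \<le> t}}" by (auto simp: polys_le_def)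
  ultimately show ?thesis using dim_keys_subset(1) by simp
qed

subsection \<open>Tuples of forms\<close>

text \<open>The graded pieces of a free module \<open>\<Oplus>\<^sub>i R(a i)\<close>, as tuples of forms.\<close>

definition tscale :: "complex \<Rightarrow> (nat \<Rightarrow> mpoly4) \<Rightarrow> nat \<Rightarrow> mpoly4" where
  "tscale c v = (\<lambda>i. cscale c (v i))"

definition form_tuples :: "nat \<Rightarrow> (nat \<Rightarrow> nat) \<Rightarrow> (nat \<Rightarrow> mpoly4) set" where
  "form_tuples m a = {v. (\<forall>i<m. v i \<in> forms (a i)) \<and> (\<forall>i\<ge>m. v i = 0)}"

lemma vector_space_tscale: "vector_space tscale"
  by unfold_locales
     (auto simp: tscale_def fun_eq_iff cs.scale_right_distrib cs.scale_left_distrib)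

interpretation ts: fd_space tscale by (simp add: fd_space_def vector_space_tscale)
interpretation tcs: fd_space_pair tscale "cscale :: complex \<Rightarrow> mpoly4 \<Rightarrow> mpoly4" ..
interpretation cts: fd_space_pair "cscale :: complex \<Rightarrow> mpoly4 \<Rightarrow> mpoly4" tscale ..
interpretation tts: fd_space_pair tscale tscale ..

lemma form_tuples_subspace: "ts.subspace (form_tuples m a)"
  by (rule ts.subspaceI) (auto simp: form_tuples_def tscale_def forms_add forms_cscale)

lemma dim_form_tuples:
  "ts.fin_dim (form_tuples m a) \<and> ts.dim (form_tuples m a) = (\<Sum>i<m. cdim (forms (a i)))"
proof (induction m)
  case 0
  have "form_tuples 0 a = {0}" by (auto simp: form_tuples_def fun_eq_iff)
  moreover have "ts.fin_dim {0}" unfolding ts.fin_dim_def by (intro exI[of _ "{}"]) simp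
  moreover have "ts.dim {0} = 0" using ts.dim_le_card[of "{0}" "{}"] by simp
  ultimately show ?case by simp
next
  case (Suc m)
  let ?V = "form_tuples (Suc m) a" and ?W = "form_tuples m a"
  let ?p = "\<lambda>v::nat \<Rightarrow> mpoly4. v m" and ?e = "\<lambda>(f::mpoly4) i. if i = m then f else 0"
  have linp: "Vector_Spaces.linear tscale cscale ?p"
    unfolding Vector_Spaces.linear_iff
    by (auto simp: vector_space_tscale vector_space_cscale tscale_def)
  have line: "Vector_Spaces.linear cscale tscale ?e"
    unfolding Vector_Spaces.linear_iff
    by (auto simp: vector_space_tscale vector_space_cscale tscale_def fun_eq_iff)
  have dec: "v = (v(m := 0)) + ?e (v m)" for v :: "nat \<Rightarrow> mpoly4"
    by (auto simp: fun_eq_iff)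
  have sub: "?V \<subseteq> {v + w | v w. v \<in> ?W \<and> w \<in> ?e ` forms (a m)}"
  proof
    fix v assume v: "v \<in> ?V"
    have "v(m := 0) \<in> ?W" "v m \<in> forms (a m)" using v by (auto simp: form_tuples_def)
    then show "v \<in> {v + w | v w. v \<in> ?W \<and> w \<in> ?e ` forms (a m)}" using dec[of v] by blast
  qed
  have fin: "ts.fin_dim ?V"
    by (rule ts.fin_dim_subset[OF ts.fin_dim_sum sub])
       (use Suc cts.fin_dim_image[OF line fin_dim_forms] in auto)
  have "?p ` ?V = forms (a m)"
  proof
    show "forms (a m) \<subseteq> ?p ` ?V"
    proof
      fix f assume "f \<in> forms (a m)"
      then have "?e f \<in> ?V" by (auto simp: form_tuples_def)
      from imageI[OF this, of ?p] show "f \<in> ?p ` ?V" by simp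
    qed
  qed (auto simp: form_tuples_def)
  moreover have "{v\<in>?V. ?p v = 0} = ?W"
  proof -
    have "(\<forall>i\<ge>m. v i = 0) \<longleftrightarrow> v m = 0 \<and> (\<forall>i\<ge>Suc m. v i = 0)" for v :: "nat \<Rightarrow> mpoly4"
      by (metis Suc_leD Suc_leI le_neq_implies_less order_refl)
    then show ?thesis unfolding form_tuples_def less_Suc_eq by auto
  qed
  ultimately have "ts.dim ?V = cdim (forms (a m)) + ts.dim ?W"
    using tcs.rank_nullity[OF linp form_tuples_subspace fin] by simp
  then show ?case using Suc fin by simp
qed

section \<open>Linear sections and chains of homogeneous primes\<close>

text \<open>\<open>good k J\<close>: some \<open>k\<close> linear forms cut \<open>J\<close> down to an ideal containing a power of the
  irrelevant ideal. For a homogeneous ideal this says that a linear subspace of codimension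
  \<open>k\<close> misses the zero locus of \<open>J\<close>.\<close>

definition good :: "nat \<Rightarrow> mpoly4 set \<Rightarrow> bool" where
  "good k J \<longleftrightarrow> (\<exists>l s. (\<forall>i<k. l i \<in> forms 1) \<and> forms s \<subseteq> adjoin J k l)"

lemma monomial_pred:
  assumes "mdeg m = Suc t"
  obtains k m' where "m = single k 1 + m'" "mdeg m' = t"
proof -
  have "\<exists>k. lookup m k \<noteq> 0"
    using assms by (rule_tac ccontr) (simp add: mdeg_def)
  then obtain k where k: "lookup m k \<noteq> 0" by blast
  have "m = single k 1 + (m - single k 1)"
    by (rule poly_mapping_eqI) (use k in \<open>auto simp: lookup_add lookup_minus lookup_single when_def\<close>)
  then show thesis using that[of k "m - single k 1"] assms mdeg_add[of "single k 1" "m - single k 1"] by simp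
qed

lemma monomial_split:
  assumes "mdeg m = s + t"
  obtains m1 m2 where "m = m1 + m2" "mdeg m1 = s" "mdeg m2 = t"
  using assms
proof (induction s arbitrary: m thesis)
  case 0
  then show ?case by (metis add_0 mdeg_0)
next
  case (Suc s)
  obtain k m' where m': "m = single k 1 + m'" "mdeg m' = s + t"
    using monomial_pred[of m "s + t"] Suc.prems(2) by auto
  obtain m1 m2 where "m' = m1 + m2" "mdeg m1 = s" "mdeg m2 = t" using Suc.IH m'(2) by blast
  then show ?case using Suc.prems(1)[of "single k 1 + m1" m2] m' by (simp add: mdeg_add add.assoc)
qed

lemma forms_subset_ideal_iff:
  assumes "is_idl K"
  shows "forms s \<subseteq> K \<longleftrightarrow> (\<forall>m. mdeg m = s \<longrightarrow> single m 1 \<in> K)"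
proof
  assume "\<forall>m. mdeg m = s \<longrightarrow> single m 1 \<in> K"
  then have "(\<Sum>m\<in>keys f. cscale (lookup f m) (single m 1)) \<in> K" if "f \<in> forms s" for f
    using that by (intro is_idl_sum[OF assms] is_idl_cscale[OF assms]) (auto simp: forms_def)
  then show "forms s \<subseteq> K" using cpoly_sum_cscale by (metis subsetI)
qed (use forms_single in blast)

lemma forms_subset_product:
  assumes "is_idl K" and "\<And>f g. f \<in> forms s \<Longrightarrow> g \<in> forms t \<Longrightarrow> f * g \<in> K"
  shows "forms (s + t) \<subseteq> K"
  unfolding forms_subset_ideal_iff[OF assms(1)]
proof (intro allI impI)
  fix m :: "4 \<Rightarrow>\<^sub>0 nat" assume "mdeg m = s + t"
  then obtain m1 m2 where m: "m = m1 + m2" "mdeg m1 = s" "mdeg m2 = t" by (rule monomial_split)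
  have "single m1 1 * single m2 1 \<in> K" using m forms_single by (intro assms(2)) blast+
  then show "single m 1 \<in> K" by (simp add: mult_single m)
qed

lemma forms_subset_mono:
  assumes "is_idl K" "forms s \<subseteq> K" "s \<le> t" shows "forms t \<subseteq> K"
proof -
  have "forms (s + (t - s)) \<subseteq> K"
    by (rule forms_subset_product[OF assms(1)]) (use assms is_idlD(4)[OF assms(1)] in blast)
  then show ?thesis using assms(3) by simp
qed

subsection \<open>Pencils of linear forms\<close>

text \<open>The determinant is a polynomial in \<open>t\<close> with value \<open>1\<close> at \<open>t = 0\<close>.\<close>

lemma finite_singular_parameters:
  fixes K :: "complex mat" assumes K: "K \<in> carrier_mat n n"
  shows "finite {t. Determinant.det (1\<^sub>m n + t \<cdot>\<^sub>m K) = 0}"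
proof -
  define P where "P = mat n n (\<lambda>(a, b). [:if a = b then 1 else 0, K $$ (a, b):])"
  interpret pe: comm_ring_hom "\<lambda>p. poly p t" for t :: complex
    by unfold_locales auto
  have M: "map_mat (\<lambda>p. poly p t) P = 1\<^sub>m n + t \<cdot>\<^sub>m K" for t
    by (rule eq_matI) (use K in \<open>auto simp: P_def\<close>)
  have *: "poly (Determinant.det P) t = Determinant.det (1\<^sub>m n + t \<cdot>\<^sub>m K)" for t
    using pe.hom_det[of t P] M by simp
  have "1\<^sub>m n + 0 \<cdot>\<^sub>m K = 1\<^sub>m n" by (rule eq_matI) (use K in auto)
  then have "poly (Determinant.det P) 0 = 1" using *[of 0] by simp
  then have "Determinant.det P \<noteq> 0" by auto
  then show ?thesis using poly_roots_finite[of "Determinant.det P"] * by simp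
qed

text \<open>Linear sections that miss the zero locus form an open set. Write each monomial of degree \<open>s\<close> as
  \<open>a + \<Sum>\<^sub>i l\<^sub>i g\<^sub>i\<close> with \<open>a \<in> J\<close>. Replacing \<open>l\<^sub>i\<close> by \<open>l\<^sub>i + t h\<^sub>i\<close> on the right yields elements of the
  moved ideal whose coefficients form a matrix \<open>1 + t K\<close>. Where it is invertible, the monomials are
  combinations of these elements.\<close>

lemma pencil_cofinite:
  assumes J: "homogeneous_ideal J" and l: "\<And>i. i < k \<Longrightarrow> l i \<in> forms 1"
    and h: "\<And>i. i < k \<Longrightarrow> h i \<in> forms 1"
    and s: "s > 0" "forms s \<subseteq> adjoin J k l"
  shows "finite {t. \<not> forms s \<subseteq> adjoin J k (\<lambda>i. l i + cscale t (h i))}"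
proof -
  have Jid: "is_idl J" using J by (simp add: homogeneous_ideal_iff)
  obtain ms where ms: "set ms = {m. mdeg m = s}" "distinct ms"
    using finite_distinct_list[OF card_mdeg_eq(1)] by blast
  define n where "n = length ms"
  have "\<exists>a g. a \<in> J \<and> (\<forall>i. g i \<in> forms (s - 1)) \<and> single m 1 = a + (\<Sum>i<k. l i * g i)"
    if "mdeg m = s" for m
  proof -
    have "single m 1 \<in> adjoin J k l" using s(2) that forms_single by blast
    then obtain a g where ag: "single m 1 = a + (\<Sum>i<k. l i * g i)" "a \<in> J" by (auto simp: adjoin_def)
    have "single m 1 = hom_component s (single m 1)"
      using that forms_single by (metis hom_component_id)
    also have "\<dots> = hom_component s a + (\<Sum>i<k. l i * hom_component (s - 1) (g i))"
      unfolding ag(1) hom_component_add hom_component_sum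
      using hom_component_mult_form[OF l] s(1) by simp
    finally show ?thesis using J ag(2) hom_component_forms
      by (intro exI[of _ "hom_component s a"] exI[of _ "\<lambda>i. hom_component (s - 1) (g i)"])
         (auto simp: homogeneous_ideal_iff)
  qed
  then have "\<forall>m\<in>{m. mdeg m = s}. \<exists>p. fst p \<in> J \<and> (\<forall>i. snd p i \<in> forms (s - 1)) \<and>
      single m 1 = fst p + (\<Sum>i<k. l i * snd p i)" by simp
  from bchoice[OF this] obtain p where p: "\<forall>m\<in>{m. mdeg m = s}. fst (p m) \<in> J \<and>
      (\<forall>i. snd (p m) i \<in> forms (s - 1)) \<and> single m 1 = fst (p m) + (\<Sum>i<k. l i * snd (p m) i)" ..
  define a where "a m = fst (p m)" for m
  define g where "g m = snd (p m)" for m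
  have ag: "\<And>m. mdeg m = s \<Longrightarrow> a m \<in> J" "\<And>m i. mdeg m = s \<Longrightarrow> g m i \<in> forms (s - 1)"
    "\<And>m. mdeg m = s \<Longrightarrow> single m 1 = a m + (\<Sum>i<k. l i * g m i)"
    using p by (simp_all add: a_def g_def)
  define q where "q m = (\<Sum>i<k. h i * g m i)" for m
  have q: "q m \<in> forms s" if "mdeg m = s" for m
    unfolding q_def using forms_mult[OF h ag(2)[OF that]] s(1) by (intro forms_sum) simp
  define K where "K = mat n n (\<lambda>(i, j). lookup (q (ms ! i)) (ms ! j))"
  have K: "K \<in> carrier_mat n n" by (simp add: K_def)
  have msn: "mdeg (ms ! i) = s" if "i < n" for i using ms(1) that nth_mem unfolding n_def by fastforce
  have "Determinant.det (1\<^sub>m n + t \<cdot>\<^sub>m K) = 0" if t: "\<not> forms s \<subseteq> adjoin J k (\<lambda>i. l i + cscale t (h i))" for t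
  proof (rule ccontr)
    let ?A = "adjoin J k (\<lambda>i. l i + cscale t (h i))"
    have Aid: "is_idl ?A" by (rule adjoin_is_idl[OF Jid])
    define M where "M = 1\<^sub>m n + t \<cdot>\<^sub>m K"
    have M: "M \<in> carrier_mat n n" using K by (simp add: M_def)
    define w where "w m = single m 1 + cscale t (q m)" for m
    have w: "w m \<in> ?A" if "mdeg m = s" for m
    proof -
      have eq: "w m = a m + (\<Sum>i<k. (l i + cscale t (h i)) * g m i)"
        unfolding w_def ag(3)[OF that] q_def
        by (simp add: cs.scale_sum_right cscale_mult_left distrib_right sum.distrib add.assoc)
      show ?thesis unfolding eq by (rule adjoinI[OF ag(1)[OF that]])
    qed
    have wf: "w m \<in> forms s" if "mdeg m = s" for m
      unfolding w_def using that forms_single by (intro forms_add forms_cscale q) blast+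
    have wM: "lookup (w (ms ! i)) (ms ! j) = M $$ (i, j)" if "i < n" "j < n" for i j
      using that K ms(2) by (auto simp: w_def M_def K_def lookup_add lookup_single when_def n_def nth_eq_iff_index_eq)
    \<comment> \<open>The adjugate of \<open>M\<close> expresses the monomials through the elements \<open>w\<close> of the moved ideal.\<close>
    assume "Determinant.det (1\<^sub>m n + t \<cdot>\<^sub>m K) \<noteq> 0"
    then have det: "Determinant.det M \<noteq> 0" by (simp add: M_def)
    have inA: "single (ms ! i) 1 \<in> ?A" if i: "i < n" for i
    proof -
      let ?B = "adj_mat M"
      have B: "?B \<in> carrier_mat n n" "?B * M = Determinant.det M \<cdot>\<^sub>m 1\<^sub>m n" using adj_mat[OF M] by auto
      let ?y = "\<Sum>b<n. cscale (?B $$ (i, b)) (w (ms ! b))"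
      have yA: "?y \<in> ?A" using w msn by (intro is_idl_sum[OF Aid] is_idl_cscale[OF Aid]) auto
      have "?y = cscale (Determinant.det M) (single (ms ! i) 1)"
      proof (rule poly_mapping_eqI)
        fix m
        show "lookup ?y m = lookup (cscale (Determinant.det M) (single (ms ! i) 1)) m"
        proof (cases "mdeg m = s")
          case True
          then have "m \<in> set ms" using ms(1) by simp
          then obtain j where j: "j < n" "m = ms ! j" by (auto simp: in_set_conv_nth n_def)
          have "lookup ?y m = (\<Sum>b<n. ?B $$ (i, b) * M $$ (b, j))"
            using j wM by (simp add: lookup_sum)
          also have "\<dots> = (?B * M) $$ (i, j)"
            using i j B(1) M by (simp add: scalar_prod_def lessThan_atLeast0)
          also have "\<dots> = lookup (cscale (Determinant.det M) (single (ms ! i) 1)) m"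
            using i j ms(2) unfolding B(2) by (auto simp: lookup_single when_def n_def nth_eq_iff_index_eq)
          finally show ?thesis .
        next
          case False
          have "?y \<in> forms s" using wf msn by (intro forms_sum forms_cscale) auto
          then have "lookup ?y m = 0" using False by (auto simp: forms_iff)
          moreover have "ms ! i \<noteq> m" using False msn[OF i] by auto
          ultimately show ?thesis by (simp add: lookup_single when_def)
        qed
      qed
      from arg_cong[OF this, of "cscale (inverse (Determinant.det M))"]
      have "cscale (inverse (Determinant.det M)) ?y = single (ms ! i) 1"
        unfolding cs.scale_scale left_inverse[OF det] cs.scale_one .
      from this[symmetric] show ?thesis by (rule ssubst) (rule is_idl_cscale[OF Aid yA])
    qed
    have "forms s \<subseteq> ?A"
      unfolding forms_subset_ideal_iff[OF Aid]
    proof (intro allI impI)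
      fix m :: "4 \<Rightarrow>\<^sub>0 nat" assume "mdeg m = s"
      then have "m \<in> set ms" using ms(1) by simp
      then show "single m 1 \<in> ?A" using inA by (auto simp: in_set_conv_nth n_def)
    qed
    then show False using t by simp
  qed
  then show ?thesis using finite_singular_parameters[OF K] by (auto intro: finite_subset[rotated])
qed

text \<open>Join the two systems of linear forms by a pencil. Each of the two conditions excludes only
  finitely many members of it.\<close>

lemma good_common:
  assumes J1: "homogeneous_ideal J1" "good k J1" and J2: "homogeneous_ideal J2" "good k J2"
  obtains l s where "\<forall>i<k. l i \<in> forms 1" "forms s \<subseteq> adjoin J1 k l" "forms s \<subseteq> adjoin J2 k l"
proof -
  have id: "is_idl J1" "is_idl J2" using J1 J2 by (auto simp: homogeneous_ideal_iff)
  obtain l1 s1 where 1: "\<forall>i<k. l1 i \<in> forms 1" "forms s1 \<subseteq> adjoin J1 k l1"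
    using J1(2) by (auto simp: good_def)
  obtain l2 s2 where 2: "\<forall>i<k. l2 i \<in> forms 1" "forms s2 \<subseteq> adjoin J2 k l2"
    using J2(2) by (auto simp: good_def)
  \<comment> \<open>The successor ensures \<open>s > 0\<close>, so that degree \<open>s\<close> leaves room for the linear forms.\<close>
  define s where "s = Suc (max s1 s2)"
  have s: "forms s \<subseteq> adjoin J1 k l1" "forms s \<subseteq> adjoin J2 k l2" "s > 0"
    using forms_subset_mono[OF adjoin_is_idl[OF id(1)] 1(2)] forms_subset_mono[OF adjoin_is_idl[OF id(2)] 2(2)]
    by (auto simp: s_def)
  \<comment> \<open>Seen from \<open>l2\<close>, the member of the pencil with parameter \<open>t\<close> has parameter \<open>1 - t\<close>.\<close>
  let ?l = "\<lambda>t i. l1 i + cscale t (l2 i - l1 i)"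
  let ?T1 = "{t. \<not> forms s \<subseteq> adjoin J1 k (?l t)}"
  let ?T2 = "{t. \<not> forms s \<subseteq> adjoin J2 k (\<lambda>i. l2 i + cscale t (l1 i - l2 i))}"
  have "finite ?T1" by (rule pencil_cofinite[OF J1(1)]) (use 1 2 s in \<open>auto intro: forms_diff\<close>)
  moreover have "finite ?T2" by (rule pencil_cofinite[OF J2(1)]) (use 1 2 s in \<open>auto intro: forms_diff\<close>)
  ultimately have fin: "finite (?T1 \<union> (\<lambda>t. 1 - t) ` ?T2)" by simp
  obtain t where t: "t \<notin> ?T1 \<union> (\<lambda>t. 1 - t) ` ?T2"
    by (rule exE[OF ex_new_if_finite[OF infinite_UNIV_char_0 fin]])
  have "1 - t \<notin> ?T2"
  proof
    assume "1 - t \<in> ?T2"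
    from imageI[OF this, of "\<lambda>t. 1 - t"] have "t \<in> (\<lambda>t. 1 - t) ` ?T2"
      by (simp only: diff_diff_eq2 add_diff_cancel_left')
    then show False using t by blast
  qed
  moreover have "(\<lambda>i. l2 i + cscale (1 - t) (l1 i - l2 i)) = ?l t"
    by (rule ext) (simp add: cs.scale_left_diff_distrib cs.scale_right_diff_distrib algebra_simps)
  ultimately have "forms s \<subseteq> adjoin J2 k (?l t)" by simp
  moreover have "forms s \<subseteq> adjoin J1 k (?l t)" using t by blast
  moreover have "\<forall>i<k. ?l t i \<in> forms 1" using 1(1) 2(1) by (intro allI impI forms_add forms_cscale forms_diff) blast+
  ultimately show thesis using that[of "?l t" s] by simp
qed

subsection \<open>Maximal bad ideals are prime\<close>

text \<open>If \<open>f g \<in> J\<close> with neither factor in \<open>J\<close>, compare the components of lowest degree outside \<open>J\<close>: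
  their product differs from a component of \<open>f g\<close> by an element of \<open>J\<close>.\<close>

lemma homogeneous_primeI:
  assumes J: "homogeneous_ideal J" "J \<noteq> UNIV"
    and prime: "\<And>f g s t. f \<in> forms s \<Longrightarrow> g \<in> forms t \<Longrightarrow> f * g \<in> J \<Longrightarrow> f \<in> J \<or> g \<in> J"
  shows "primeideal J R4"
  unfolding primeideal_R4_iff
proof (intro conjI allI impI)
  show id: "is_idl J" using J by (simp add: homogeneous_ideal_iff)
  have comp: "hom_component t x \<in> J" if "x \<in> J" for x t using that J by (simp add: homogeneous_ideal_iff)
  fix f g assume fg: "f * g \<in> J"
  show "f \<in> J \<or> g \<in> J"
  proof (rule ccontr)
    assume "\<not> (f \<in> J \<or> g \<in> J)"
    then have no: "f \<notin> J" "g \<notin> J" by auto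
    have ex: "\<exists>t. hom_component t x \<notin> J \<and> (\<forall>s<t. hom_component s x \<in> J)" if "x \<notin> J" for x
    proof -
      obtain t where "x \<in> polys_le t" using polys_le_exists by blast
      then have "\<exists>s. hom_component s x \<notin> J"
        using polys_le_sum_components is_idl_sum[OF id] that by metis
      then show ?thesis by (subst (asm) exists_least_iff) simp
    qed
    obtain a where a: "hom_component a f \<notin> J" "\<forall>s<a. hom_component s f \<in> J" using ex no by blast
    obtain b where b: "hom_component b g \<notin> J" "\<forall>s<b. hom_component s g \<in> J" using ex no by blast
    obtain N where N: "f \<in> polys_le N" using polys_le_exists by blast
    define n where "n = max N (a + b)"
    have fN: "f = (\<Sum>s\<le>n. hom_component s f)"
      using polys_le_sum_components polys_le_mono[of N n] N by (auto simp: n_def)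
    have "hom_component (a + b) (f * g) = (\<Sum>s\<le>n. hom_component (a + b) (hom_component s f * g))"
      by (subst fN) (simp add: sum_distrib_right hom_component_sum)
    also have "\<dots> = (\<Sum>s\<le>n. if s \<le> a + b then hom_component s f * hom_component (a + b - s) g else 0)"
      by (simp add: hom_component_mult_form[OF hom_component_forms])
    also have "\<dots> = hom_component a f * hom_component b g +
        (\<Sum>s\<in>{..n} - {a}. if s \<le> a + b then hom_component s f * hom_component (a + b - s) g else 0)"
      by (subst sum.remove[of _ a]) (auto simp: n_def)
    finally have eq: "hom_component a f * hom_component b g = hom_component (a + b) (f * g) -
        (\<Sum>s\<in>{..n} - {a}. if s \<le> a + b then hom_component s f * hom_component (a + b - s) g else 0)"
      by simp
    have part: "(if s \<le> a + b then hom_component s f * hom_component (a + b - s) g else 0) \<in> J" if "s \<noteq> a" for s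
    proof (cases "s < a")
      case True
      then show ?thesis using a(2) is_idlD(1,4)[OF id] by auto
    next
      case False
      then have "a + b - s < b" if "s \<le> a + b" using \<open>s \<noteq> a\<close> that by linarith
      then show ?thesis using b(2) is_idlD(1,3)[OF id] by auto
    qed
    have "hom_component a f * hom_component b g \<in> J"
      unfolding eq by (intro is_idlD(6)[OF id] comp fg is_idl_sum[OF id] part) auto
    then show False using prime[OF hom_component_forms hom_component_forms] a b by blast
  qed
qed (use J in auto)

text \<open>If \<open>f\<close> and \<open>g\<close> are forms outside \<open>J\<close>, then \<open>J + (f)\<close> and \<open>J + (g)\<close> are good by maximality, with
  common linear forms \<open>l\<close>. If \<open>f g\<close> were in \<open>J\<close>, the product of these two ideals enlarged by \<open>l\<close>
  would lie in \<open>J + (l)\<close>, and \<open>J\<close> would be good.\<close>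

lemma maximal_bad_prime:
  assumes J: "homogeneous_ideal J" "\<not> good k J"
    and max: "\<And>K. homogeneous_ideal K \<Longrightarrow> \<not> good k K \<Longrightarrow> J \<subseteq> K \<Longrightarrow> K = J"
  shows "primeideal J R4"
proof (rule homogeneous_primeI[OF J(1)])
  have id: "is_idl J" using J by (simp add: homogeneous_ideal_iff)
  show "J \<noteq> UNIV"
  proof
    assume "J = UNIV"
    then have "good k J" unfolding good_def
      using adjoin_superset[of UNIV k "\<lambda>_. 0"] by (intro exI[of _ "\<lambda>_. 0"] exI[of _ 0]) auto
    then show False using J by simp
  qed
  fix f g s t assume fg: "f \<in> forms s" "g \<in> forms t" "f * g \<in> J"
  show "f \<in> J \<or> g \<in> J"
  proof (rule ccontr)
    assume no: "\<not> (f \<in> J \<or> g \<in> J)"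
    let ?J = "\<lambda>f. adjoin J 1 (\<lambda>_. f)"
    have good: "homogeneous_ideal (?J x) \<and> good k (?J x)" if "x \<in> forms u" "x \<notin> J" for x u
    proof
      show h: "homogeneous_ideal (?J x)" by (rule adjoin_homogeneous[OF J(1)]) (rule that(1))
      have "x \<in> ?J x" using adjoin_gen[OF id, of 0 1 "\<lambda>_. x"] by simp
      then have "?J x \<noteq> J" using that(2) by blast
      then show "good k (?J x)" using max[OF h _ adjoin_superset] by blast
    qed
    obtain l S where l: "\<forall>i<k. l i \<in> forms 1" "forms S \<subseteq> adjoin (?J f) k l" "forms S \<subseteq> adjoin (?J g) k l"
      using good_common[of "?J f" k "?J g"] good[OF fg(1)] good[OF fg(2)] no by blast
    let ?K = "adjoin J k l"
    have K: "is_idl ?K" by (rule adjoin_is_idl[OF id])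
    have dec: "\<exists>u p. u \<in> ?K \<and> y = u + x * p" if "y \<in> adjoin (?J x) k l" for x y
    proof -
      from that obtain b h where 1: "y = b + (\<Sum>i<k. l i * h i)" "b \<in> ?J x"
        unfolding adjoin_def[of "?J x"] by blast
      obtain a p where 2: "b = a + x * p" "a \<in> J" using 1(2) by (auto simp: adjoin_def)
      have "y = (a + (\<Sum>i<k. l i * h i)) + x * p" by (simp add: 1 2 algebra_simps)
      then show ?thesis using adjoinI[OF 2(2)] by blast
    qed
    have "forms (S + S) \<subseteq> ?K"
    proof (rule forms_subset_product[OF K])
      fix x y assume "x \<in> forms S" "y \<in> forms S"
      then obtain u p v q where uv: "u \<in> ?K" "x = u + f * p" "v \<in> ?K" "y = v + g * q"
        using l dec[of x f] dec[of y g] by blast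
      have "x * y = u * y + (f * p) * v + (f * g) * (p * q)"
        by (simp add: uv algebra_simps)
      moreover have "f * g \<in> ?K" using fg(3) adjoin_superset by blast
      ultimately show "x * y \<in> ?K"
        using uv is_idlD(2,3,4)[OF K] by auto
    qed
    then show False using J(2) l(1) unfolding good_def by blast
  qed
qed

lemma union_chain_is_idl:
  assumes C: "C \<noteq> {}" "subset.chain A C" and id: "\<And>K. K \<in> C \<Longrightarrow> is_idl K"
  shows "is_idl (\<Union>C)"
  unfolding is_idl_def
proof (intro conjI ballI allI)
  show "0 \<in> \<Union>C" using C(1) id is_idlD(1) by blast
next
  fix x y assume "x \<in> \<Union>C" "y \<in> \<Union>C"
  then obtain U V where UV: "U \<in> C" "V \<in> C" "x \<in> U" "y \<in> V" by blast
  moreover have "U \<subseteq> V \<or> V \<subseteq> U" using C(2) UV(1,2) unfolding subset_chain_def by blast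
  ultimately obtain Z where "Z \<in> C" "x \<in> Z" "y \<in> Z" by blast
  then show "x + y \<in> \<Union>C" using is_idlD(2)[OF id] by blast
next
  fix x r assume "x \<in> \<Union>C"
  then show "r * x \<in> \<Union>C" using is_idlD(3)[OF id] by blast
qed

text \<open>Zorn's lemma applies because goodness of the union of a chain is witnessed by finitely many
  elements, one for each monomial of degree \<open>s\<close>, and these lie in one member of the chain.\<close>

lemma exists_maximal_bad:
  assumes J: "homogeneous_ideal J" "\<not> good k J"
  obtains P where "homogeneous_ideal P" "\<not> good k P" "J \<subseteq> P"
    "\<And>K. homogeneous_ideal K \<Longrightarrow> \<not> good k K \<Longrightarrow> P \<subseteq> K \<Longrightarrow> K = P"
proof -
  let ?A = "{K. homogeneous_ideal K \<and> \<not> good k K \<and> J \<subseteq> K}"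
  have "\<exists>M\<in>(?A). \<forall>U\<in>(?A). M \<subseteq> U \<longrightarrow> U = M"
  proof (rule subset_Zorn_nonempty)
    show "?A \<noteq> {}" using J by blast
    fix C assume C: "C \<noteq> {}" "subset.chain ?A C"
    have CA: "C \<subseteq> ?A" using C(2) by (auto simp: subset.chain_def)
    have hom: "homogeneous_ideal K" "is_idl K" if "K \<in> C" for K
      using that CA by (auto simp: homogeneous_ideal_iff)
    have "hom_component t x \<in> \<Union>C" if "x \<in> \<Union>C" for x t
      using that hom(1) by (auto simp: homogeneous_ideal_iff)
    then have UC: "homogeneous_ideal (\<Union>C)"
      using union_chain_is_idl[OF C hom(2)] unfolding homogeneous_ideal_iff by blast
    have "\<not> good k (\<Union>C)"
    proof
      assume "good k (\<Union>C)"
      then obtain l s where l: "\<forall>i<k. l i \<in> forms 1" "forms s \<subseteq> adjoin (\<Union>C) k l" by (auto simp: good_def)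
      have "\<exists>a\<in>\<Union>C. \<exists>g. single m 1 = a + (\<Sum>i<k. l i * g i)" if "mdeg m = s" for m
      proof -
        have "single m 1 \<in> adjoin (\<Union>C) k l" using l(2) that forms_single by blast
        then show ?thesis by (auto simp: adjoin_def)
      qed
      then have "\<forall>m\<in>{m. mdeg m = s}. \<exists>a. a \<in> \<Union>C \<and> (\<exists>g. single m 1 = a + (\<Sum>i<k. l i * g i))" by blast
      from bchoice[OF this] obtain a where ag: "\<And>m. mdeg m = s \<Longrightarrow> a m \<in> \<Union>C"
        "\<And>m. mdeg m = s \<Longrightarrow> \<exists>g. single m 1 = a m + (\<Sum>i<k. l i * g i)" by auto
      have "finite (a ` {m. mdeg m = s})" "a ` {m. mdeg m = s} \<subseteq> \<Union>C" using card_mdeg_eq(1) ag(1) by auto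
      then obtain K where K: "K \<in> C" "a ` {m. mdeg m = s} \<subseteq> K"
        using finite_subset_Union_chain[OF _ _ C(1) C(2)] by metis
      have "forms s \<subseteq> adjoin K k l"
        unfolding forms_subset_ideal_iff[OF adjoin_is_idl[OF hom(2)[OF K(1)]]]
      proof (intro allI impI)
        fix m :: "4 \<Rightarrow>\<^sub>0 nat" assume m: "mdeg m = s"
        then obtain g where g: "single m 1 = a m + (\<Sum>i<k. l i * g i)" using ag(2) by blast
        have "a m \<in> K" using K(2) m by blast
        then show "single m 1 \<in> adjoin K k l" unfolding g by (rule adjoinI)
      qed
      then have "good k K" using l(1) by (auto simp: good_def)
      then show False using K(1) CA by blast
    qed
    then show "\<Union>C \<in> ?A" using UC C(1) CA by blast
  qed
  then obtain M where M: "M \<in> ?A" "\<forall>U\<in>(?A). M \<subseteq> U \<longrightarrow> U = M" by blast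
  show thesis by (rule that[of M]) (use M in auto)
qed

text \<open>A maximal bad ideal contains neither \<open>1\<close> nor all linear forms, since it would be good otherwise;
  hence it is a point of the projective scheme.\<close>

lemma bad_prime:
  assumes J: "homogeneous_ideal J" "\<not> good k J"
  obtains P where "homogeneous_ideal P" "\<not> good k P" "P \<in> proj_points J" "\<not> forms 1 \<subseteq> P"
proof -
  obtain P where P: "homogeneous_ideal P" "\<not> good k P" "J \<subseteq> P"
    and max: "\<And>K. homogeneous_ideal K \<Longrightarrow> \<not> good k K \<Longrightarrow> P \<subseteq> K \<Longrightarrow> K = P"
    using exists_maximal_bad[OF J] by blast
  have prime: "primeideal P R4" using maximal_bad_prime[OF P(1,2) max] .
  have no1: "\<not> forms 1 \<subseteq> P"
  proof
    assume "forms 1 \<subseteq> P"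
    then have "forms 1 \<subseteq> adjoin P k (\<lambda>_. 0)" using adjoin_superset by blast
    then have "good k P" unfolding good_def by (intro exI[of _ "\<lambda>_. 0"] exI[of _ 1]) auto
    then show False using P by simp
  qed
  have "forms 1 \<subseteq> irrelevant_ideal"
  proof
    fix f assume "f \<in> forms 1"
    then have "lookup f 0 \<noteq> 0 \<longrightarrow> mdeg 0 = 1" unfolding forms_iff by blast
    then show "f \<in> irrelevant_ideal" by (simp add: irrelevant_ideal_def)
  qed
  then have "P \<in> proj_points J" using no1 prime P by (auto simp: proj_points_def)
  then show thesis using that P no1 by blast
qed

text \<open>A maximal bad ideal \<open>P\<close> is the first member of the chain. For a linear form \<open>l\<close> outside \<open>P\<close>, the
  ideal \<open>P + (l)\<close> is bad for one linear form less, which by induction gives the rest of the chain.\<close>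

lemma bad_chain:
  assumes "homogeneous_ideal J" "\<not> good k J"
  shows "\<exists>c. (\<forall>i\<le>k. c i \<in> proj_points J) \<and> (\<forall>i<k. c i \<subset> c (Suc i))"
  using assms
proof (induction k arbitrary: J)
  case 0
  obtain P where "P \<in> proj_points J" using bad_prime[OF 0] by blast
  then show ?case by (intro exI[of _ "\<lambda>_. P"]) auto
next
  case (Suc k)
  obtain P where P: "homogeneous_ideal P" "\<not> good (Suc k) P" "P \<in> proj_points J" "\<not> forms 1 \<subseteq> P"
    using bad_prime[OF Suc.prems] by blast
  then obtain l where l: "l \<in> forms 1" "l \<notin> P" by blast
  have id: "is_idl P" using P by (simp add: homogeneous_ideal_iff)
  let ?Q = "adjoin P 1 (\<lambda>_. l)"
  have Q: "homogeneous_ideal ?Q" by (rule adjoin_homogeneous[OF P(1)]) (rule l(1))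
  have "\<not> good k ?Q"
  proof
    assume "good k ?Q"
    then obtain l' s where l': "\<forall>i<k. l' i \<in> forms 1" "forms s \<subseteq> adjoin ?Q k l'" by (auto simp: good_def)
    let ?l = "\<lambda>i. if i < k then l' i else l"
    have K: "is_idl (adjoin P (Suc k) ?l)" by (rule adjoin_is_idl[OF id])
    have g: "?l i \<in> adjoin P (Suc k) ?l" if "i < Suc k" for i by (rule adjoin_gen[OF id that])
    have "adjoin ?Q k l' \<subseteq> adjoin P (Suc k) ?l"
    proof (intro adjoin_least K adjoin_superset)
      show "l \<in> adjoin P (Suc k) ?l" using g[of k] by simp
      show "l' i \<in> adjoin P (Suc k) ?l" if "i < k" for i using g[of i] that by simp
    qed
    then have "good (Suc k) P" using l' l(1) unfolding good_def
      by (intro exI[of _ ?l] exI[of _ s]) auto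
    then show False using P(2) by simp
  qed
  then obtain c where c: "\<forall>i\<le>k. c i \<in> proj_points ?Q" "\<forall>i<k. c i \<subset> c (Suc i)"
    using Suc.IH[OF Q] by blast
  have JQ: "J \<subseteq> P" "P \<subseteq> ?Q" "l \<in> ?Q" using P(3) adjoin_superset adjoin_gen[OF id, of 0 1 "\<lambda>_. l"]
    by (auto simp: proj_points_def)
  have pp: "proj_points ?Q \<subseteq> proj_points J" using JQ by (auto simp: proj_points_def)
  have "?Q \<subseteq> c 0" using c(1) by (auto simp: proj_points_def)
  then have "P \<subset> c 0" using JQ l(2) by blast
  then show ?case
    using c P(3) pp
    by (intro exI[of _ "\<lambda>i. case i of 0 \<Rightarrow> P | Suc i \<Rightarrow> c i"])
       (auto split: nat.splits simp: less_Suc_eq_0_disj)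
qed

lemma good_of_scheme_dim:
  assumes "homogeneous_ideal J" "scheme_dim J \<le> ereal (real k)"
  shows "good (Suc k) J"
proof (rule ccontr)
  assume "\<not> good (Suc k) J"
  from bad_chain[OF assms(1) this]
  have "ereal (real (Suc k)) \<le> scheme_dim J"
    unfolding scheme_dim_def chain_dim_def by (intro Sup_upper) blast
  then show False using assms(2) by (metis ereal_less_eq(3) not_less_eq_eq of_nat_le_iff order.refl order_trans)
qed

section \<open>Linear coordinates\<close>

subsection \<open>The coordinate functions form a regular sequence\<close>

abbreviation coord :: "4 \<Rightarrow> mpoly4" where
  "coord k \<equiv> single (single k 1) 1"

text \<open>An enumeration of the variables, in the order \<open>1, 2, 3, 4 = 0\<close> of their indices, so that initial
  segments of them generate ideals of the form \<^const>\<open>adjoin\<close>.\<close>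

definition ix :: "nat \<Rightarrow> 4" where
  "ix i = (if i = 0 then 1 else if i = 1 then 2 else if i = 2 then 3 else 4)"

lemma ix_inj: "i < 4 \<Longrightarrow> j < 4 \<Longrightarrow> ix i = ix j \<longleftrightarrow> i = j"
  by (auto simp: ix_def split: if_splits)

lemma coord_power: "coord k ^ e = single (single k e) 1"
  by (induction e) (simp_all add: mult_single single_add[symmetric])

lemma lookup_mult_monomial:
  "lookup (single a c * g) (a + m) = c * lookup (g :: 'v cpoly) m"
  by (induction g rule: cpoly_induct)
     (auto simp: mult_single lookup_single when_def lookup_add distrib_left)

lemma is_idl_zero: "is_idl {0}" by (auto simp: is_idl_def)

lemma adjoin_zero_iff: "f \<in> adjoin {0} k l \<longleftrightarrow> (\<exists>g. f = (\<Sum>i<k. l i * g i))"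
  by (auto simp: adjoin_def)

text \<open>Membership in an ideal of pure powers is a condition on the individual monomials, from which
  regularity of the sequence of variables can be read off.\<close>

lemma monomial_ideal_iff:
  "f \<in> adjoin {0} k (\<lambda>i. coord (ix i) ^ e i) \<longleftrightarrow> (\<forall>m\<in>keys f. \<exists>i<k. e i \<le> lookup m (ix i))" (is "f \<in> ?J \<longleftrightarrow> ?R f")
proof
  have J: "is_idl ?J" by (rule adjoin_is_idl[OF is_idl_zero])
  assume R: "?R f"
  have "single m (lookup f m) \<in> ?J" if m: "m \<in> keys f" for m
  proof -
    obtain i where i: "i < k" "e i \<le> lookup m (ix i)" using R m by blast
    have "m = single (ix i) (e i) + (m - single (ix i) (e i))"
      by (rule poly_mapping_eqI) (use i in \<open>auto simp: lookup_add lookup_minus lookup_single when_def\<close>)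
    then have eq: "single m (lookup f m) = coord (ix i) ^ e i * single (m - single (ix i) (e i)) (lookup f m)"
      unfolding coord_power mult_single by simp
    show ?thesis unfolding eq by (rule is_idlD(4)[OF J adjoin_gen[OF is_idl_zero i(1)]])
  qed
  then have "(\<Sum>m\<in>keys f. single m (lookup f m)) \<in> ?J" by (intro is_idl_sum[OF J])
  then show "f \<in> ?J" using cpoly_sum_single[of f] by simp
next
  assume "f \<in> ?J"
  then obtain g where f: "f = (\<Sum>i<k. coord (ix i) ^ e i * g i)" by (auto simp: adjoin_zero_iff)
  show "?R f"
  proof
    fix m assume "m \<in> keys f"
    then have "(\<Sum>i<k. lookup (coord (ix i) ^ e i * g i) m) \<noteq> 0"
      unfolding f in_keys_iff lookup_sum .
    then have "\<exists>i<k. lookup (coord (ix i) ^ e i * g i) m \<noteq> 0"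
      by (rule contrapos_np) (simp add: sum.neutral)
    then obtain i where i: "i < k" "m \<in> keys (single (single (ix i) (e i)) 1 * g i)"
      unfolding coord_power in_keys_iff by blast
    then obtain a where "m = single (ix i) (e i) + a"
      using keys_mult[of "single (single (ix i) (e i)) 1" "g i"] by (auto split: if_splits)
    then show "\<exists>i<k. e i \<le> lookup m (ix i)" using i(1) by (auto simp: lookup_add)
  qed
qed

lemma coord_regular:
  assumes "k < 4" "coord (ix k) ^ s * g \<in> adjoin {0} k (\<lambda>i. coord (ix i) ^ e i)"
  shows "g \<in> adjoin {0} k (\<lambda>i. coord (ix i) ^ e i)"
  unfolding monomial_ideal_iff
proof
  fix m assume m: "m \<in> keys g"
  let ?a = "single (ix k) s"
  have "lookup (coord (ix k) ^ s * g) (?a + m) = lookup g m"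
    unfolding coord_power by (simp add: lookup_mult_monomial)
  then have "?a + m \<in> keys (coord (ix k) ^ s * g)" using m by (simp add: in_keys_iff)
  then obtain i where i: "i < k" "e i \<le> lookup (?a + m) (ix i)"
    using assms(2) unfolding monomial_ideal_iff by blast
  have "ix i \<noteq> ix k" using i(1) assms(1) ix_inj[of i k] by simp
  then show "\<exists>i<k. e i \<le> lookup m (ix i)" using i by (auto simp: lookup_add lookup_single when_def)
qed

subsection \<open>Linear changes of coordinates\<close>

lemma lookup_dual_form: "lookup (dual_form v) m = (\<Sum>k\<in>UNIV. if m = single k 1 then vec_nth v k else 0)"
  unfolding dual_form_def lookup_sum by (rule sum.cong) (auto simp: lookup_single when_def)

lemma dual_form_forms: "dual_form v \<in> forms 1"
  unfolding dual_form_def by (intro forms_sum) (metis forms_single mdeg_single)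

lemma dual_form_eq: "dual_form v = (\<Sum>k\<in>UNIV. cscale (vec_nth v k) (coord k))"
  by (simp add: dual_form_def cscale_def mult_single)

lemma forms_1_dual:
  assumes "f \<in> forms 1" obtains v where "f = dual_form v"
proof -
  let ?v = "\<chi> k. lookup f (single k 1)"
  have "lookup f m = lookup (dual_form ?v) m" for m
  proof (cases "mdeg m = 1")
    case True
    then obtain k m' where m: "m = single k 1 + m'" "mdeg m' = 0" using monomial_pred[of m 0] by auto
    have "m' = 0" by (rule poly_mapping_eqI) (use m(2) in \<open>simp add: mdeg_def\<close>)
    then have mk: "m = single k 1" using m by simp
    have "single k 1 = single j (1::nat) \<longleftrightarrow> k = j" for j :: 4
      by (metis lookup_single_eq lookup_single_not_eq zero_neq_one)
    then show ?thesis by (simp add: lookup_dual_form mk)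
  next
    case False
    then have "lookup f m = 0" "lookup (dual_form ?v) m = 0"
      using assms dual_form_forms by (auto simp: forms_iff)
    then show ?thesis by simp
  qed
  then show thesis using that poly_mapping_eqI by blast
qed

lemma dual_form_add: "dual_form (v + w) = dual_form v + dual_form w"
  by (simp add: dual_form_eq sum.distrib cs.scale_left_distrib)

lemma dual_form_scale: "dual_form (c *s v) = cscale c (dual_form v)"
  by (simp add: dual_form_eq cs.scale_sum_right)

lemma dual_form_sum: "dual_form (sum f A) = (\<Sum>i\<in>A. dual_form (f i))"
proof (induction A rule: infinite_finite_induct)
  case (insert x F) then show ?case by (simp add: dual_form_add)
qed (simp_all add: dual_form_eq)

definition linear_subst :: "(4 \<Rightarrow> complex ^ 4) \<Rightarrow> mpoly4 \<Rightarrow> mpoly4" where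
  "linear_subst b = substitute (single 0) (\<lambda>k. dual_form (b k))"

interpretation linear_subst: comm_ring_hom "linear_subst b" for b
  unfolding linear_subst_def by (rule coeff_hom.substitute_ring_hom[OF const_ring_hom])

lemma linear_subst_single: "linear_subst b (single m c) = single 0 c * monom_val (\<lambda>k. dual_form (b k)) m"
  unfolding linear_subst_def by (rule coeff_hom.substitute_single[OF const_ring_hom])

lemma linear_subst_coord: "linear_subst b (coord k) = dual_form (b k)"
  by (simp add: linear_subst_single monom_val_single)

lemma linear_subst_cscale: "linear_subst b (cscale c f) = cscale c (linear_subst b f)"
  by (simp add: cscale_def linear_subst.hom_mult linear_subst_single)

lemma single_eq_monom_val: "single m c = single 0 c * monom_val coord m"
proof -
  have "single m 1 = monom_val coord (m :: 4 \<Rightarrow>\<^sub>0 nat)"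
  proof -
    have "(\<Prod>k\<in>S. single (single k (lookup m k)) (1::complex)) = single (\<Sum>k\<in>S. single k (lookup m k)) 1"
      if "finite S" for S :: "4 set"
      using that by induction (simp_all add: mult_single)
    moreover have "m = (\<Sum>k\<in>keys m. single k (lookup m k))"
      by (rule poly_mapping_eqI) (auto simp: lookup_sum lookup_single when_def sum.delta in_keys_iff)
    ultimately show ?thesis unfolding monom_val_def coord_power by simp
  qed
  then show ?thesis by (metis add_0 mult.right_neutral mult_single)
qed

lemma linear_subst_inverse:
  assumes "\<And>k. linear_subst b' (dual_form (b k)) = coord k" shows "linear_subst b' (linear_subst b f) = f"
proof (induction f rule: cpoly_induct)
  case (single m c)
  have "linear_subst b' (monom_val (\<lambda>k. dual_form (b k)) m) = monom_val coord m"
    unfolding monom_val_def linear_subst.hom_prod linear_subst.hom_power assms ..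
  then have "linear_subst b' (linear_subst b (single m c)) = single 0 c * monom_val coord m"
    by (simp add: linear_subst_single linear_subst.hom_mult)
  then show ?case using single_eq_monom_val by metis
next
  case (add f g) then show ?case by (simp add: linear_subst.hom_add)
qed

text \<open>The forms are the images of the variables under a linear automorphism, which transports
  regularity.\<close>

lemma coordinates_regular:
  fixes b :: "4 \<Rightarrow> complex ^ 4"
  assumes indep: "\<And>c. (\<Sum>i\<in>UNIV. c i *s b i) = 0 \<Longrightarrow> \<forall>i. c i = 0"
  defines "l \<equiv> \<lambda>i. dual_form (b (ix i))"
  assumes k: "k < 4" and mem: "l k ^ s * g \<in> adjoin {0} k (\<lambda>i. l i ^ e i)"
  shows "g \<in> adjoin {0} k (\<lambda>i. l i ^ e i)"
proof -
  define A where "A = (\<chi> i. b i)"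
  have rows: "Finite_Cartesian_Product.row i A = b i" for i by (simp add: Finite_Cartesian_Product.row_def A_def Finite_Cartesian_Product.vec_eq_iff)
  have "\<exists>B. A ** B = Finite_Cartesian_Product.mat 1"
    unfolding matrix_right_invertible_independent_rows rows using indep by blast
  then obtain B where AB: "A ** B = Finite_Cartesian_Product.mat 1" by blast
  then have BA: "B ** A = Finite_Cartesian_Product.mat 1" using matrix_left_right_inverse by blast
  define b' where "b' i = Finite_Cartesian_Product.row i B" for i
  have inv: "(\<Sum>j\<in>UNIV. vec_nth (Finite_Cartesian_Product.row k P) j *s Finite_Cartesian_Product.row j Q) = axis k 1" if "P ** Q = Finite_Cartesian_Product.mat 1"
    for P Q :: "complex ^ 4 ^ 4" and k
  proof -
    have "vec_nth (vec_nth (P ** Q) k) i = vec_nth (axis k 1) i" for i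
      unfolding that by (simp add: Finite_Cartesian_Product.mat_def axis_def eq_commute)
    then have "(\<Sum>j\<in>UNIV. vec_nth (vec_nth P k) j * vec_nth (vec_nth Q j) i) = vec_nth (axis k 1) i" for i
      by (simp add: matrix_matrix_mult_def)
    then have "vec_nth (\<Sum>j\<in>UNIV. vec_nth (Finite_Cartesian_Product.row k P) j *s Finite_Cartesian_Product.row j Q) i =
        vec_nth (axis k 1) i" for i
      by (simp add: Finite_Cartesian_Product.row_def)
    then show ?thesis unfolding Finite_Cartesian_Product.vec_eq_iff by blast
  qed
  have ch: "linear_subst (\<lambda>j. Finite_Cartesian_Product.row j Q) (dual_form (Finite_Cartesian_Product.row k P)) = coord k" if "P ** Q = Finite_Cartesian_Product.mat 1" for P Q k
  proof -
    have "linear_subst (\<lambda>j. Finite_Cartesian_Product.row j Q) (dual_form (Finite_Cartesian_Product.row k P)) = (\<Sum>j\<in>UNIV. cscale (vec_nth (Finite_Cartesian_Product.row k P) j) (dual_form (Finite_Cartesian_Product.row j Q)))"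
      unfolding dual_form_eq[of "Finite_Cartesian_Product.row k P"] linear_subst.hom_sum linear_subst_cscale linear_subst_coord ..
    also have "\<dots> = dual_form (axis k 1)"
      unfolding inv[OF that, symmetric] dual_form_sum dual_form_scale ..
    also have "\<dots> = coord k"
    proof -
      have "vec_nth (axis k 1) j = (if j = k then 1 else (0::complex))" for j by (simp add: axis_def)
      then show ?thesis by (simp add: dual_form_eq if_distrib[of "\<lambda>c. cscale c _"] cong: if_cong)
    qed
    finally show ?thesis .
  qed
  have b: "b = (\<lambda>j. Finite_Cartesian_Product.row j A)" using rows by auto
  have b'_eq: "b' = (\<lambda>j. Finite_Cartesian_Product.row j B)" by (rule ext) (rule b'_def)
  \<comment> \<open>The rows of the inverse matrix define the inverse automorphism.\<close>
  have i1: "linear_subst b' (linear_subst b f) = f" for f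
    by (rule linear_subst_inverse) (use ch[OF AB] in \<open>simp only: b'_eq rows\<close>)
  have i2: "linear_subst b (linear_subst b' f) = f" for f
    by (rule linear_subst_inverse) (use ch[OF BA] in \<open>simp only: b'_eq rows\<close>)
  have lcoord: "linear_subst b (coord (ix i)) = l i" for i unfolding l_def by (rule linear_subst_coord)
  have coordl: "linear_subst b' (l i) = coord (ix i)" for i using i1 lcoord by metis
  obtain h where h: "l k ^ s * g = (\<Sum>i<k. l i ^ e i * h i)" using mem by (auto simp: adjoin_zero_iff)
  then have "coord (ix k) ^ s * linear_subst b' g = (\<Sum>i<k. coord (ix i) ^ e i * linear_subst b' (h i))"
    by (metis (no_types, lifting) coordl linear_subst.hom_mult linear_subst.hom_power linear_subst.hom_sum sum.cong)
  then have "coord (ix k) ^ s * linear_subst b' g \<in> adjoin {0} k (\<lambda>i. coord (ix i) ^ e i)"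
    unfolding adjoin_zero_iff by (rule exI[of _ "\<lambda>i. linear_subst b' (h i)"])
  then have "linear_subst b' g \<in> adjoin {0} k (\<lambda>i. coord (ix i) ^ e i)"
    by (rule coord_regular[OF k])
  then obtain h' where "linear_subst b' g = (\<Sum>i<k. coord (ix i) ^ e i * h' i)"
    unfolding adjoin_zero_iff by (rule exE)
  then have "g = linear_subst b (\<Sum>i<k. coord (ix i) ^ e i * h' i)" using i2 by metis
  also have "\<dots> = (\<Sum>i<k. l i ^ e i * linear_subst b (h' i))"
    unfolding linear_subst.hom_sum linear_subst.hom_mult linear_subst.hom_power lcoord ..
  finally show ?thesis unfolding adjoin_zero_iff by (rule exI[of _ "\<lambda>i. linear_subst b (h' i)"])
qed

text \<open>Extend a basis of the span of the two forms to a basis of \<open>\<complex>\<^sup>4\<close>. The forms may be dependent, so the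
  conclusion is only that they lie in the ideal of \<open>l\<^sub>0\<close> and \<open>l\<^sub>1\<close>.\<close>

lemma exists_coordinates:
  assumes "f0 \<in> forms 1" "f1 \<in> forms 1"
  obtains l where "\<And>i. l i \<in> forms 1" "f0 \<in> adjoin {0} 2 l" "f1 \<in> adjoin {0} 2 l"
    "\<And>k s g e. k < 4 \<Longrightarrow> l k ^ s * g \<in> adjoin {0} k (\<lambda>i. l i ^ e i) \<Longrightarrow> g \<in> adjoin {0} k (\<lambda>i. l i ^ e i)"
proof -
  obtain v0 v1 where v: "f0 = dual_form v0" "f1 = dual_form v1"
    using forms_1_dual assms by metis
  obtain B0 where B0: "B0 \<subseteq> {v0, v1}" "vec.independent B0" "{v0, v1} \<subseteq> vec.span B0"
    using vec.maximal_independent_subset[of "{v0, v1}"] by blast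
  obtain B where B': "B0 \<subseteq> B" "B \<subseteq> UNIV" "vec.independent B" "UNIV \<subseteq> vec.span B"
    by (rule vec.maximal_independent_subset_extend[OF subset_UNIV B0(2)])
  then have B: "B0 \<subseteq> B" "vec.independent B" "vec.span B = UNIV" by auto
  have finB: "finite B" using B(2) vec.finiteI_independent by blast
  have cardB: "card B = 4"
    using vec.dim_eq_card[of B UNIV] B vec.dim_UNIV by (simp add: vec.dim_UNIV card_cart_basis)
  \<comment> \<open>Enlarge the basis of the span to exactly two vectors, which come first in the enumeration.\<close>
  have "card B0 \<le> 2" using card_mono[OF _ B0(1)] by (simp add: card_insert_if split: if_splits)
  then obtain C where C: "B0 \<subseteq> C" "C \<subseteq> B" "card C = 2"
    using exists_subset_between[of B0 2 B] B(1) finB cardB by auto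
  obtain c1 c2 where c12: "C = {c1, c2}" "c1 \<noteq> c2" using C(3) by (auto simp: card_2_iff)
  have "card (B - C) = 2" using C cardB finB by (simp add: card_Diff_subset finite_subset)
  then obtain c3 c4 where c34: "B - C = {c3, c4}" "c3 \<noteq> c4" by (auto simp: card_2_iff)
  define b :: "4 \<Rightarrow> complex ^ 4" where
    "b i = (if i = 1 then c1 else if i = 2 then c2 else if i = 3 then c3 else c4)" for i
  have Beq: "B = {c1, c2, c3, c4}" using c12 c34 C(2) by blast
  have dist: "c3 \<notin> {c1, c2}" "c4 \<notin> {c1, c2}" using c34 c12 by blast+
  have b4: "b 1 = c1" "b 2 = c2" "b 3 = c3" "b 4 = c4" by (simp_all add: b_def)
  have bij: "bij_betw b UNIV B" unfolding bij_betw_def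
  proof (rule conjI[rotated])
    show rng: "range b = B" unfolding UNIV_4 Beq by (simp add: b4)
    show "inj b" by (rule eq_card_imp_inj_on) (simp_all add: rng cardB)
  qed
  have indep: "\<forall>i. c i = 0" if "(\<Sum>i\<in>UNIV. c i *s b i) = 0" for c
  proof -
    let ?u = "\<lambda>x. c (inv_into UNIV b x)"
    have "(\<Sum>x\<in>B. ?u x *s x) = (\<Sum>i\<in>UNIV. c i *s b i)"
      using bij by (subst sum.reindex_bij_betw[OF bij, symmetric]) (simp add: bij_betw_def)
    then have sum0: "(\<Sum>x\<in>B. ?u x *s x) = 0" using that by simp
    have "?u x = 0" if "x \<in> B" for x
      by (rule vec.independentD[OF B(2) finB subset_refl sum0 that])
    then show ?thesis using bij by (metis bij_betw_def inv_into_f_f rangeI UNIV_I)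
  qed
  define l where "l i = dual_form (b (ix i))" for i
  have mem: "dual_form v \<in> adjoin {0} 2 l" if "v \<in> {v0, v1}" for v
  proof -
    have "v \<in> vec.span C" using that B0(3) vec.span_mono[OF C(1)] by blast
    then obtain a1 where "v - a1 *s c1 \<in> vec.span {c2}" unfolding c12(1) vec.span_insert by auto
    then obtain a2 where "v - a1 *s c1 = a2 *s c2" by (auto simp: vec.span_singleton)
    then have "v = a1 *s c1 + a2 *s c2" by (simp add: algebra_simps)
    then have "dual_form v = cscale a1 (l 0) + cscale a2 (l 1)"
      by (simp add: dual_form_add dual_form_scale l_def ix_def b4)
    moreover have "l 0 \<in> adjoin {0} 2 l" "l 1 \<in> adjoin {0} 2 l" using adjoin_gen[OF is_idl_zero] by auto
    ultimately show ?thesis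
      by (simp add: is_idlD(2)[OF adjoin_is_idl[OF is_idl_zero]] is_idl_cscale[OF adjoin_is_idl[OF is_idl_zero]])
  qed
  show thesis
  proof (rule that[of l])
    show "l i \<in> forms 1" for i unfolding l_def by (rule dual_form_forms)
    show "f0 \<in> adjoin {0} 2 l" "f1 \<in> adjoin {0} 2 l" using mem v by auto
    show "g \<in> adjoin {0} k (\<lambda>i. l i ^ e i)" if "k < 4" "l k ^ s * g \<in> adjoin {0} k (\<lambda>i. l i ^ e i)" for k s g e
      using coordinates_regular[OF indep that[unfolded l_def]] unfolding l_def by blast
  qed
qed

section \<open>Maximal minors of an \<open>m \<times> (m + 1)\<close> matrix\<close>

text \<open>Matrices of size \<open>m \<times> (m + 1)\<close> are given by their entries \<open>A i j\<close>, \<open>i < m\<close>, \<open>j \<le> m\<close>. They are made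
  square by a further row \<open>v\<close>, so that maximal minors become cofactors and come with signs.\<close>

definition bordered :: "nat \<Rightarrow> (nat \<Rightarrow> nat \<Rightarrow> mpoly4) \<Rightarrow> (nat \<Rightarrow> mpoly4) \<Rightarrow> mpoly4 mat" where
  "bordered m A v = mat (Suc m) (Suc m) (\<lambda>(i, j). if i < m then A i j else v j)"

text \<open>Cofactors of the last row do not depend on that row, which may thus be taken to be zero.\<close>

definition sminor :: "nat \<Rightarrow> (nat \<Rightarrow> nat \<Rightarrow> mpoly4) \<Rightarrow> nat \<Rightarrow> mpoly4" where
  "sminor m A j = cofactor (bordered m A (\<lambda>_. 0)) m j"

text \<open>The determinant of the bordered matrix, expanded along the last row.\<close>

definition minor_form :: "nat \<Rightarrow> (nat \<Rightarrow> nat \<Rightarrow> mpoly4) \<Rightarrow> (nat \<Rightarrow> mpoly4) \<Rightarrow> mpoly4" where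
  "minor_form m A v = (\<Sum>j\<le>m. sminor m A j * v j)"

abbreviation minor_ideal :: "nat \<Rightarrow> (nat \<Rightarrow> nat \<Rightarrow> mpoly4) \<Rightarrow> mpoly4 set" where
  "minor_ideal m A \<equiv> adjoin {0} (Suc m) (sminor m A)"

definition row_comb :: "nat \<Rightarrow> (nat \<Rightarrow> nat \<Rightarrow> mpoly4) \<Rightarrow> (nat \<Rightarrow> mpoly4) \<Rightarrow> nat \<Rightarrow> mpoly4" where
  "row_comb m A c k = (\<Sum>i<m. c i * A i k)"

lemma bordered_carrier [simp]: "bordered m A v \<in> carrier_mat (Suc m) (Suc m)"
  by (simp add: bordered_def)

lemma bordered_index:
  "i < Suc m \<Longrightarrow> j < Suc m \<Longrightarrow> bordered m A v $$ (i, j) = (if i < m then A i j else v j)"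
  by (simp add: bordered_def)

lemma mat_mult_entry:
  assumes "A \<in> carrier_mat n n" "B \<in> carrier_mat n n" "i < n" "j < n"
  shows "(A * B) $$ (i, j) = (\<Sum>k<n. A $$ (i, k) * B $$ (k, j))"
  using assms by (auto simp: scalar_prod_def lessThan_atLeast0)

lemma cofactor_bordered: "cofactor (bordered m A v) m j = sminor m A j"
proof -
  have "mat_delete (bordered m A v) m j = mat_delete (bordered m A (\<lambda>_. 0)) m j"
    by (rule eq_matI) (auto simp: mat_delete_def bordered_def)
  then show ?thesis by (simp add: sminor_def cofactor_def)
qed

lemma det_bordered: "Determinant.det (bordered m A v) = minor_form m A v"
proof -
  have "Determinant.det (bordered m A v) =
      (\<Sum>j<Suc m. bordered m A v $$ (m, j) * cofactor (bordered m A v) m j)"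
    by (rule laplace_expansion_row[OF bordered_carrier]) simp
  also have "\<dots> = minor_form m A v"
    unfolding minor_form_def lessThan_Suc_atMost
    by (rule sum.cong) (auto simp: bordered_index cofactor_bordered mult.commute)
  finally show ?thesis .
qed

lemma minor_ideal_iff: "f \<in> minor_ideal m A \<longleftrightarrow> (\<exists>v. f = minor_form m A v)"
  by (simp add: adjoin_zero_iff minor_form_def lessThan_Suc_atMost)

lemma minor_form_row:
  assumes "i < m" shows "minor_form m A (A i) = 0"
  unfolding det_bordered[symmetric]
  by (rule det_identical_rows[OF bordered_carrier, of i m])
     (use assms in \<open>auto intro!: eq_vecI simp: bordered_index Matrix.row_def bordered_def\<close>)

lemma minor_form_add: "minor_form m A (\<lambda>k. v k + w k) = minor_form m A v + minor_form m A w"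
  by (simp add: minor_form_def distrib_left sum.distrib)

lemma minor_form_diff: "minor_form m A (\<lambda>k. v k - w k) = minor_form m A v - minor_form m A w"
  by (simp add: minor_form_def right_diff_distrib sum_subtractf)

lemma minor_form_mult: "minor_form m A (\<lambda>k. r * v k) = r * minor_form m A v"
  by (simp add: minor_form_def sum_distrib_left mult.left_commute)

lemma minor_form_row_comb: "minor_form m A (row_comb m A c) = 0"
proof -
  have "minor_form m A (row_comb m A c) = (\<Sum>i<m. c i * minor_form m A (A i))"
    unfolding minor_form_def row_comb_def sum_distrib_left
    by (subst sum.swap) (simp add: mult.left_commute)
  then show ?thesis by (simp add: minor_form_row)
qed

lemma minor_form_cong: "(\<And>k. k \<le> m \<Longrightarrow> v k = w k) \<Longrightarrow> minor_form m A v = minor_form m A w"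
  by (simp add: minor_form_def)

lemma minor_form_ideal: "is_idl K \<Longrightarrow> (\<And>k. k \<le> m \<Longrightarrow> v k \<in> K) \<Longrightarrow> minor_form m A v \<in> K"
  unfolding minor_form_def by (intro is_idl_sum is_idlD(3)) auto

text \<open>Cramer's rule for the matrix bordered by a unit vector, whose determinant is a minor. Multiplying
  \<open>v\<close> by the adjugate and then by the matrix itself expresses the multiple of \<open>v\<close> by that minor
  through the rows; the coefficient of the unit vector is the determinant of the matrix bordered
  by \<open>v\<close>.\<close>

lemma minor_cramer:
  assumes j: "j \<le> m"
  obtains c where "\<And>k. k \<le> m \<Longrightarrow>
    sminor m A j * v k = row_comb m A c k + (if k = j then minor_form m A v else 0)"
proof -
  let ?e = "\<lambda>k. if k = j then 1 else (0 :: mpoly4)"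
  let ?W = "bordered m A ?e" and ?n = "Suc m"
  let ?B = "adj_mat ?W"
  have W: "?W \<in> carrier_mat ?n ?n" by simp
  have B: "?B \<in> carrier_mat ?n ?n" using adj_mat(1)[OF W] .
  have "minor_form m A ?e = sminor m A j"
    using j by (simp add: minor_form_def if_distrib cong: if_cong)
  then have BW: "?B * ?W = sminor m A j \<cdot>\<^sub>m 1\<^sub>m ?n"
    using adj_mat(3)[OF W] det_bordered[of m A ?e] by simp
  have Bm: "?B $$ (p, m) = sminor m A p" if "p < ?n" for p
    using that by (simp add: adj_mat_def cofactor_bordered bordered_def[of m A ?e] cofactor_bordered[of m A ?e, unfolded bordered_def])
  define c where "c i = (\<Sum>p<?n. v p * ?B $$ (p, i))" for i
  have "sminor m A j * v k = row_comb m A c k + (if k = j then minor_form m A v else 0)" if k: "k \<le> m" for k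
  proof -
    have entry: "(\<Sum>i<?n. ?B $$ (p, i) * ?W $$ (i, k)) = (if p = k then sminor m A j else 0)" if "p < ?n" for p
    proof -
      have "(\<Sum>i<?n. ?B $$ (p, i) * ?W $$ (i, k)) = (?B * ?W) $$ (p, k)"
        using mat_mult_entry[OF B W that, of k] k by simp
      then show ?thesis using that k by (simp add: BW)
    qed
    have "sminor m A j * v k = (\<Sum>p<?n. v p * (if p = k then sminor m A j else 0))"
      using k by (simp add: if_distrib mult.commute cong: if_cong)
    also have "\<dots> = (\<Sum>p<?n. v p * (\<Sum>i<?n. ?B $$ (p, i) * ?W $$ (i, k)))"
      using entry by simp
    also have "\<dots> = (\<Sum>i<?n. c i * ?W $$ (i, k))"
      unfolding c_def sum_distrib_left sum_distrib_right
      by (subst sum.swap) (simp add: mult.assoc)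
    also have "\<dots> = (\<Sum>i<m. c i * ?W $$ (i, k)) + c m * ?W $$ (m, k)" by simp
    also have "(\<Sum>i<m. c i * ?W $$ (i, k)) = row_comb m A c k"
      unfolding row_comb_def using k by (intro sum.cong) (auto simp: bordered_index)
    also have "c m * ?W $$ (m, k) = (if k = j then minor_form m A v else 0)"
    proof -
      have "c m = minor_form m A v"
        unfolding c_def minor_form_def lessThan_Suc_atMost
        by (rule sum.cong) (auto simp: Bm mult.commute)
      then show ?thesis using k by (simp add: bordered_index)
    qed
    finally show ?thesis .
  qed
  then show thesis using that by blast
qed

text \<open>A relation between the rows is multiplied by the adjugate of the matrix bordered by a unit vector;
  the determinant of this matrix is the minor.\<close>

lemma minor_rows_independent:
  assumes K: "is_idl K" and b: "\<And>k. k \<le> m \<Longrightarrow> row_comb m A b k \<in> K" and i: "i < m" and j: "j \<le> m"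
  shows "b i * sminor m A j \<in> K"
proof -
  let ?e = "\<lambda>k. if k = j then 1 else (0 :: mpoly4)"
  let ?W = "bordered m A ?e" and ?n = "Suc m"
  let ?B = "adj_mat ?W"
  have W: "?W \<in> carrier_mat ?n ?n" by simp
  have B: "?B \<in> carrier_mat ?n ?n" using adj_mat(1)[OF W] .
  have "minor_form m A ?e = sminor m A j"
    using j by (simp add: minor_form_def if_distrib cong: if_cong)
  then have WB: "?W * ?B = sminor m A j \<cdot>\<^sub>m 1\<^sub>m ?n"
    using adj_mat(2)[OF W] det_bordered[of m A ?e] by simp
  have entry: "(\<Sum>k<?n. ?W $$ (p, k) * ?B $$ (k, i)) = (if p = i then sminor m A j else 0)" if "p < m" for p
  proof -
    have "(\<Sum>k<?n. ?W $$ (p, k) * ?B $$ (k, i)) = (?W * ?B) $$ (p, i)"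
      using mat_mult_entry[OF W B, of p i] that i by simp
    then show ?thesis using that i by (simp add: WB)
  qed
  have "b i * sminor m A j = (\<Sum>p<m. b p * (if p = i then sminor m A j else 0))"
    using i by (simp add: if_distrib cong: if_cong)
  also have "\<dots> = (\<Sum>p<m. b p * (\<Sum>k<?n. ?W $$ (p, k) * ?B $$ (k, i)))"
    using entry by simp
  also have "\<dots> = (\<Sum>k<?n. (\<Sum>p<m. b p * ?W $$ (p, k)) * ?B $$ (k, i))"
    unfolding sum_distrib_left sum_distrib_right
    by (subst sum.swap) (simp add: mult.assoc)
  also have "\<dots> = (\<Sum>k<?n. row_comb m A b k * ?B $$ (k, i))"
    unfolding row_comb_def by (intro sum.cong) (auto simp: bordered_index)
  also have "\<dots> \<in> K" using b by (intro is_idl_sum[OF K] is_idlD(4)[OF K]) auto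
  finally show ?thesis .
qed

section \<open>Exactness of the Hilbert--Burch complex\<close>

text \<open>Syzygies of the maximal minors modulo \<open>K\<close> come from the rows.\<close>

definition hb_exact :: "nat \<Rightarrow> (nat \<Rightarrow> nat \<Rightarrow> mpoly4) \<Rightarrow> mpoly4 set \<Rightarrow> bool" where
  "hb_exact m A K \<longleftrightarrow> (\<forall>v. minor_form m A v \<in> K \<longrightarrow> (\<exists>c. \<forall>k\<le>m. v k - row_comb m A c k \<in> K))"

lemma row_comb_add: "row_comb m A (\<lambda>i. b i + c i) k = row_comb m A b k + row_comb m A c k"
  by (simp add: row_comb_def distrib_right sum.distrib)

lemma row_comb_diff: "row_comb m A (\<lambda>i. b i - c i) k = row_comb m A b k - row_comb m A c k"
  by (simp add: row_comb_def left_diff_distrib sum_subtractf)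

lemma row_comb_mult: "row_comb m A (\<lambda>i. r * c i) k = r * row_comb m A c k"
  by (simp add: row_comb_def sum_distrib_left mult.assoc)

lemma row_comb_sum: "row_comb m A (\<lambda>i. \<Sum>j\<in>S. c j i) k = (\<Sum>j\<in>S. row_comb m A (c j) k)"
  unfolding row_comb_def sum_distrib_right by (rule sum.swap)

lemma adjoin_one_iff: "f \<in> adjoin K 1 (\<lambda>_. u) \<longleftrightarrow> (\<exists>a g. a \<in> K \<and> f = a + u * g)"
  by (auto simp: adjoin_def)

text \<open>Cramer's rule shows that every minor multiplies every syzygy into the row space; hence so does
  every element of the ideal of minors.\<close>

lemma syzygy_times_minor:
  assumes K: "is_idl K" and u: "u \<in> adjoin (minor_ideal m A) n l" "adjoin {0} n l = K"
    and v: "minor_form m A v \<in> K"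
  obtains c where "\<And>k. k \<le> m \<Longrightarrow> u * v k - row_comb m A c k \<in> K"
proof -
  obtain a where a: "u - (\<Sum>j\<le>m. sminor m A j * a j) \<in> K"
  proof -
    obtain x g where x: "u = x + (\<Sum>i<n. l i * g i)" "x \<in> minor_ideal m A" using u(1) by (auto simp: adjoin_def)
    obtain a where a: "x = minor_form m A a" using x(2) unfolding minor_ideal_iff by blast
    have "u - (\<Sum>j\<le>m. sminor m A j * a j) = (\<Sum>i<n. l i * g i)"
      by (simp add: x(1) a minor_form_def)
    also have "\<dots> \<in> K" using u(2) adjoin_zero_iff by blast
    finally show thesis using that by blast
  qed
  have "\<exists>c. \<forall>k\<le>m. sminor m A j * v k = row_comb m A c k + (if k = j then minor_form m A v else 0)"
    if "j \<le> m" for j using minor_cramer[OF that] by metis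
  then have "\<forall>j\<in>{..m}. \<exists>c. \<forall>k\<le>m. sminor m A j * v k = row_comb m A c k + (if k = j then minor_form m A v else 0)"
    by blast
  from bchoice[OF this] obtain c where c: "\<And>j k. j \<le> m \<Longrightarrow> k \<le> m \<Longrightarrow>
      sminor m A j * v k = row_comb m A (c j) k + (if k = j then minor_form m A v else 0)" by auto
  define cc where "cc i = (\<Sum>j\<le>m. a j * c j i)" for i
  have "u * v k - row_comb m A cc k \<in> K" if k: "k \<le> m" for k
  proof -
    have "(\<Sum>j\<le>m. sminor m A j * a j) * v k = (\<Sum>j\<le>m. a j * (sminor m A j * v k))"
      unfolding sum_distrib_right by (rule sum.cong) (auto simp: mult_ac)
    also have "\<dots> = (\<Sum>j\<le>m. a j * row_comb m A (c j) k + (if k = j then a j * minor_form m A v else 0))"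
      by (rule sum.cong) (auto simp: c[OF _ k] distrib_left)
    also have "\<dots> = row_comb m A cc k + a k * minor_form m A v"
      unfolding cc_def row_comb_sum using k by (simp add: sum.distrib row_comb_mult)
    finally have "u * v k - row_comb m A cc k =
        (u - (\<Sum>j\<le>m. sminor m A j * a j)) * v k + a k * minor_form m A v"
      by (simp add: left_diff_distrib)
    also have "\<dots> \<in> K" by (intro is_idlD(2)[OF K] is_idlD(4)[OF K a] is_idlD(3)[OF K v])
    finally show ?thesis .
  qed
  then show thesis using that by blast
qed

text \<open>A syzygy \<open>v\<close> satisfies \<open>u v = \<Sum>\<^sub>i b\<^sub>i A\<^sub>i\<close> and \<open>w v = \<Sum>\<^sub>i c\<^sub>i A\<^sub>i\<close> modulo \<open>K\<close>, where \<open>A\<^sub>i\<close> are the rows. The rows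
  are independent modulo \<open>K\<close>, so \<open>w b\<^sub>i = u c\<^sub>i\<close>. As \<open>u, w\<close> is a regular sequence, \<open>u\<close> divides \<open>b\<^sub>i\<close>, and the
  quotients are the coefficients of \<open>v\<close>.\<close>

lemma hb_exact_base:
  assumes K: "is_idl K" "adjoin {0} n l = K"
    and u: "u \<in> adjoin (minor_ideal m A) n l" and w: "w \<in> adjoin (minor_ideal m A) n l"
    and regu: "\<And>g. u * g \<in> K \<Longrightarrow> g \<in> K"
    and regw: "\<And>g. w * g \<in> adjoin K 1 (\<lambda>_. u) \<Longrightarrow> g \<in> adjoin K 1 (\<lambda>_. u)"
  shows "hb_exact m A K"
  unfolding hb_exact_def
proof (intro allI impI)
  fix v assume v: "minor_form m A v \<in> K"
  obtain b where b: "\<And>k. k \<le> m \<Longrightarrow> u * v k - row_comb m A b k \<in> K"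
    using syzygy_times_minor[OF K(1) u K(2) v] by blast
  obtain c where c: "\<And>k. k \<le> m \<Longrightarrow> w * v k - row_comb m A c k \<in> K"
    using syzygy_times_minor[OF K(1) w K(2) v] by blast
  have cancel: "x i \<in> K" if x: "\<And>k. k \<le> m \<Longrightarrow> row_comb m A x k \<in> K" and i: "i < m" for x i
  proof -
    obtain y g where y: "u = y + (\<Sum>i<n. l i * g i)" "y \<in> minor_ideal m A" using u by (auto simp: adjoin_def)
    obtain a where a: "y = minor_form m A a" using y(2) unfolding minor_ideal_iff by blast
    have "u * x i = (\<Sum>j\<le>m. sminor m A j * a j) * x i + (\<Sum>i<n. l i * g i) * x i"
      by (simp only: y(1) a minor_form_def distrib_right)
    also have "(\<Sum>j\<le>m. sminor m A j * a j) * x i = (\<Sum>j\<le>m. (x i * sminor m A j) * a j)"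
      unfolding sum_distrib_right by (rule sum.cong) (auto simp: mult_ac)
    also have "\<dots> + (\<Sum>i<n. l i * g i) * x i \<in> K"
    proof (rule is_idlD(2)[OF K(1)])
      have "x i * sminor m A j \<in> K" if "j \<in> {..m}" for j
        using minor_rows_independent[OF K(1) x i] that by simp
      then show "(\<Sum>j\<le>m. (x i * sminor m A j) * a j) \<in> K"
        by (intro is_idl_sum[OF K(1)]) (rule is_idlD(4)[OF K(1)], blast)
      have "(\<Sum>i<n. l i * g i) \<in> K" unfolding K(2)[symmetric] adjoin_zero_iff by blast
      then show "(\<Sum>i<n. l i * g i) * x i \<in> K" by (rule is_idlD(4)[OF K(1)])
    qed
    finally show ?thesis by (rule regu)
  qed
  have "\<exists>e. b i - u * e \<in> K" if i: "i < m" for i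
  proof -
    have "row_comb m A (\<lambda>i. w * b i - u * c i) k \<in> K" if k: "k \<le> m" for k
    proof -
      have "row_comb m A (\<lambda>i. w * b i - u * c i) k =
          u * (w * v k - row_comb m A c k) - w * (u * v k - row_comb m A b k)"
        by (simp add: row_comb_diff row_comb_mult algebra_simps)
      then show ?thesis using is_idlD(3,6)[OF K(1)] b[OF k] c[OF k] by simp
    qed
    then have d: "w * b i - u * c i \<in> K" by (rule cancel[OF _ i])
    have "w * b i = (w * b i - u * c i) + u * c i" by simp
    then have "w * b i \<in> adjoin K 1 (\<lambda>_. u)" unfolding adjoin_one_iff using d by blast
    from regw[OF this] obtain a g where "a \<in> K" "b i = a + u * g" unfolding adjoin_one_iff by blast
    then show ?thesis by (intro exI[of _ g]) simp
  qed
  then have "\<forall>i\<in>{..<m}. \<exists>e. b i - u * e \<in> K" by blast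
  from bchoice[OF this] obtain e where e: "\<And>i. i < m \<Longrightarrow> b i - u * e i \<in> K" by auto
  have "v k - row_comb m A e k \<in> K" if k: "k \<le> m" for k
  proof (rule regu)
    have "u * (v k - row_comb m A e k) = (u * v k - row_comb m A b k) + row_comb m A (\<lambda>i. b i - u * e i) k"
      by (simp add: row_comb_diff row_comb_mult algebra_simps)
    also have "\<dots> \<in> K"
      using b[OF k] e unfolding row_comb_def
      by (intro is_idlD(2)[OF K(1)] is_idl_sum[OF K(1)] is_idlD(4)[OF K(1)]) auto
    finally show "u * (v k - row_comb m A e k) \<in> K" .
  qed
  then show "\<exists>e. \<forall>k\<le>m. v k - row_comb m A e k \<in> K" by blast
qed

lemma trunc_homogeneous:
  assumes "homogeneous_ideal K" "f \<in> K" shows "trunc t f \<in> K"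
proof -
  have "trunc t f = (\<Sum>s\<le>t. hom_component s f)"
  proof (rule poly_mapping_eqI)
    fix m
    have "lookup (\<Sum>s\<le>t. hom_component s f) m = (\<Sum>s\<le>t. if mdeg m = s then lookup f m else 0)"
      by (simp add: lookup_sum hom_component_eq_restr lookup_restr)
    then show "lookup (trunc t f) m = lookup (\<Sum>s\<le>t. hom_component s f) m"
      by (auto simp: trunc_def lookup_restr sum.delta')
  qed
  then show ?thesis using assms by (auto simp: homogeneous_ideal_iff intro!: is_idl_sum)
qed

lemma trunc_zero_linear: "l \<in> forms 1 \<Longrightarrow> trunc 0 (l * f) = 0"
  using trunc_mult_form[of l 1 0 f] by simp

text \<open>Modulo \<open>K\<close> and up to a combination of rows, a syzygy is \<open>l w\<close>, and \<open>w\<close> is again a syzygy because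
  \<open>l\<close> is a nonzerodivisor. The degree of \<open>w\<close> is smaller, which makes an induction possible.
  Truncation keeps degrees under control; it is compatible with multiplication by the rows since
  these are homogeneous.\<close>

lemma hb_exact_lift:
  assumes K: "homogeneous_ideal K" and l: "l \<in> forms 1" and reg: "\<And>g. l * g \<in> K \<Longrightarrow> g \<in> K"
    and A: "\<And>i k. i < m \<Longrightarrow> k \<le> m \<Longrightarrow> A i k \<in> forms (e i)"
    and ex: "hb_exact m A (adjoin K 1 (\<lambda>_. l))"
  shows "hb_exact m A K"
proof -
  have id: "is_idl K" using K by (simp add: homogeneous_ideal_iff)
  have decomp: "\<exists>c a w. \<forall>k\<le>m. v k = row_comb m A c k + a k + trunc t (l * w k) \<and> a k \<in> K"
    if v: "minor_form m A v \<in> K" "\<forall>k\<le>m. v k \<in> polys_le t" for t v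
  proof -
    have "minor_form m A v \<in> adjoin K 1 (\<lambda>_. l)" using v(1) adjoin_superset by blast
    then obtain c where c: "\<And>k. k \<le> m \<Longrightarrow> v k - row_comb m A c k \<in> adjoin K 1 (\<lambda>_. l)"
      using ex unfolding hb_exact_def by blast
    have "\<forall>k\<in>{..m}. \<exists>p. fst p \<in> K \<and> v k - row_comb m A c k = fst p + l * snd p"
      using c unfolding adjoin_one_iff by fastforce
    from bchoice[OF this] obtain p where p: "\<And>k. k \<le> m \<Longrightarrow> fst (p k) \<in> K"
      "\<And>k. k \<le> m \<Longrightarrow> v k = row_comb m A c k + fst (p k) + l * snd (p k)"
      by (auto simp: algebra_simps)
    define c' where "c' i = (if e i \<le> t then trunc (t - e i) (c i) else 0)" for i
    have tr: "trunc t (row_comb m A c k) = row_comb m A c' k" if "k \<le> m" for k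
      unfolding row_comb_def trunc_sum
    proof (rule sum.cong)
      fix i assume "i \<in> {..<m}"
      then have "trunc t (A i k * c i) = A i k * c' i"
        using trunc_mult_form[OF A[OF _ that], of i t "c i"] by (simp add: c'_def)
      then show "trunc t (c i * A i k) = c' i * A i k" by (simp add: mult.commute)
    qed simp
    have vk: "v k = row_comb m A c' k + trunc t (fst (p k)) + trunc t (l * snd (p k))" if "k \<le> m" for k
    proof -
      have "v k = trunc t (v k)" using v(2) that by (simp add: trunc_id)
      also have "\<dots> = trunc t (row_comb m A c k + fst (p k) + l * snd (p k))"
        by (rule arg_cong[OF p(2)[OF that]])
      finally show ?thesis by (simp add: trunc_add tr[OF that])
    qed
    have pK: "trunc t (fst (p k)) \<in> K" if "k \<le> m" for k
      by (rule trunc_homogeneous[OF K p(1)[OF that]])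
    show ?thesis
      using vk pK by (intro exI[of _ c'] exI[of _ "\<lambda>k. trunc t (fst (p k))"] exI[of _ "\<lambda>k. snd (p k)"]) auto
  qed
  have main: "\<exists>c. \<forall>k\<le>m. v k - row_comb m A c k \<in> K"
    if "minor_form m A v \<in> K" "\<forall>k\<le>m. v k \<in> polys_le t" for t v
    using that
  proof (induction t arbitrary: v)
    case 0
    obtain c a w where c: "\<forall>k\<le>m. v k = row_comb m A c k + a k + trunc 0 (l * w k) \<and> a k \<in> K"
      using decomp[OF 0] by blast
    then have "\<forall>k\<le>m. v k - row_comb m A c k \<in> K" using trunc_zero_linear[OF l] by simp
    then show ?case by blast
  next
    case (Suc t)
    obtain c a w where c: "\<forall>k\<le>m. v k = row_comb m A c k + a k + trunc (Suc t) (l * w k) \<and> a k \<in> K"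
      using decomp[OF Suc.prems] by blast
    define w' where "w' k = trunc t (w k)" for k
    have vk: "v k = (row_comb m A c k + a k) + l * w' k" "a k \<in> K" if "k \<le> m" for k
      using c that trunc_mult_form[OF l, of "Suc t"] by (auto simp: w'_def)
    have "minor_form m A v = minor_form m A (\<lambda>k. (row_comb m A c k + a k) + l * w' k)"
      by (rule minor_form_cong) (rule vk(1))
    also have "\<dots> = minor_form m A a + l * minor_form m A w'"
      by (simp add: minor_form_add minor_form_mult minor_form_row_comb)
    finally have "l * minor_form m A w' = minor_form m A v - minor_form m A a" by simp
    also have "\<dots> \<in> K" by (rule is_idlD(6)[OF id Suc.prems(1) minor_form_ideal[OF id vk(2)]])
    finally have "minor_form m A w' \<in> K" by (rule reg)
    moreover have "\<forall>k\<le>m. w' k \<in> polys_le t" by (simp add: w'_def trunc_polys_le)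
    ultimately obtain b where b: "\<forall>k\<le>m. w' k - row_comb m A b k \<in> K" using Suc.IH by blast
    have "v k - row_comb m A (\<lambda>i. c i + l * b i) k \<in> K" if "k \<le> m" for k
    proof -
      have "v k - row_comb m A (\<lambda>i. c i + l * b i) k = a k + l * (w' k - row_comb m A b k)"
        by (simp add: vk(1)[OF that] row_comb_add row_comb_mult algebra_simps)
      then show ?thesis using vk(2)[OF that] b that is_idlD(2,3)[OF id] by simp
    qed
    then show ?case by blast
  qed
  show ?thesis unfolding hb_exact_def
  proof (intro allI impI)
    fix v assume v: "minor_form m A v \<in> K"
    have "\<forall>k. \<exists>t. v k \<in> polys_le t" by (rule allI) (rule polys_le_exists)
    from choice[OF this] obtain T where T: "\<forall>k. v k \<in> polys_le (T k)" ..
    have "v k \<in> polys_le (Max (T ` {..m}))" if "k \<le> m" for k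
      using T[rule_format, of k] polys_le_mono[of "T k" "Max (T ` {..m})"] that by auto
    then show "\<exists>c. \<forall>k\<le>m. v k - row_comb m A c k \<in> K" using main[OF v] by blast
  qed
qed

lemma adjoin_cong: "(\<And>i. i < k \<Longrightarrow> l i = l' i) \<Longrightarrow> adjoin J k l = adjoin J k l'"
  by (auto simp: adjoin_def)

lemma adjoin_Suc: "adjoin (adjoin J k l) 1 (\<lambda>_. l k) = adjoin J (Suc k) l"
proof (intro subset_antisym subsetI)
  fix f assume "f \<in> adjoin (adjoin J k l) 1 (\<lambda>_. l k)"
  then obtain x h where x: "x \<in> adjoin J k l" "f = x + l k * h" unfolding adjoin_one_iff by blast
  then obtain a g where a: "x = a + (\<Sum>i<k. l i * g i)" "a \<in> J" by (auto simp: adjoin_def)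
  have eq: "f = a + (\<Sum>i<Suc k. l i * (g(k := h)) i)" by (simp add: x(2) a(1) add.assoc)
  show "f \<in> adjoin J (Suc k) l" unfolding eq by (rule adjoinI[OF a(2)])
next
  fix f assume "f \<in> adjoin J (Suc k) l"
  then obtain a g where a: "f = a + (\<Sum>i<Suc k. l i * g i)" "a \<in> J" by (auto simp: adjoin_def)
  then have "f = (a + (\<Sum>i<k. l i * g i)) + l k * g k" by (simp add: add.assoc)
  then show "f \<in> adjoin (adjoin J k l) 1 (\<lambda>_. l k)" unfolding adjoin_one_iff using adjoinI[OF a(2)] by blast
qed

text \<open>In coordinates \<open>l\<^sub>0, \<dots>, l\<^sub>3\<close> such that the line \<open>l\<^sub>0 = l\<^sub>1 = 0\<close> misses the zero locus of the minors, the
  powers \<open>l\<^sub>2\<^sup>s\<close> and \<open>l\<^sub>3\<^sup>s\<close> lie in the ideal of minors modulo \<open>(l\<^sub>0, l\<^sub>1)\<close>. This gives exactness modulo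
  \<open>(l\<^sub>0, l\<^sub>1)\<close>, which lifts to \<open>R/(l\<^sub>0)\<close> and \<open>R\<close>. Exactness modulo \<open>l\<^sub>0\<close> says that relations \<open>l\<^sub>0 g \<in> I\<close> can
  be divided by \<open>l\<^sub>0\<close>, and exactness modulo \<open>(l\<^sub>0, l\<^sub>1)\<close> gives regularity of \<open>l\<^sub>1\<close>.\<close>

lemma hilbert_burch:
  assumes good: "good 2 (minor_ideal m A)"
    and A: "\<And>i k. i < m \<Longrightarrow> k \<le> m \<Longrightarrow> A i k \<in> forms (e i)"
  obtains l where "l 0 \<in> forms 1" "l 1 \<in> forms 1"
    "\<And>g. l 0 * g \<in> minor_ideal m A \<Longrightarrow> g \<in> minor_ideal m A"
    "\<And>g. l 1 * g \<in> adjoin (minor_ideal m A) 1 l \<Longrightarrow> g \<in> adjoin (minor_ideal m A) 1 l"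
    "hb_exact m A {0}"
proof -
  let ?I = "minor_ideal m A"
  have I: "is_idl ?I" by (rule adjoin_is_idl[OF is_idl_zero])
  obtain l' s where l': "\<forall>i<2. l' i \<in> forms 1" "forms s \<subseteq> adjoin ?I 2 l'" using good by (auto simp: good_def)
  have l'01: "l' 0 \<in> forms 1" "l' 1 \<in> forms 1" using l'(1) by (simp_all add: less_2_cases_iff)
  obtain l where l: "\<And>i. l i \<in> forms 1" and ml: "l' 0 \<in> adjoin {0} 2 l" "l' 1 \<in> adjoin {0} 2 l"
    and reg: "\<And>k s g e. k < 4 \<Longrightarrow> l k ^ s * g \<in> adjoin {0} k (\<lambda>i. l i ^ e i) \<Longrightarrow> g \<in> adjoin {0} k (\<lambda>i. l i ^ e i)"
    by (rule exists_coordinates[OF l'01]) blast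
  define K where "K k = adjoin {0} k l" for k
  have Kid: "is_idl (K k)" for k unfolding K_def by (rule adjoin_is_idl[OF is_idl_zero])
  have hom0: "homogeneous_ideal {0}"
    by (auto simp: homogeneous_ideal_iff is_idl_zero hom_component_eq_restr)
  have Khom: "homogeneous_ideal (K k)" for k
    unfolding K_def by (rule adjoin_homogeneous[OF hom0 l])
  have regK: "g \<in> K k" if "k < 4" "l k ^ s * g \<in> K k" for k s g
    using reg[OF that(1), of s g "\<lambda>_. 1"] that(2) unfolding K_def by simp
  have reg1: "g \<in> K k" if "k < 4" "l k * g \<in> K k" for k g
    using regK[OF that(1), of 1 g] that(2) by simp
  have KSuc: "adjoin (K k) 1 (\<lambda>_. l k) = K (Suc k)" for k
    unfolding K_def by (rule adjoin_Suc)
  have sub: "adjoin ?I 2 l' \<subseteq> adjoin ?I 2 l"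
  proof (rule adjoin_least[OF adjoin_is_idl[OF I] adjoin_superset])
    fix i :: nat assume "i < 2"
    then have "i = 0 \<or> i = 1" by auto
    then have "l' i \<in> adjoin {0} 2 l" using ml by (elim disjE) simp_all
    moreover have "adjoin {0} 2 l \<subseteq> adjoin ?I 2 l" by (rule adjoin_mono) (use is_idlD(1)[OF I] in simp)
    ultimately show "l' i \<in> adjoin ?I 2 l" by blast
  qed
  have pow: "l k ^ s \<in> adjoin ?I 2 l" for k
    using forms_power[OF l, of k s] l'(2) sub by auto
  have ex2: "hb_exact m A (K 2)"
  proof (rule hb_exact_base[OF Kid _ pow pow])
    show "adjoin {0} 2 l = K 2" by (simp add: K_def)
    show "g \<in> K 2" if "l 2 ^ s * g \<in> K 2" for g using regK[of 2] that by simp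
    have *: "adjoin (K 2) 1 (\<lambda>_. l 2 ^ s) = adjoin {0} 3 (\<lambda>i. l i ^ (if i < 2 then 1 else s))"
    proof -
      have "K 2 = adjoin {0} 2 (\<lambda>i. l i ^ (if i < 2 then 1 else s))"
        unfolding K_def by (rule adjoin_cong) simp
      then show ?thesis using adjoin_Suc[of "{0}" 2 "\<lambda>i. l i ^ (if i < 2 then 1 else s)"]
        by (simp add: numeral_3_eq_3 numeral_2_eq_2)
    qed
    show "g \<in> adjoin (K 2) 1 (\<lambda>_. l 2 ^ s)" if "l 3 ^ s * g \<in> adjoin (K 2) 1 (\<lambda>_. l 2 ^ s)" for g
      using reg[of 3 s g "\<lambda>i. if i < 2 then 1 else s"] that unfolding * by simp
  qed
  have K21: "adjoin (K 1) 1 (\<lambda>_. l 1) = K 2" using KSuc[of 1] by (simp add: numeral_2_eq_2)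
  have K10: "adjoin (K 0) 1 (\<lambda>_. l 0) = K 1" using KSuc[of 0] by simp
  have ex1: "hb_exact m A (K 1)"
  proof (rule hb_exact_lift[OF Khom l])
    show "g \<in> K 1" if "l 1 * g \<in> K 1" for g using reg1[of 1 g] that by simp
    show "A i k \<in> forms (e i)" if "i < m" "k \<le> m" for i k by (rule A[OF that])
    show "hb_exact m A (adjoin (K 1) 1 (\<lambda>_. l 1))" unfolding K21 by (rule ex2)
  qed
  have ex0: "hb_exact m A (K 0)"
  proof (rule hb_exact_lift[OF Khom l])
    show "g \<in> K 0" if "l 0 * g \<in> K 0" for g using reg1[of 0 g] that by simp
    show "A i k \<in> forms (e i)" if "i < m" "k \<le> m" for i k by (rule A[OF that])
    show "hb_exact m A (adjoin (K 0) 1 (\<lambda>_. l 0))" unfolding K10 by (rule ex1)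
  qed
  have K0: "K 0 = {0}" by (simp add: K_def)
  have K1: "f \<in> K 1 \<longleftrightarrow> (\<exists>h. f = l 0 * h)" for f
    by (auto simp: K_def adjoin_zero_iff)
  have K2: "f \<in> K 2 \<longleftrightarrow> (\<exists>g h. f = l 0 * g + l 1 * h)" for f
  proof -
    have "f \<in> K 2 \<longleftrightarrow> (\<exists>a h. a \<in> K 1 \<and> f = a + l 1 * h)"
      unfolding K21[symmetric] by (rule adjoin_one_iff)
    then show ?thesis unfolding K1 by blast
  qed
  have Kl: "l 0 * h \<in> K 1" for h unfolding K1 by blast
  show thesis
  proof (rule that[of l])
    show "l 0 \<in> forms 1" "l 1 \<in> forms 1" by (rule l)+
    show "hb_exact m A {0}" using ex0 K0 by simp
  next
    fix g assume "l 0 * g \<in> ?I"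
    then obtain v where v: "l 0 * g = minor_form m A v" unfolding minor_ideal_iff by blast
    then have "minor_form m A v \<in> K 1" unfolding K1 by (intro exI[of _ g]) simp
    then obtain c where "\<forall>k\<le>m. v k - row_comb m A c k \<in> K 1" using ex1 unfolding hb_exact_def by blast
    then have "\<forall>k\<in>{..m}. \<exists>h. v k - row_comb m A c k = l 0 * h" unfolding K1 by blast
    from bchoice[OF this] obtain h where h: "\<forall>k\<in>{..m}. v k - row_comb m A c k = l 0 * h k" ..
    have "minor_form m A v = minor_form m A (\<lambda>k. v k - row_comb m A c k)"
      by (simp add: minor_form_diff minor_form_row_comb)
    also have "\<dots> = minor_form m A (\<lambda>k. l 0 * h k)" by (rule minor_form_cong) (use h in auto)
    also have "\<dots> = l 0 * minor_form m A h" by (rule minor_form_mult)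
    finally have "l 0 * (g - minor_form m A h) \<in> K 0" using v by (simp add: K0 right_diff_distrib)
    from reg1[OF _ this] have "g = minor_form m A h" by (simp add: K0)
    then show "g \<in> ?I" unfolding minor_ideal_iff by blast
  next
    fix g assume "l 1 * g \<in> adjoin ?I 1 l"
    then obtain x h' where x: "l 1 * g = x + l 0 * h'" "x \<in> ?I" by (auto simp: adjoin_def[of ?I])
    then obtain v where v: "x = minor_form m A v" unfolding minor_ideal_iff by blast
    have "x = l 0 * (- h') + l 1 * g" using x(1) by simp
    then have "minor_form m A v \<in> K 2" unfolding K2 v by blast
    then obtain c where "\<forall>k\<le>m. v k - row_comb m A c k \<in> K 2" using ex2 unfolding hb_exact_def by blast
    then have "\<forall>k\<in>{..m}. \<exists>p. v k - row_comb m A c k = l 0 * fst p + l 1 * snd p"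
      unfolding K2 by fastforce
    from bchoice[OF this] obtain p where p: "\<forall>k\<in>{..m}. v k - row_comb m A c k = l 0 * fst (p k) + l 1 * snd (p k)" ..
    have "minor_form m A v = minor_form m A (\<lambda>k. v k - row_comb m A c k)"
      by (simp add: minor_form_diff minor_form_row_comb)
    also have "\<dots> = minor_form m A (\<lambda>k. l 0 * fst (p k) + l 1 * snd (p k))"
      by (rule minor_form_cong) (use p in auto)
    also have "\<dots> = l 0 * minor_form m A (\<lambda>k. fst (p k)) + l 1 * minor_form m A (\<lambda>k. snd (p k))"
      by (simp add: minor_form_add minor_form_mult)
    finally have "l 1 * (g - minor_form m A (\<lambda>k. snd (p k))) = l 0 * (minor_form m A (\<lambda>k. fst (p k)) + h')"
      using x(1) v by (simp add: algebra_simps)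
    then have "l 1 * (g - minor_form m A (\<lambda>k. snd (p k))) \<in> K 1" unfolding K1 by (rule exI)
    from reg1[OF _ this] obtain h where "g - minor_form m A (\<lambda>k. snd (p k)) = l 0 * h" unfolding K1 by auto
    then have "g = minor_form m A (\<lambda>k. snd (p k)) + l 0 * h" by (simp add: algebra_simps)
    moreover have "minor_form m A (\<lambda>k. snd (p k)) \<in> ?I" unfolding minor_ideal_iff by blast
    ultimately show "g \<in> adjoin ?I 1 l" using adjoinI[of _ ?I l "\<lambda>_. h" 1] by simp
  qed
qed

section \<open>The Hilbert function of the ideal of maximal minors\<close>

text \<open>Determinants of matrices with homogeneous rows are homogeneous, for any grading.\<close>

lemma det_graded:
  fixes G :: "'g::comm_monoid_add \<Rightarrow> 'a::comm_ring_1 set"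
  assumes zero: "\<And>s. 0 \<in> G s" and one: "1 \<in> G 0" and neg: "\<And>s a. a \<in> G s \<Longrightarrow> - a \<in> G s"
    and add: "\<And>s a b. a \<in> G s \<Longrightarrow> b \<in> G s \<Longrightarrow> a + b \<in> G s"
    and mult: "\<And>s t a b. a \<in> G s \<Longrightarrow> b \<in> G t \<Longrightarrow> a * b \<in> G (s + t)"
    and M: "M \<in> carrier_mat n n" and rows: "\<And>i j. i < n \<Longrightarrow> j < n \<Longrightarrow> M $$ (i, j) \<in> G (e i)"
  shows "Determinant.det M \<in> G (\<Sum>i<n. e i)"
proof -
  have prod: "(\<Prod>i\<in>S. f i) \<in> G (\<Sum>i\<in>S. e i)" if "finite S" "\<And>i. i \<in> S \<Longrightarrow> f i \<in> G (e i)" for S :: "nat set" and f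
    using that by (induction S) (auto intro: one mult)
  have sum: "(\<Sum>p\<in>S. f p) \<in> G s" if "finite S" "\<And>p. p \<in> S \<Longrightarrow> f p \<in> G s" for S :: "(nat \<Rightarrow> nat) set" and f s
    using that by (induction S) (auto intro: zero add)
  show ?thesis
    unfolding det_def'[OF M]
  proof (rule sum)
    show "finite {p. p permutes {0..<n}}" by (simp add: finite_permutations)
    fix p assume "p \<in> {p. p permutes {0..<n}}"
    then have p: "p permutes {0..<n}" by simp
    have "(\<Prod>i\<in>{0..<n}. M $$ (i, p i)) \<in> G (\<Sum>i\<in>{0..<n}. e i)"
      by (rule prod) (use rows permutes_in_image[OF p] in auto)
    then show "signof p * (\<Prod>i = 0..<n. M $$ (i, p i)) \<in> G (\<Sum>i<n. e i)"
      by (auto simp: sign_def lessThan_atLeast0 intro: neg)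
  qed
qed

lemma sminor_forms:
  assumes A: "\<And>i k. i < m \<Longrightarrow> k \<le> m \<Longrightarrow> A i k \<in> forms (e i)" and j: "j \<le> m"
  shows "sminor m A j \<in> forms (\<Sum>i<m. e i)"
proof -
  let ?M = "mat_delete (bordered m A (\<lambda>_. 0)) m j"
  have neg: "- a \<in> forms s" if "a \<in> forms s" for a s using forms_diff[OF forms_0 that] by simp
  have "Determinant.det ?M \<in> forms (\<Sum>i<m. e i)"
  proof (rule det_graded[where n = m])
    show "?M \<in> carrier_mat m m" by (rule carrier_matI) (auto simp: bordered_def)
    show "?M $$ (i, k) \<in> forms (e i)" if "i < m" "k < m" for i k
      using that A by (auto simp: mat_delete_def bordered_def)
  qed (auto intro: neg forms_add forms_mult)
  then show ?thesis
    unfolding sminor_def cofactor_def by (cases "even (m + j)") (auto intro: neg)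
qed

lemma minor_ideal_homogeneous:
  assumes A: "\<And>i k. i < m \<Longrightarrow> k \<le> m \<Longrightarrow> A i k \<in> forms (e i)"
  shows "homogeneous_ideal (minor_ideal m A)"
proof (rule adjoin_homogeneous)
  show "homogeneous_ideal {0}" by (auto simp: homogeneous_ideal_iff is_idl_zero hom_component_eq_restr)
  show "sminor m A j \<in> forms (\<Sum>i<m. e i)" if "j < Suc m" for j
    by (rule sminor_forms) (use A that in auto)
qed

lemma binomial_3_real: "real ((t + 3) choose 3) = (real t + 1) * (real t + 2) * (real t + 3) / 6"
proof (induction t)
  case (Suc t)
  have two: "real ((k + 2) choose 2) = (real k + 1) * (real k + 2) / 2" for k
    by (induction k) (simp_all add: numeral_2_eq_2 field_simps)
  have "(Suc t + 3) choose 3 = ((t + 3) choose 2) + ((t + 3) choose 3)"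
    by (simp add: numeral_3_eq_3 numeral_2_eq_2)
  then have "real ((Suc t + 3) choose 3) = (real (Suc t) + 1) * (real (Suc t) + 2) / 2
      + (real t + 1) * (real t + 2) * (real t + 3) / 6"
    using two[of "Suc t"] Suc by (simp add: numeral_3_eq_3 numeral_2_eq_2)
  then show ?case by (simp add: field_simps)
qed simp

context
  fixes m :: nat and A :: "nat \<Rightarrow> nat \<Rightarrow> mpoly4" and e :: "nat \<Rightarrow> nat" and n :: nat
  assumes A: "\<And>i k. i < m \<Longrightarrow> k \<le> m \<Longrightarrow> A i k \<in> forms (e i)"
    and e: "\<And>i. i < m \<Longrightarrow> e i \<le> 1" and n: "n = (\<Sum>i<m. e i)"
    and exact: "hb_exact m A {0}" and nonzero: "\<exists>j\<le>m. sminor m A j \<noteq> 0"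
begin

lemma minor_forms: "j \<le> m \<Longrightarrow> sminor m A j \<in> forms n"
  unfolding n by (rule sminor_forms[OF A])

text \<open>Rank--nullity along the complex \<open>R(-n)\<^bsup>m-n\<^esup> \<oplus> R(-n-1)\<^bsup>n\<^esup> \<rightarrow> R(-n)\<^bsup>m+1\<^esup> \<rightarrow> I\<close> in degree \<open>n + a\<close>. The
  assumption \<open>a \<ge> 1\<close> ensures that \<open>a - e i\<close> is not truncated.\<close>

lemma dim_minor_ideal:
  assumes a: "a \<ge> 1"
  shows "cdim (minor_ideal m A \<inter> forms (n + a)) + (\<Sum>i<m. (a - e i + 3) choose 3)
    = Suc m * ((a + 3) choose 3)"
proof -
  let ?I = "minor_ideal m A" and ?V = "form_tuples (Suc m) (\<lambda>_. a)"
  let ?W = "form_tuples m (\<lambda>i. a - e i)"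
  let ?T = "\<lambda>c k. if k \<le> m then row_comb m A c k else 0"
  have linD: "Vector_Spaces.linear tscale cscale (minor_form m A)"
    unfolding Vector_Spaces.linear_iff
    by (auto simp: vector_space_tscale vector_space_cscale minor_form_def tscale_def plus_fun_def
        distrib_left sum.distrib cs.scale_sum_right cscale_mult_right)
  have linT: "Vector_Spaces.linear tscale tscale ?T"
    unfolding Vector_Spaces.linear_iff
    by (auto simp: vector_space_tscale row_comb_def tscale_def fun_eq_iff
        distrib_right sum.distrib cs.scale_sum_right cscale_mult_left)
  have image: "minor_form m A ` ?V = ?I \<inter> forms (n + a)"
  proof (intro subset_antisym subsetI)
    fix f assume "f \<in> minor_form m A ` ?V"
    then obtain v where v: "v \<in> ?V" "f = minor_form m A v" by blast
    have "sminor m A j * v j \<in> forms (n + a)" if "j \<le> m" for j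
      using v(1) that by (intro forms_mult minor_forms) (auto simp: form_tuples_def)
    then have "f \<in> forms (n + a)" unfolding v(2) minor_form_def by (intro forms_sum) auto
    moreover have "f \<in> ?I" unfolding minor_ideal_iff using v(2) by blast
    ultimately show "f \<in> ?I \<inter> forms (n + a)" by blast
  next
    fix f assume f: "f \<in> ?I \<inter> forms (n + a)"
    then obtain v where v: "f = minor_form m A v" using minor_ideal_iff by blast
    define w where "w j = (if j \<le> m then hom_component a (v j) else 0)" for j
    have "f = hom_component (n + a) f" using f hom_component_id by simp
    also have "\<dots> = minor_form m A w"
      unfolding v minor_form_def hom_component_sum
      by (rule sum.cong) (use hom_component_mult_form[OF minor_forms] in \<open>auto simp: w_def\<close>)
    finally have fw: "f = minor_form m A w" .
    have "w \<in> ?V" by (auto simp: form_tuples_def w_def hom_component_forms)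
    then show "f \<in> minor_form m A ` ?V" using fw by blast
  qed
  have kernel: "{v\<in>?V. minor_form m A v = 0} = ?T ` ?W"
  proof (intro subset_antisym subsetI)
    fix v assume v: "v \<in> {v\<in>?V. minor_form m A v = 0}"
    then obtain c where c: "\<And>k. k \<le> m \<Longrightarrow> v k = row_comb m A c k"
      using exact unfolding hb_exact_def by fastforce
    define c' where "c' i = (if i < m then hom_component (a - e i) (c i) else 0)" for i
    have "v k = ?T c' k" for k
    proof (cases "k \<le> m")
      case True
      have "v k = hom_component a (v k)"
        using v True hom_component_id[of "v k" a] by (auto simp: form_tuples_def)
      also have "\<dots> = row_comb m A c' k"
        unfolding c[OF True] row_comb_def hom_component_sum
      proof (rule sum.cong)
        fix i assume i: "i \<in> {..<m}"
        then have "e i \<le> a" using e[of i] a by auto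
        then have "hom_component a (A i k * c i) = A i k * c' i"
          using hom_component_mult_form[OF A[of i k]] i True by (simp add: c'_def)
        then show "hom_component a (c i * A i k) = c' i * A i k" by (simp add: mult.commute)
      qed simp
      finally show ?thesis using True by simp
    qed (use v in \<open>auto simp: form_tuples_def\<close>)
    then have "v = ?T c'" by (rule ext)
    moreover have "c' \<in> ?W" by (auto simp: form_tuples_def c'_def hom_component_forms)
    ultimately show "v \<in> ?T ` ?W" by blast
  next
    fix v assume "v \<in> ?T ` ?W"
    then obtain c where c: "c \<in> ?W" "v = ?T c" by blast
    have "row_comb m A c k \<in> forms a" if "k \<le> m" for k
      unfolding row_comb_def
    proof (rule forms_sum)
      fix i assume i: "i \<in> {..<m}"
      then have "c i * A i k \<in> forms (a - e i + e i)"
        using c(1) A[of i k] that by (intro forms_mult) (auto simp: form_tuples_def)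
      then show "c i * A i k \<in> forms a" using e[of i] i a by simp
    qed
    then have "v \<in> ?V" by (auto simp: form_tuples_def c(2))
    moreover have "minor_form m A v = minor_form m A (row_comb m A c)"
      by (rule minor_form_cong) (simp add: c(2))
    ultimately show "v \<in> {v\<in>?V. minor_form m A v = 0}" by (simp add: minor_form_row_comb)
  qed
  have dimV: "ts.dim ?V = Suc m * ((a + 3) choose 3)"
    using dim_form_tuples[of "Suc m" "\<lambda>_. a"] by (simp add: dim_forms)
  have "ts.dim (?T ` ?W) = ts.dim ?W"
  proof (rule tts.dim_image_inj[OF linT form_tuples_subspace conjunct1[OF dim_form_tuples]])
    fix c assume c: "c \<in> ?W" "?T c = 0"
    obtain j where j: "j \<le> m" "sminor m A j \<noteq> 0" using nonzero by blast
    have "row_comb m A c k \<in> {0}" if "k \<le> m" for k using fun_cong[OF c(2), of k] that by simp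
    then have "c i * sminor m A j \<in> {0}" if "i < m" for i
      using minor_rows_independent[OF is_idl_zero _ that j(1)] by blast
    then have "c i = 0" if "i < m" for i using j(2) that by simp
    then show "c = 0" using c(1) by (auto simp: form_tuples_def fun_eq_iff) (metis not_le)
  qed
  then have dimW: "ts.dim (?T ` ?W) = (\<Sum>i<m. (a - e i + 3) choose 3)"
    using dim_form_tuples[of m "\<lambda>i. a - e i"] by (simp add: dim_forms)
  show ?thesis
    using tcs.rank_nullity[OF linD form_tuples_subspace conjunct1[OF dim_form_tuples[of "Suc m" "\<lambda>_. a"]]]
    unfolding image kernel dimV dimW by simp
qed

text \<open>With \<open>h t = dim [R]\<^sub>t\<close> the Hilbert function is \<open>h t - (n + 1) h (t - n) + n h (t - n - 1)\<close>. The ranks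
  \<open>1 - (n + 1) + n\<close> cancel, as does the quadratic term, and \<open>\<beta>\<close> is the value of the remaining linear
  polynomial at \<open>0\<close>.\<close>

lemma hilbert_fun_minor_ideal:
  assumes t: "t \<ge> n + 1"
  defines "\<beta> \<equiv> 1 - (real n + 1) * ((1 - real n) * (2 - real n) * (3 - real n) / 6)
    + real n * ((- real n) * (1 - real n) * (2 - real n) / 6)"
  shows "real (hilbert_fun (minor_ideal m A) t) = real n * (real n + 1) / 2 * real t + \<beta>"
proof -
  let ?I = "minor_ideal m A"
  obtain a where a: "t = n + a" "a \<ge> 1" using t by (metis add_leD1 add_le_cancel_left le_Suc_ex)
  define h where "h x = real ((x + 3) choose 3)" for x :: nat
  have step: "h (a - e i) = h a - real (e i) * (h a - h (a - 1))" if "i < m" for i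
    using e[OF that] by (cases "e i = 0") (auto simp: le_Suc_eq)
  have "(\<Sum>i<m. h (a - e i)) = (\<Sum>i<m. h a - real (e i) * (h a - h (a - 1)))"
    by (rule sum.cong) (auto simp: step)
  also have "\<dots> = real m * h a - real n * (h a - h (a - 1))"
    by (simp add: sum_subtractf n sum_distrib_right)
  finally have s: "(\<Sum>i<m. h (a - e i)) = real m * h a - real n * (h a - h (a - 1))" .
  have "real (cdim (?I \<inter> forms t)) + (\<Sum>i<m. h (a - e i)) = (real m + 1) * h a"
    using arg_cong[OF dim_minor_ideal[OF a(2)], of real] unfolding h_def a(1) of_nat_add of_nat_sum of_nat_mult by simp
  then have dI: "real (cdim (?I \<inter> forms t)) = (real n + 1) * h a - real n * h (a - 1)"
    unfolding s by (simp add: algebra_simps)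
  have "cdim (?I \<inter> forms t) \<le> cdim (forms t)" by (rule cs.dim_mono_fin[OF _ fin_dim_forms]) auto
  then have "real (hilbert_fun ?I t) = h t - real (cdim (?I \<inter> forms t))"
    unfolding hilbert_fun_def h_def dim_forms by simp
  also have "\<dots> = h t - (real n + 1) * h a + real n * h (a - 1)" unfolding dI by simp
  also have "\<dots> = real n * (real n + 1) / 2 * real t + \<beta>"
  proof -
    have ra: "real a = real t - real n" "real (a - 1) = real t - real n - 1" using a by auto
    show ?thesis unfolding h_def binomial_3_real ra \<beta>_def by (simp add: field_simps power2_eq_square power3_eq_cube)
  qed
  finally show ?thesis .
qed

lemma has_degree_minor_ideal:
  assumes "n \<ge> 1"
  shows "has_degree (minor_ideal m A) ((n + 1) choose 2)"
proof -
  obtain \<beta> where \<beta>: "\<And>t. t \<ge> n + 1 \<Longrightarrow> real (hilbert_fun (minor_ideal m A) t) = real n * (real n + 1) / 2 * real t + \<beta>"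
    using hilbert_fun_minor_ideal by blast
  define H where "H = [:\<beta>, real n * (real n + 1) / 2:]"
  have c: "real n * (real n + 1) / 2 \<noteq> 0" using assms by simp
  have deg: "Polynomial.degree H = 1" "Polynomial.lead_coeff H = real n * (real n + 1) / 2"
    using c by (simp_all add: H_def)
  moreover have "\<forall>\<^sub>F t in sequentially. real (hilbert_fun (minor_ideal m A) t) = poly H (real t)"
    unfolding eventually_sequentially
  proof (intro exI[of _ "n + 1"] allI impI)
    fix t assume "t \<ge> n + 1"
    from \<beta>[OF this] show "real (hilbert_fun (minor_ideal m A) t) = poly H (real t)" by (simp add: H_def algebra_simps)
  qed
  moreover have two: "real ((k + 1) choose 2) = real k * (real k + 1) / 2" for k
    by (induction k) (simp_all add: numeral_2_eq_2 field_simps)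
  have "fact (Polynomial.degree H) * Polynomial.lead_coeff H = real ((n + 1) choose 2)"
    unfolding deg(2) two unfolding deg(1) by simp
  ultimately show ?thesis unfolding has_degree_def by blast
qed

lemma hilbert_fun_linear_bound: "\<exists>B. \<forall>t. hilbert_fun (minor_ideal m A) t \<le> B * (t + 1)"
proof -
  let ?h = "hilbert_fun (minor_ideal m A)"
  obtain \<beta> where \<beta>: "\<And>t. t \<ge> n + 1 \<Longrightarrow> real (?h t) = real n * (real n + 1) / 2 * real t + \<beta>"
    using hilbert_fun_minor_ideal by blast
  define \<alpha> where "\<alpha> = real n * (real n + 1) / 2"
  have \<alpha>: "\<alpha> \<ge> 0" by (simp add: \<alpha>_def)
  define b where "b = nat \<lceil>\<alpha> + \<bar>\<beta>\<bar>\<rceil>"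
  have b: "\<alpha> + \<bar>\<beta>\<bar> \<le> real b" unfolding b_def using \<alpha> by (simp add: of_nat_ceiling)
  let ?B = "b + (\<Sum>s\<le>n. ?h s)"
  have "?h t \<le> ?B * (t + 1)" for t
  proof (cases "t \<le> n")
    case True
    have "?h t \<le> (\<Sum>s\<le>n. ?h s)" using member_le_sum[of t "{..n}" ?h] True by simp
    then show ?thesis by (simp add: algebra_simps trans_le_add1 trans_le_add2)
  next
    case False
    then have "real (?h t) = \<alpha> * real t + \<beta>" using \<beta>[of t] by (simp add: \<alpha>_def)
    also have "\<dots> \<le> (\<alpha> + \<bar>\<beta>\<bar>) * (real t + 1)"
    proof -
      have "(\<alpha> + \<bar>\<beta>\<bar>) * (real t + 1) = \<alpha> * real t + \<alpha> + \<bar>\<beta>\<bar> * real t + \<bar>\<beta>\<bar>"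
        by (simp add: algebra_simps)
      moreover have "0 \<le> \<bar>\<beta>\<bar> * real t" by simp
      ultimately show ?thesis using \<alpha> by linarith
    qed
    also have "\<dots> \<le> real b * (real t + 1)" using b by (intro mult_right_mono) auto
    also have "\<dots> = real (b * (t + 1))" by (simp add: algebra_simps)
    finally have "?h t \<le> b * (t + 1)" unfolding of_nat_le_iff .
    then show ?thesis by (simp add: algebra_simps)
  qed
  then show ?thesis by blast
qed

end

section \<open>Depth and Krull dimension\<close>

subsection \<open>Primes avoiding a multiplicative set\<close>

text \<open>An ideal that is maximal among those disjoint from a multiplicative set is prime.\<close>

lemma exists_prime_avoiding:
  assumes J: "is_idl J" and S: "1 \<in> S" "\<And>a b. a \<in> S \<Longrightarrow> b \<in> S \<Longrightarrow> a * b \<in> S" and dis: "J \<inter> S = {}"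
  obtains Q where "primeideal Q R4" "J \<subseteq> Q" "Q \<inter> S = {}"
proof -
  let ?A = "{K. is_idl K \<and> J \<subseteq> K \<and> K \<inter> S = {}}"
  have "\<exists>M\<in>(?A). \<forall>K\<in>(?A). M \<subseteq> K \<longrightarrow> K = M"
  proof (rule subset_Zorn_nonempty)
    show "?A \<noteq> {}" using J dis by blast
    fix C assume C: "C \<noteq> {}" "subset.chain ?A C"
    have CA: "C \<subseteq> ?A" using C(2) by (auto simp: subset.chain_def)
    have id: "is_idl K" if "K \<in> C" for K using that CA by blast
    have "is_idl (\<Union>C)" by (rule union_chain_is_idl[OF C id])
    then show "\<Union>C \<in> ?A" using C(1) CA by blast
  qed
  then obtain M where M: "is_idl M" "J \<subseteq> M" "M \<inter> S = {}"
    and max: "\<And>K. is_idl K \<Longrightarrow> K \<inter> S = {} \<Longrightarrow> M \<subseteq> K \<Longrightarrow> K = M" by auto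
  have meet: "\<exists>x p. x \<in> M \<and> x + a * p \<in> S" if a: "a \<notin> M" for a
  proof -
    let ?K = "adjoin M 1 (\<lambda>_. a)"
    have "a \<in> ?K" using adjoin_gen[OF M(1), of 0 1 "\<lambda>_. a"] by simp
    then have "?K \<noteq> M" using a by blast
    then have "?K \<inter> S \<noteq> {}" using max[OF adjoin_is_idl[OF M(1)] _ adjoin_superset] by blast
    then obtain y where y: "y \<in> ?K" "y \<in> S" by blast
    from y(1) obtain x p where "x \<in> M" "y = x + a * p" unfolding adjoin_one_iff by blast
    then show ?thesis using y(2) by blast
  qed
  have "primeideal M R4"
    unfolding primeideal_R4_iff
  proof (intro conjI allI impI M(1))
    show "M \<noteq> UNIV" using M(3) S(1) by blast
    fix a b assume ab: "a * b \<in> M"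
    show "a \<in> M \<or> b \<in> M"
    proof (rule ccontr)
      assume "\<not> (a \<in> M \<or> b \<in> M)"
      then obtain x p y q where xy: "x \<in> M" "x + a * p \<in> S" "y \<in> M" "y + b * q \<in> S"
        using meet by meson
      have "(x + a * p) * (y + b * q) = x * (y + b * q) + y * (a * p) + (a * b) * (p * q)"
        by (simp add: algebra_simps)
      moreover have "\<dots> \<in> M"
        by (intro is_idlD(2)[OF M(1)] is_idlD(4)[OF M(1) xy(1)] is_idlD(4)[OF M(1) xy(3)] is_idlD(4)[OF M(1) ab])
      ultimately show False using S(2)[OF xy(2,4)] M(3) by auto
    qed
  qed
  then show thesis using that M by blast
qed

text \<open>The products of powers of \<open>f\<close> with elements outside \<open>P\<close> form a multiplicative set, which is
  disjoint from \<open>J\<close> because \<open>f\<close> is a nonzerodivisor modulo \<open>J\<close>. A prime that avoids it lies in \<open>P\<close> and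
  does not contain \<open>f\<close>.\<close>

lemma smaller_prime:
  assumes J: "is_idl J" and P: "primeideal P R4" "J \<subseteq> P" "f \<in> P"
    and reg: "\<And>g. f * g \<in> J \<Longrightarrow> g \<in> J"
  obtains Q where "primeideal Q R4" "J \<subseteq> Q" "Q \<subset> P"
proof -
  let ?S = "{f ^ a * s | a s. s \<notin> P}"
  have Pid: "is_idl P" and prime: "\<And>a b. a * b \<in> P \<Longrightarrow> a \<in> P \<or> b \<in> P" and "P \<noteq> UNIV"
    using P(1) unfolding primeideal_R4_iff by blast+
  have P1: "1 \<notin> P" using \<open>P \<noteq> UNIV\<close> is_idlD(3)[OF Pid, of 1] by auto
  have pow: "s \<in> J" if "f ^ a * s \<in> J" for a s
    using that by (induction a) (auto intro: reg simp: mult.assoc)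
  obtain Q where Q: "primeideal Q R4" "J \<subseteq> Q" "Q \<inter> ?S = {}"
  proof (rule exists_prime_avoiding[OF J, of ?S])
    show "1 \<in> ?S" using P1 by (intro CollectI exI[of _ 0] exI[of _ 1]) simp
    show "a * b \<in> ?S" if ab: "a \<in> ?S" "b \<in> ?S" for a b
    proof -
      obtain i s j t where st: "a = f ^ i * s" "s \<notin> P" "b = f ^ j * t" "t \<notin> P" using ab by blast
      have "a * b = f ^ (i + j) * (s * t)" by (simp add: st power_add mult_ac)
      moreover have "s * t \<notin> P" using prime st by blast
      ultimately show ?thesis by blast
    qed
    show "J \<inter> ?S = {}" using pow P(2) by blast
  qed
  have "Q \<subseteq> P"
  proof
    fix s assume s: "s \<in> Q"
    show "s \<in> P"
    proof (rule ccontr)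
      assume "s \<notin> P"
      then have "f ^ 0 * s \<in> ?S" by blast
      then show False using s Q(3) by auto
    qed
  qed
  moreover have "f ^ 1 * 1 \<in> ?S" using P1 by blast
  then have "f \<notin> Q" using Q(3) by auto
  ultimately show thesis using that Q P(3) by blast
qed

text \<open>Start with a prime that contains the whole regular sequence. Dropping its members one at a time,
  from the last to the first, each step leaves room for a strictly smaller prime.\<close>

lemma depth_le_krull:
  shows "depth_quot I \<le> krull_dim_quot I"
  unfolding depth_quot_def
proof (rule Sup_least, clarify)
  fix fs assume fs: "regular_sequence_mod I fs"
  let ?J = "\<lambda>k. genideal R4 (I \<union> set (take k fs))"
  have chain: "\<exists>c. (\<forall>i\<le>k. primeideal (c i) R4 \<and> I \<subseteq> c i) \<and> (\<forall>i<k. c i \<subset> c (Suc i)) \<and> c k = P"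
    if "k \<le> length fs" "primeideal P R4" "?J k \<subseteq> P" for k P
    using that
  proof (induction k arbitrary: P)
    case 0
    have "I \<subseteq> P" using 0(3) genideal_incl by fastforce
    then show ?case using 0 by (intro exI[of _ "\<lambda>_. P"]) auto
  next
    case (Suc k)
    have k: "k < length fs" using Suc.prems by simp
    have "set (take (Suc k) fs) = insert (fs ! k) (set (take k fs))"
      using k by (simp add: take_Suc_conv_app_nth)
    then have JS: "I \<union> set (take k fs) \<subseteq> ?J (Suc k)" "fs ! k \<in> ?J (Suc k)"
      using genideal_incl[of "I \<union> set (take (Suc k) fs)"] by auto
    then have "?J k \<subseteq> ?J (Suc k)" by (intro genideal_least genideal_is_idl)
    then have P: "?J k \<subseteq> P" "fs ! k \<in> P" using Suc.prems(3) JS(2) by auto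
    have reg: "g \<in> ?J k" if "fs ! k * g \<in> ?J k" for g
      using fs k that unfolding regular_sequence_mod_def by blast
    obtain Q where Q: "primeideal Q R4" "?J k \<subseteq> Q" "Q \<subset> P"
      by (rule smaller_prime[OF genideal_is_idl Suc.prems(2) P reg])
    obtain c where c: "\<forall>i\<le>k. primeideal (c i) R4 \<and> I \<subseteq> c i" "\<forall>i<k. c i \<subset> c (Suc i)" "c k = Q"
      using Suc.IH[OF _ Q(1,2)] k by auto
    have IP: "I \<subseteq> P" using P(1) genideal_incl by blast
    define c' where "c' i = (if i \<le> k then c i else P)" for i
    have "\<forall>i\<le>Suc k. primeideal (c' i) R4 \<and> I \<subseteq> c' i" using c(1) Suc.prems(2) IP by (simp add: c'_def)
    moreover have "c' i \<subset> c' (Suc i)" if "i < Suc k" for i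
      using c(2,3) Q(3) that by (cases "i = k") (auto simp: c'_def)
    moreover have "c' (Suc k) = P" by (simp add: c'_def)
    ultimately show ?case by blast
  qed
  let ?n = "length fs"
  have "?J ?n \<noteq> UNIV" using fs by (simp add: regular_sequence_mod_def)
  then have "1 \<notin> ?J ?n" using is_idlD(3)[OF genideal_is_idl, of 1] by fastforce
  then obtain P where P: "primeideal P R4" "?J ?n \<subseteq> P"
    using exists_prime_avoiding[OF genideal_is_idl[of "I \<union> set (take ?n fs)"], of "{1}"] by auto
  obtain c where c: "\<forall>i\<le>?n. primeideal (c i) R4 \<and> I \<subseteq> c i" "\<forall>i<?n. c i \<subset> c (Suc i)"
    using chain[OF order_refl P] by blast
  show "ereal (real ?n) \<le> krull_dim_quot I"
    unfolding krull_dim_quot_def chain_dim_def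
    by (rule Sup_upper) (use c in blast)
qed

subsection \<open>Chains of primes and growth\<close>

lemma dim_sum_le:
  assumes "cs.fin_dim V" "cs.fin_dim (W :: 'v cpoly set)"
  shows "cdim {v + w | v w. v \<in> V \<and> w \<in> W} \<le> cdim V + cdim W"
proof -
  obtain B where B: "B \<subseteq> V" "finite B" "cs.independent B" "V \<subseteq> cs.span B" "card B = cdim V" 
    by (rule cs.fin_dim_basis[OF assms(1)])
  obtain C where C: "C \<subseteq> W" "finite C" "cs.independent C" "W \<subseteq> cs.span C" "card C = cdim W" 
    by (rule cs.fin_dim_basis[OF assms(2)])
  have "V \<subseteq> cs.span (B \<union> C)" "W \<subseteq> cs.span (B \<union> C)"
    using B C cs.span_mono[of B "B \<union> C"] cs.span_mono[of C "B \<union> C"] by auto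
  then have "{v + w | v w. v \<in> V \<and> w \<in> W} \<subseteq> cs.span (B \<union> C)" by (auto intro!: cs.span_add)
  then have "cdim {v + w | v w. v \<in> V \<and> w \<in> W} \<le> card (B \<union> C)" using B C by (intro cs.dim_le_card) auto
  also have "\<dots> \<le> card B + card C" by (rule card_Un_le)
  finally show ?thesis using B C by simp
qed

text \<open>The dimension of the image of the polynomials of degree at most \<open>t\<close> in \<open>R/P\<close>. The filtration by
  degree takes the place of a grading, since the primes in a chain need not be homogeneous.\<close>

definition quot_dim :: "mpoly4 set \<Rightarrow> nat \<Rightarrow> nat" where
  "quot_dim P t = cdim (polys_le t) - cdim (P \<inter> polys_le t)"

lemma fin_dim_Int: "cs.fin_dim (P \<inter> polys_le t)"
  by (rule cs.fin_dim_subset[OF fin_dim_polys_le]) auto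

lemma quot_dim_add: "quot_dim P t + cdim (P \<inter> polys_le t) = cdim (polys_le t)"
  unfolding quot_dim_def using cs.dim_mono_fin[OF _ fin_dim_polys_le, of "P \<inter> polys_le t" t] by simp

lemma quot_dim_le_hilbert:
  assumes P: "is_idl P" "I \<subseteq> P"
  shows "quot_dim P t \<le> (\<Sum>s\<le>t. hilbert_fun I s)"
proof -
  have Psub: "cs.subspace P" by (rule is_idl_subspace[OF P(1)])
  obtain h :: "mpoly4 \<Rightarrow> mpoly4" where h: "Vector_Spaces.linear cscale cscale h" "\<And>x. h x = 0 \<longleftrightarrow> x \<in> P"
    by (rule cs.exists_quotient_map[OF Psub]) (rule that)
  have q: "cdim (h ` V) + cdim (V \<inter> P) = cdim V" if "cs.subspace V" "cs.fin_dim V" for V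
    using csp.rank_nullity[OF h(1) that] by (simp add: h(2) Int_def)
  have forms: "cdim (h ` forms s) \<le> hilbert_fun I s" for s
  proof -
    have "cdim (I \<inter> forms s) \<le> cdim (forms s \<inter> P)"
    proof (rule cs.dim_mono_fin)
      show "I \<inter> forms s \<subseteq> forms s \<inter> P" using P(2) by blast
      show "cs.fin_dim (forms s \<inter> P)" by (rule cs.fin_dim_subset[OF fin_dim_forms]) blast
    qed
    then show ?thesis using q[OF forms_subspace fin_dim_forms, of s] unfolding hilbert_fun_def by simp
  qed
  have "cdim (h ` polys_le t) \<le> (\<Sum>s\<le>t. cdim (h ` forms s))"
  proof (induction t)
    case 0
    have "polys_le 0 = forms 0" by (auto simp: polys_le_def forms_def)
    then show ?case by simp
  next
    case (Suc t)
    have "h ` polys_le (Suc t) \<subseteq> {v + w | v w. v \<in> h ` polys_le t \<and> w \<in> h ` forms (Suc t)}"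
    proof
      fix y assume "y \<in> h ` polys_le (Suc t)"
      then obtain f where f: "f \<in> polys_le (Suc t)" "y = h f" by blast
      let ?g = "\<Sum>s\<le>t. hom_component s f"
      have "f = ?g + hom_component (Suc t) f" using polys_le_sum_components[OF f(1)] by simp
      then have "y = h ?g + h (hom_component (Suc t) f)"
        using csp.linear_add[OF h(1)] f(2) by metis
      moreover have "?g \<in> polys_le t"
        using hom_component_forms forms_polys_le polys_le_mono
        by (intro cs.subspace_sum[OF polys_le_subspace]) (meson atMost_iff subsetD)
      ultimately show "y \<in> {v + w | v w. v \<in> h ` polys_le t \<and> w \<in> h ` forms (Suc t)}"
        using hom_component_forms by blast
    qed
    then have "cdim (h ` polys_le (Suc t)) \<le> cdim {v + w | v w. v \<in> h ` polys_le t \<and> w \<in> h ` forms (Suc t)}"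
      by (rule cs.dim_mono_fin)
         (intro cs.fin_dim_sum csp.fin_dim_image[OF h(1)] fin_dim_polys_le fin_dim_forms)
    also have "\<dots> \<le> cdim (h ` polys_le t) + cdim (h ` forms (Suc t))"
      by (intro dim_sum_le csp.fin_dim_image[OF h(1)] fin_dim_polys_le fin_dim_forms)
    finally show ?case using Suc by simp
  qed
  also have "\<dots> \<le> (\<Sum>s\<le>t. hilbert_fun I s)" by (rule sum_mono) (rule forms)
  finally show ?thesis
    using q[OF polys_le_subspace fin_dim_polys_le, of t] quot_dim_add[of P t] by (simp add: Int_commute)
qed

text \<open>If \<open>f \<in> Q\<close> has degree at most \<open>e\<close> and is not in the prime \<open>P\<close>, then multiplication by
  \<open>f\<close> embeds \<open>R/P\<close> into \<open>Q/P\<close> and raises the filtration by \<open>e\<close>.\<close>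

lemma quot_dim_step:
  assumes P: "primeideal P R4" and Q: "is_idl Q" "P \<subseteq> Q" and f: "f \<in> Q" "f \<notin> P" "f \<in> polys_le e"
  shows "quot_dim P t + quot_dim Q (t + e) \<le> quot_dim P (t + e)"
proof -
  have Pid: "is_idl P" and prime: "\<And>a b. a * b \<in> P \<Longrightarrow> a \<in> P \<or> b \<in> P"
    using P unfolding primeideal_R4_iff by blast+
  have sub: "cs.subspace (K \<inter> polys_le u)" if "is_idl K" for K u
    using cs.subspace_inter[OF is_idl_subspace[OF that] polys_le_subspace] .
  have "cdim (polys_le t) + cdim (P \<inter> polys_le (t + e)) \<le> cdim (Q \<inter> polys_le (t + e)) + cdim (P \<inter> polys_le t)"
  proof (rule csp.dim_quotient_mono[OF linear_cpoly_mult[of f]])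
    show "f * x \<in> Q \<inter> polys_le (t + e)" if "x \<in> polys_le t" for x
      using is_idlD(4)[OF Q(1) f(1)] polys_le_mult[OF f(3) that] by (simp add: add.commute)
    show "x \<in> P \<inter> polys_le t" if "x \<in> polys_le t" "f * x \<in> P \<inter> polys_le (t + e)" for x
      using that prime f(2) by blast
  qed (use sub Pid Q polys_le_subspace fin_dim_polys_le fin_dim_Int in auto)
  then show ?thesis
    using quot_dim_add[of P t] quot_dim_add[of P "t + e"] quot_dim_add[of Q "t + e"] by linarith
qed

text \<open>Each link of the chain raises the order of growth by one: the inequality for a link, summed over
  \<open>t = 0, F, 2 F, \<dots>\<close>, is Pascal's rule for the binomial coefficients on the left. Different links
  need polynomials \<open>f\<close> of different degrees, which are absorbed in the scale \<open>E\<close>.\<close>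

lemma quot_dim_chain:
  assumes "\<forall>i\<le>j. primeideal (c i) R4" "\<forall>i<j. c i \<subset> c (Suc i)"
  shows "\<exists>E\<ge>1. \<forall>s. (s + j) choose j \<le> quot_dim (c 0) (s * E)"
  using assms
proof (induction j arbitrary: c)
  case 0
  have P: "is_idl (c 0)" "c 0 \<noteq> UNIV" using 0 by (auto simp: primeideal_R4_iff)
  have "1 \<notin> c 0" using P is_idlD(3)[OF P(1), of 1] by auto
  have "quot_dim (c 0) t \<noteq> 0" for t
  proof
    assume "quot_dim (c 0) t = 0"
    then have "cdim (polys_le t) \<le> cdim (c 0 \<inter> polys_le t)" using quot_dim_add[of "c 0" t] by simp
    then have "c 0 \<inter> polys_le t = polys_le t"
      by (intro cs.dim_eq_imp_eq fin_dim_polys_le cs.subspace_inter is_idl_subspace P polys_le_subspace) auto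
    moreover have "1 \<in> polys_le t" by (simp add: polys_le_def)
    ultimately show False using \<open>1 \<notin> c 0\<close> by blast
  qed
  then show ?case by (intro exI[of _ 1]) (auto simp: Suc_le_eq)
next
  case (Suc j)
  have P: "primeideal (c i) R4" if "i \<le> Suc j" for i using Suc.prems(1) that by simp
  have "\<exists>E\<ge>1. \<forall>s. (s + j) choose j \<le> quot_dim (c (Suc 0)) (s * E)"
    using Suc.IH[of "\<lambda>i. c (Suc i)"] Suc.prems by simp
  then obtain E where E: "E \<ge> 1" "\<And>s. (s + j) choose j \<le> quot_dim (c (Suc 0)) (s * E)" by blast
  obtain f where f: "f \<in> c (Suc 0)" "f \<notin> c 0" using Suc.prems(2) by blast
  obtain e where e: "f \<in> polys_le e" using polys_le_exists by blast
  define F where "F = E * Suc e"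
  have F: "F \<ge> 1" "f \<in> polys_le F"
  proof -
    have "1 * Suc e \<le> F" unfolding F_def by (rule mult_le_mono1[OF E(1)])
    then show "F \<ge> 1" "f \<in> polys_le F" using e polys_le_mono[of e F] by auto
  qed
  have id: "is_idl (c (Suc 0))" using P[of "Suc 0"] by (auto simp: primeideal_R4_iff)
  have le: "c 0 \<subseteq> c (Suc 0)" using Suc.prems(2) by blast
  have Q: "(s + j) choose j \<le> quot_dim (c (Suc 0)) (s * F)" for s
  proof -
    have "(s + j) choose j \<le> (s * Suc e + j) choose j" by (rule binomial_right_mono) simp
    also have "\<dots> \<le> quot_dim (c (Suc 0)) (s * Suc e * E)" by (rule E(2))
    also have "s * Suc e * E = s * F" unfolding F_def by (simp only: mult_ac)
    finally show ?thesis .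
  qed
  have "(s + Suc j) choose (Suc j) \<le> quot_dim (c 0) (s * F)" for s
  proof (induction s)
    case 0
    have "1 \<le> quot_dim (c (Suc 0)) 0" using Q[of 0] by simp
    also have "\<dots> \<le> quot_dim (c 0) 0"
      using cs.dim_mono_fin[OF _ fin_dim_Int, of "c 0 \<inter> polys_le 0" "c (Suc 0)" 0] le
      unfolding quot_dim_def by (meson Int_mono diff_le_mono2 order_refl)
    finally show ?case by simp
  next
    case (Suc s)
    have "(Suc s + Suc j) choose (Suc j) = (s + Suc j choose Suc j) + (Suc s + j choose j)" by simp
    also have "\<dots> \<le> quot_dim (c 0) (s * F) + quot_dim (c (Suc 0)) (s * F + F)"
      using Suc Q[of "Suc s"] by (simp add: add.commute)
    also have "\<dots> \<le> quot_dim (c 0) (s * F + F)"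
      by (rule quot_dim_step[OF P id le f F(2)]) simp
    finally show ?case by (simp add: add.commute)
  qed
  then show ?case using F(1) by blast
qed

text \<open>A linear bound for the Hilbert function gives quadratic growth of \<^const>\<open>quot_dim\<close>, whereas a chain
  of length \<open>3\<close> enforces cubic growth.\<close>

lemma krull_le_2:
  assumes B: "\<And>t. hilbert_fun I t \<le> B * (t + 1)"
  shows "krull_dim_quot I \<le> 2"
  unfolding krull_dim_quot_def chain_dim_def
proof (rule Sup_least, clarify)
  fix n c assume c: "\<forall>i\<le>n. c i \<in> {\<pp>. primeideal \<pp> R4 \<and> I \<subseteq> \<pp>}" "\<forall>i<n. c i \<subset> c (Suc i)"
  show "ereal (real n) \<le> 2"
  proof (rule ccontr)
    assume "\<not> ereal (real n) \<le> 2"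
    then have n: "n \<ge> 3" by (cases "n \<ge> 3") (auto simp: not_le)
    have "\<forall>i\<le>3. primeideal (c i) R4" "\<forall>i<3. c i \<subset> c (Suc i)" using c n by auto
    from quot_dim_chain[OF this] obtain E where E: "E \<ge> 1" "\<And>s. (s + 3) choose 3 \<le> quot_dim (c 0) (s * E)" by blast
    have I: "is_idl (c 0)" "I \<subseteq> c 0" using c by (auto simp: primeideal_R4_iff)
    \<comment> \<open>Large enough for \<open>s\<^sup>3 / 6\<close> to exceed \<open>B (s (E + 1))\<^sup>2\<close>.\<close>
    define s where "s = 6 * B * (E + 1) ^ 2 + 1"
    have "(\<Sum>t\<le>s * E. hilbert_fun I t) \<le> (\<Sum>t\<le>s * E. B * (s * E + 1))"
      by (rule sum_mono) (use B in \<open>meson add_le_mono1 atMost_iff mult_le_mono2 order_trans\<close>)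
    also have "\<dots> = B * (s * E + 1) ^ 2" by (simp add: power2_eq_square algebra_simps)
    also have "\<dots> \<le> B * (s * (E + 1)) ^ 2"
      by (intro mult_le_mono2 power_mono) (simp_all add: s_def)
    finally have "(s + 3) choose 3 \<le> B * (s * (E + 1)) ^ 2"
      using E(2)[of s] quot_dim_le_hilbert[OF I, of "s * E"] by linarith
    then have "real ((s + 3) choose 3) \<le> real (B * (s * (E + 1)) ^ 2)" by (simp only: of_nat_le_iff)
    then have "(real s + 1) * (real s + 2) * (real s + 3) \<le> real (6 * B * (E + 1) ^ 2) * (real s * real s)"
      unfolding binomial_3_real by (simp add: power2_eq_square algebra_simps)
    also have "\<dots> \<le> real s * (real s * real s)" by (rule mult_right_mono) (simp_all add: s_def)
    finally have "(real s + 1) * (real s + 2) * (real s + 3) \<le> real s * (real s * real s)" .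
    moreover have "(real s + 1) * (real s + 2) * (real s + 3) =
        real s * (real s * real s) + 6 * (real s * real s) + 11 * real s + 6"
      by (simp add: algebra_simps)
    moreover have "0 \<le> real s * real s" "0 \<le> real s" by simp_all
    ultimately show False by linarith
  qed
qed

section \<open>General points\<close>

lemma det_nonzero_iff:
  fixes M :: "complex mat" assumes M: "M \<in> carrier_mat n n"
  shows "Determinant.det M \<noteq> 0 \<longleftrightarrow>
    (\<forall>c. (\<forall>j<n. (\<Sum>i<n. c i * M $$ (i, j)) = 0) \<longrightarrow> (\<forall>i<n. c i = 0))"
proof -
  let ?T = "transpose_mat M"
  have T: "?T \<in> carrier_mat n n" using M by simp
  have entry: "vec_index ((?T *\<^sub>v v)) j = (\<Sum>i<n. vec_index (v) i * M $$ (i, j))" if "v \<in> carrier_vec n" "j < n" for v j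
    using that M by (auto simp: scalar_prod_def lessThan_atLeast0 mult.commute intro!: sum.cong)
  have "Determinant.det M = 0 \<longleftrightarrow> (\<exists>v. v \<in> carrier_vec n \<and> v \<noteq> 0\<^sub>v n \<and> ?T *\<^sub>v v = 0\<^sub>v n)"
    using det_0_iff_vec_prod_zero[OF T] det_transpose[OF M] by simp
  also have "\<dots> \<longleftrightarrow> (\<exists>c. (\<forall>j<n. (\<Sum>i<n. c i * M $$ (i, j)) = 0) \<and> (\<exists>i<n. c i \<noteq> 0))"
  proof
    assume "\<exists>v. v \<in> carrier_vec n \<and> v \<noteq> 0\<^sub>v n \<and> ?T *\<^sub>v v = 0\<^sub>v n"
    then obtain v where v: "v \<in> carrier_vec n" "v \<noteq> 0\<^sub>v n" "?T *\<^sub>v v = 0\<^sub>v n" by blast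
    have "\<exists>i<n. vec_index (v) i \<noteq> 0"
    proof (rule ccontr)
      assume "\<not> (\<exists>i<n. vec_index (v) i \<noteq> 0)"
      then have "v = 0\<^sub>v n" using v(1) by (intro eq_vecI) auto
      then show False using v(2) by simp
    qed
    moreover have "\<forall>j<n. (\<Sum>i<n. vec_index (v) i * M $$ (i, j)) = 0"
      using entry[OF v(1)] v(3) by (metis index_zero_vec(1))
    ultimately show "\<exists>c. (\<forall>j<n. (\<Sum>i<n. c i * M $$ (i, j)) = 0) \<and> (\<exists>i<n. c i \<noteq> 0)"
      by (intro exI[of _ "\<lambda>i. vec_index (v) i"]) simp
  next
    assume "\<exists>c. (\<forall>j<n. (\<Sum>i<n. c i * M $$ (i, j)) = 0) \<and> (\<exists>i<n. c i \<noteq> 0)"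
    then obtain c where c: "\<forall>j<n. (\<Sum>i<n. c i * M $$ (i, j)) = 0" "\<exists>i<n. c i \<noteq> 0" by blast
    let ?v = "Matrix.vec n c"
    have v: "?v \<in> carrier_vec n" by simp
    have "?T *\<^sub>v ?v = 0\<^sub>v n"
    proof (rule eq_vecI)
      fix j assume "j < dim_vec (0\<^sub>v n :: complex Matrix.vec)"
      then have j: "j < n" by simp
      have "vec_index ((?T *\<^sub>v ?v)) j = (\<Sum>i<n. c i * M $$ (i, j))" using entry[OF v j] by simp
      then show "vec_index ((?T *\<^sub>v ?v)) j = vec_index (0\<^sub>v n) j" using c(1) j by simp
    qed (use M in simp)
    moreover have "?v \<noteq> 0\<^sub>v n"
    proof
      assume "?v = 0\<^sub>v n"
      then have "c i = 0" if "i < n" for i using that by (metis index_vec index_zero_vec(1))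
      then show False using c(2) by blast
    qed
    ultimately show "\<exists>v. v \<in> carrier_vec n \<and> v \<noteq> 0\<^sub>v n \<and> ?T *\<^sub>v v = 0\<^sub>v n" using v by blast
  qed
  finally show ?thesis by blast
qed

subsection \<open>Intersections of nonempty open sets\<close>

lemma eval_line: "\<exists>p. \<forall>t. eval (\<lambda>v. x v + t * h v) f = poly p t"
proof
  show "\<forall>t. eval (\<lambda>v. x v + t * h v) f = poly (substitute (\<lambda>c. [:c:]) (\<lambda>v. [:x v, h v:]) f) t"
    by (simp add: eval_eq_substitute substitute_def monom_val_def poly_sum poly_prod)
qed

lemma line_nonzero_cofinite:
  assumes "eval (\<lambda>v. x v + s * h v) f \<noteq> 0"
  shows "finite {t. eval (\<lambda>v. x v + t * h v) f = 0}"
proof -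
  obtain p where p: "\<And>t. eval (\<lambda>v. x v + t * h v) f = poly p t" using eval_line by blast
  then have "p \<noteq> 0" using assms by auto
  then show ?thesis unfolding p by (rule poly_roots_finite)
qed

abbreviation point_coords :: "(nat \<Rightarrow> complex ^ 4) \<Rightarrow> nat \<times> 4 \<Rightarrow> complex" where
  "point_coords P \<equiv> (\<lambda>(i, k). vec_nth (P i) k)"

text \<open>Restrict \<open>f\<close>, \<open>g\<close> and one nonzero coordinate of each point to the line joining the two
  configurations; each of these polynomials in one variable has finitely many zeros.\<close>

lemma common_nonvanishing:
  assumes f: "eval (point_coords P1) f \<noteq> 0" "\<forall>i<r. P1 i \<noteq> 0"
    and g: "eval (point_coords P2) g \<noteq> 0" "\<forall>i<r. P2 i \<noteq> 0"
  obtains P where "eval (point_coords P) f \<noteq> 0" "eval (point_coords P) g \<noteq> 0" "\<forall>i<r. P i \<noteq> 0"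
proof -
  define P where "P t i = P1 i + t *s (P2 i - P1 i)" for t i
  let ?x = "point_coords P1" and ?h = "\<lambda>v. point_coords P2 v - point_coords P1 v"
  have line: "point_coords (P t) = (\<lambda>v. ?x v + t * ?h v)" for t
    by (auto simp: P_def fun_eq_iff right_diff_distrib)
  have P01: "P 0 = P1" "P 1 = P2" by (auto simp: P_def fun_eq_iff)
  have "finite {t. eval (point_coords (P t)) f = 0}"
    unfolding line by (rule line_nonzero_cofinite[where s = 0]) (use f in simp)
  moreover have "finite {t. eval (point_coords (P t)) g = 0}"
    unfolding line by (rule line_nonzero_cofinite[where s = 1]) (simp only: line[symmetric] P01 g not_False_eq_True)
  moreover have "finite {t. P t i = 0}" if "i < r" for i
  proof -
    have "P1 i \<noteq> 0" using f(2) that by simp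
    then obtain k where k: "vec_nth (P1 i) k \<noteq> 0"
      unfolding Finite_Cartesian_Product.vec_eq_iff by auto
    have e: "eval (point_coords Q) (single (single (i, k) 1) 1) = vec_nth (Q i) k" for Q
      by (simp add: eval_single monom_val_single)
    have "finite {t. eval (point_coords (P t)) (single (single (i, k) 1) 1) = 0}"
      unfolding line by (rule line_nonzero_cofinite[where s = 0])
        (use k in \<open>simp add: eval_single monom_val_single\<close>)
    then have "finite {t. vec_nth (P t i) k = 0}" unfolding e .
    then show ?thesis by (rule finite_subset[rotated]) auto
  qed
  ultimately have fin: "finite ({t. eval (point_coords (P t)) f = 0} \<union> {t. eval (point_coords (P t)) g = 0}
      \<union> (\<Union>i<r. {t. P t i = 0}))" by simp
  obtain t where "t \<notin> {t. eval (point_coords (P t)) f = 0} \<union> {t. eval (point_coords (P t)) g = 0}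
      \<union> (\<Union>i<r. {t. P t i = 0})"
    by (rule exE[OF ex_new_if_finite[OF infinite_UNIV_char_0 fin]])
  then show thesis using that[of "P t"] by blast
qed

text \<open>Multihomogeneity with prescribed degrees \<open>e\<close>; additive in \<open>e\<close> under products, as needed for
  determinants.\<close>

definition multiforms :: "(nat \<Rightarrow> nat) \<Rightarrow> (nat \<times> 4) cpoly set" where
  "multiforms e = {f. \<forall>m\<in>keys f. \<forall>i. (\<Sum>k\<in>UNIV. lookup m (i, k)) = e i}"

lemma multihomogeneous_iff: "multihomogeneous r f \<longleftrightarrow> (\<exists>e. (\<forall>i\<ge>r. e i = 0) \<and> f \<in> multiforms e)"
  by (simp add: multihomogeneous_def multiforms_def)

lemma multiforms_0 [simp]: "0 \<in> multiforms e" by (simp add: multiforms_def)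

lemma multiforms_1: "1 \<in> multiforms 0" by (simp add: multiforms_def)

lemma multiforms_add: "f \<in> multiforms e \<Longrightarrow> g \<in> multiforms e \<Longrightarrow> f + g \<in> multiforms e"
  using keys_add[of f g] unfolding multiforms_def by blast

lemma multiforms_neg: "f \<in> multiforms e \<Longrightarrow> - f \<in> multiforms e"
  by (simp add: multiforms_def in_keys_iff)

lemma multiforms_mult:
  assumes "f \<in> multiforms e" "g \<in> multiforms e'" shows "f * g \<in> multiforms (e + e')"
  unfolding multiforms_def
proof (intro CollectI ballI allI)
  fix m i assume "m \<in> keys (f * g)"
  then obtain a b where "m = a + b" "a \<in> keys f" "b \<in> keys g" using keys_mult[of f g] by blast
  then show "(\<Sum>k\<in>UNIV. lookup m (i, k)) = (e + e') i"
    using assms by (simp add: multiforms_def lookup_add sum.distrib)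
qed

lemma multiforms_sum: "(\<And>i. i \<in> S \<Longrightarrow> f i \<in> multiforms e) \<Longrightarrow> sum f S \<in> multiforms e"
  by (induction S rule: infinite_finite_induct) (auto intro: multiforms_add)

lemma multihomogeneous_mult:
  "multihomogeneous r f \<Longrightarrow> multihomogeneous r g \<Longrightarrow> multihomogeneous r (f * g)"
  unfolding multihomogeneous_iff by (metis add.right_neutral multiforms_mult plus_fun_apply)

lemma for_general_pointsI:
  assumes f: "multihomogeneous r f" and P0: "\<forall>i<r. P0 i \<noteq> 0" "eval (point_coords P0) f \<noteq> 0"
    and \<Phi>: "\<And>P. \<forall>i<r. P i \<noteq> 0 \<Longrightarrow> eval (point_coords P) f \<noteq> 0 \<Longrightarrow> \<Phi> P"
  shows "for_general_points r \<Phi>"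
proof -
  let ?U = "{P. (\<forall>i<r. P i \<noteq> 0) \<and> (\<exists>g\<in>{f}. eval (point_coords P) g \<noteq> 0)}"
  have "zariski_open r ?U" unfolding zariski_open_def by (intro exI[of _ "{f}"]) (use f in simp)
  moreover have "P0 \<in> ?U" using P0 by simp
  moreover have "\<forall>P\<in>?U. \<Phi> P" using \<Phi> by blast
  ultimately show ?thesis unfolding for_general_points_def by blast
qed

lemma for_general_pointsE:
  assumes "for_general_points r \<Phi>"
  obtains f P0 where "multihomogeneous r f" "\<forall>i<r. P0 i \<noteq> 0" "eval (point_coords P0) f \<noteq> 0"
    "\<And>P. \<forall>i<r. P i \<noteq> 0 \<Longrightarrow> eval (point_coords P) f \<noteq> 0 \<Longrightarrow> \<Phi> P"
proof -
  obtain U where U: "zariski_open r U" "U \<noteq> {}" "\<forall>P\<in>U. \<Phi> P"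
    using assms unfolding for_general_points_def by blast
  obtain F where F: "\<forall>f\<in>F. multihomogeneous r f"
    "U = {P. (\<forall>i<r. P i \<noteq> 0) \<and> (\<exists>f\<in>F. eval (point_coords P) f \<noteq> 0)}"
    using U(1) unfolding zariski_open_def by blast
  obtain P0 where P0: "P0 \<in> U" using U(2) by blast
  then obtain f where f: "f \<in> F" "eval (point_coords P0) f \<noteq> 0" "\<forall>i<r. P0 i \<noteq> 0" unfolding F(2) by blast
  show thesis
  proof (rule that[of f P0])
    show "multihomogeneous r f" using F(1) f(1) by blast
    show "\<Phi> P" if "\<forall>i<r. P i \<noteq> 0" "eval (point_coords P) f \<noteq> 0" for P
    proof -
      have "P \<in> U" unfolding F(2) using that f(1) by blast
      then show ?thesis using U(3) by blast
    qed
  qed (use f in auto)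
qed

lemma for_general_points_conj:
  assumes "for_general_points r \<Phi>" "for_general_points r \<Psi>"
  shows "for_general_points r (\<lambda>P. \<Phi> P \<and> \<Psi> P)"
proof -
  obtain f P1 where f: "multihomogeneous r f" "\<forall>i<r. P1 i \<noteq> 0" "eval (point_coords P1) f \<noteq> 0"
    "\<And>P. \<forall>i<r. P i \<noteq> 0 \<Longrightarrow> eval (point_coords P) f \<noteq> 0 \<Longrightarrow> \<Phi> P"
    by (rule for_general_pointsE[OF assms(1)]) (rule that)
  obtain g P2 where g: "multihomogeneous r g" "\<forall>i<r. P2 i \<noteq> 0" "eval (point_coords P2) g \<noteq> 0"
    "\<And>P. \<forall>i<r. P i \<noteq> 0 \<Longrightarrow> eval (point_coords P) g \<noteq> 0 \<Longrightarrow> \<Psi> P"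
    by (rule for_general_pointsE[OF assms(2)]) (rule that)
  obtain P where P: "eval (point_coords P) f \<noteq> 0" "eval (point_coords P) g \<noteq> 0" "\<forall>i<r. P i \<noteq> 0"
    by (rule common_nonvanishing[OF f(3,2) g(3,2)])
  show ?thesis
    by (rule for_general_pointsI[OF multihomogeneous_mult[OF f(1) g(1)] P(3)])
       (use P f(4) g(4) in \<open>auto simp: eval.hom_mult\<close>)
qed

lemma for_general_points_mono:
  assumes "for_general_points r \<Phi>" "\<And>P. \<Phi> P \<Longrightarrow> \<Psi> P"
  shows "for_general_points r \<Psi>"
  using assms unfolding for_general_points_def by blast

lemma for_general_points_ball:
  assumes "finite S" "\<And>s. s \<in> S \<Longrightarrow> for_general_points r (\<Phi> s)"
  shows "for_general_points r (\<lambda>P. \<forall>s\<in>S. \<Phi> s P)"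
  using assms
proof (induction S)
  case empty
  show ?case
    by (rule for_general_pointsI[of r 1 "\<lambda>_. axis 1 1"])
       (auto simp: multihomogeneous_iff axis_eq_0_iff intro: exI[of _ 0] multiforms_1)
next
  case (insert x S)
  have "for_general_points r (\<lambda>P. \<Phi> x P \<and> (\<forall>s\<in>S. \<Phi> s P))"
    by (rule for_general_points_conj) (use insert in auto)
  then show ?case by (rule for_general_points_mono) auto
qed

lemma for_general_points_obtain:
  assumes "for_general_points r \<Phi>" obtains P where "\<Phi> P"
  using assms unfolding for_general_points_def by blast

subsection \<open>Determinantal conditions\<close>

definition point_monomial :: "nat \<Rightarrow> (4 \<Rightarrow>\<^sub>0 nat) \<Rightarrow> (nat \<times> 4) cpoly" where
  "point_monomial i m = monom_val (\<lambda>k. single (single (i, k) 1) 1) m"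

lemma eval_point_monomial: "eval (point_coords P) (point_monomial i m) = monom_val (vec_nth (P i)) m"
  unfolding point_monomial_def monom_val_def eval.hom_prod eval.hom_power
  by (simp add: eval_single monom_val_single)

lemma point_monomial_multiforms: "point_monomial i m \<in> multiforms (\<lambda>a. if a = i then mdeg m else 0)"
proof -
  let ?v = "\<lambda>k::4. single (single (i, k) (1::nat)) (1::complex)"
  have v: "?v k \<in> multiforms (\<lambda>a. if a = i then 1 else 0)" for k
    by (auto simp: multiforms_def lookup_single when_def)
  have pow: "?v k ^ n \<in> multiforms (\<lambda>a. if a = i then n else 0)" for k n
  proof (induction n)
    case 0
    then show ?case using multiforms_1 by (simp add: zero_fun_def)
  next
    case (Suc n)
    have "(\<lambda>a. if a = i then 1 else 0) + (\<lambda>a. if a = i then n else 0) = (\<lambda>a. if a = i then Suc n else 0)"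
      by (auto simp: fun_eq_iff)
    then show ?case using multiforms_mult[OF v[of k] Suc] by simp
  qed
  have "(\<Prod>k\<in>S. ?v k ^ a k) \<in> multiforms (\<lambda>b. if b = i then sum a S else 0)" if "finite S" for S :: "4 set" and a
    using that
  proof (induction S)
    case empty
    have "(\<lambda>b. if b = i then sum a {} else 0) = (0 :: nat \<Rightarrow> nat)" by (auto simp: fun_eq_iff)
    then show ?case using multiforms_1 by simp
  next
    case (insert k S)
    have "(\<lambda>b. if b = i then a k else 0) + (\<lambda>b. if b = i then sum a S else 0)
        = (\<lambda>b. if b = i then sum a (insert k S) else 0)"
      using insert by (auto simp: fun_eq_iff)
    then show ?case using multiforms_mult[OF pow[of k "a k"] insert.IH] insert.hyps by simp
  qed
  from this[of UNIV "lookup m"]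
  have "(\<Prod>k\<in>UNIV. ?v k ^ lookup m k) \<in> multiforms (\<lambda>b. if b = i then mdeg m else 0)"
    unfolding mdeg_def by simp
  moreover have "monom_val ?v m = (\<Prod>k\<in>UNIV. ?v k ^ lookup m k)" by (rule monom_val_superset) auto
  ultimately show ?thesis unfolding point_monomial_def by simp
qed

text \<open>The determinant is a multihomogeneous polynomial in the coordinates of the points, so a single
  configuration at which it does not vanish suffices.\<close>

lemma for_general_points_det:
  fixes P0 :: "nat \<Rightarrow> complex ^ 4"
  assumes idx: "\<And>i. i < s \<Longrightarrow> idx i < r" and M: "\<And>j. j < s \<Longrightarrow> mdeg (M j) = D"
    and P0: "\<forall>i<r. P0 i \<noteq> 0"
      "Determinant.det (mat s s (\<lambda>(i, j). monom_val (vec_nth (P0 (idx i))) (M j))) \<noteq> 0"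
  shows "for_general_points r (\<lambda>P.
    Determinant.det (mat s s (\<lambda>(i, j). monom_val (vec_nth (P (idx i))) (M j))) \<noteq> 0)"
proof -
  define B where "B = mat s s (\<lambda>(i, j). point_monomial (idx i) (M j))"
  have B: "B \<in> carrier_mat s s" by (simp add: B_def)
  have ev: "eval (point_coords P) (Determinant.det B) =
      Determinant.det (mat s s (\<lambda>(i, j). monom_val (vec_nth (P (idx i))) (M j)))" for P
  proof -
    have "map_mat (eval (point_coords P)) B = mat s s (\<lambda>(i, j). monom_val (vec_nth (P (idx i))) (M j))"
      by (rule eq_matI) (auto simp: B_def eval_point_monomial)
    then show ?thesis using eval.hom_det[of "point_coords P" B] by simp
  qed
  let ?e = "\<lambda>i a. if a = idx i then D else 0"
  have "Determinant.det B \<in> multiforms (\<Sum>i<s. ?e i)"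
  proof (rule det_graded[where G = multiforms, OF multiforms_0 multiforms_1 multiforms_neg multiforms_add multiforms_mult B])
    show "B $$ (i, j) \<in> multiforms (?e i)" if "i < s" "j < s" for i j
      using point_monomial_multiforms[of "idx i" "M j"] that unfolding M[OF that(2)] by (simp add: B_def)
  qed
  moreover have "\<forall>a\<ge>r. (\<Sum>i<s. ?e i) a = 0"
  proof (intro allI impI)
    fix a assume a: "a \<ge> r"
    have "(\<Sum>i<s. ?e i) a = (\<Sum>i<s. ?e i a)" by (induction s) simp_all
    also have "\<dots> = 0" using idx a by (intro sum.neutral) fastforce
    finally show "(\<Sum>i<s. ?e i) a = 0" .
  qed
  ultimately have "multihomogeneous r (Determinant.det B)" unfolding multihomogeneous_iff by blast
  then show ?thesis by (rule for_general_pointsI[OF _ P0(1)]) (use P0(2) in \<open>simp_all add: ev\<close>)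
qed

text \<open>Two nonempty open sets meet, so the general value is unique if it exists.\<close>

lemma general_valueI:
  assumes f: "f \<in> forms n" and Q0: "Q0 \<noteq> 0" "eval (vec_nth Q0) f \<noteq> 0"
    and \<nu>: "\<And>Q. eval (vec_nth Q) f \<noteq> 0 \<Longrightarrow> \<nu> Q = c"
  shows "general_value \<nu> = c"
proof -
  define g where "g = (\<Sum>m\<in>keys f. single 0 (lookup f m) * point_monomial 0 m)"
  have ev: "eval (point_coords P) g = eval (vec_nth (P 0)) f" for P
    unfolding g_def eval.hom_sum eval.hom_mult eval_point_monomial
    by (simp add: eval_single eval_eq_substitute[of "vec_nth (P 0)"] substitute_def)
  have "g \<in> multiforms (\<lambda>a. if a = 0 then n else 0)"
    unfolding g_def
  proof (rule multiforms_sum)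
    fix m assume "m \<in> keys f"
    then have m: "mdeg m = n" using f by (simp add: forms_def)
    have "single 0 (lookup f m) \<in> multiforms 0" by (simp add: multiforms_def)
    from multiforms_mult[OF this point_monomial_multiforms[of 0 m]]
    show "single 0 (lookup f m) * point_monomial 0 m \<in> multiforms (\<lambda>a. if a = 0 then n else 0)"
      unfolding m add_0 .
  qed
  then have mh: "multihomogeneous 1 g"
    unfolding multihomogeneous_iff by (intro exI[of _ "\<lambda>a. if a = 0 then n else 0"]) auto
  have gen: "for_general_points 1 (\<lambda>Q. \<nu> (Q 0) = c)"
    by (rule for_general_pointsI[OF mh, of "\<lambda>_. Q0"]) (use Q0 \<nu> in \<open>auto simp: ev\<close>)
  show ?thesis
    unfolding general_value_def
  proof (rule the_equality)
    show "for_general_points 1 (\<lambda>Q. \<nu> (Q 0) = c)" by (rule gen)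
    fix c' assume "for_general_points 1 (\<lambda>Q. \<nu> (Q 0) = c')"
    from for_general_points_conj[OF this gen]
    obtain Q where "\<nu> (Q 0) = c' \<and> \<nu> (Q 0) = c" by (rule for_general_points_obtain)
    then show "c' = c" by simp
  qed
qed

section \<open>The interpolation matrix\<close>

subsection \<open>Coefficients of powers of linear forms\<close>

text \<open>The multi-index factorial \<open>m!\<close>.\<close>

definition mfact :: "(4 \<Rightarrow>\<^sub>0 nat) \<Rightarrow> complex" where
  "mfact m = (\<Prod>k\<in>UNIV. fact (lookup m k))"

lemma mfact_nonzero [simp]: "mfact m \<noteq> 0"
  by (simp add: mfact_def)

lemma lookup_mult_single_other:
  assumes "\<And>b. m \<noteq> a + b" shows "lookup (single a c * f) m = 0"
proof (rule ccontr)
  assume "lookup (single a c * f) m \<noteq> 0"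
  then have "m \<in> keys (single a c * f)" by (simp add: in_keys_iff)
  then show False using keys_mult[of "single a c" f] assms by (auto split: if_splits)
qed

lemma monomial_diff_add:
  fixes m :: "'v \<Rightarrow>\<^sub>0 nat"
  assumes "\<And>k. lookup a k \<le> lookup m k" shows "m = a + (m - a)"
  by (rule poly_mapping_eqI) (use assms in \<open>simp add: lookup_add lookup_minus\<close>)

lemma mfact_add_single: "mfact (single k 1 + m) = of_nat (Suc (lookup m k)) * mfact m"
proof -
  have split: "(\<Prod>j\<in>UNIV. f j) = f k * (\<Prod>j\<in>UNIV - {k}. f j)" for f :: "4 \<Rightarrow> complex"
    by (rule prod.remove) auto
  have "(\<Prod>j\<in>UNIV - {k}. fact (lookup (single k 1 + m) j)) = (\<Prod>j\<in>UNIV - {k}. (fact (lookup m j) :: complex))"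
    by (rule prod.cong) (auto simp: lookup_add lookup_single when_def)
  then show ?thesis
    unfolding mfact_def split[of "\<lambda>j. fact (lookup (single k 1 + m) j)"] split[of "\<lambda>j. fact (lookup m j)"]
    by (simp add: lookup_add)
qed

text \<open>The multinomial theorem, with the coefficient \<open>d! / m!\<close> cleared of its denominator.\<close>

lemma lookup_dual_form_power:
  assumes "mdeg m = d"
  shows "mfact m * lookup (dual_form v ^ d) m = fact d * monom_val (vec_nth v) m"
  using assms
proof (induction d arbitrary: m)
  case 0
  then have "m = 0" by (intro poly_mapping_eqI) (simp add: mdeg_def)
  then show ?case by (simp add: mfact_def)
next
  case (Suc d)
  have part: "mfact m * (vec_nth v k * lookup (coord k * dual_form v ^ d) m)
      = of_nat (lookup m k) * (fact d * monom_val (vec_nth v) m)" for k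
  proof (cases "lookup m k = 0")
    case True
    have "m \<noteq> single k 1 + b" for b using True by (metis add_eq_0_iff_both_eq_0 lookup_add lookup_single_eq zero_neq_one)
    then have "lookup (coord k * dual_form v ^ d) m = 0" by (rule lookup_mult_single_other)
    then show ?thesis using True by simp
  next
    case False
    define a where "a = m - single k 1"
    have m: "m = single k 1 + a"
      unfolding a_def by (rule monomial_diff_add) (use False in \<open>auto simp: lookup_single when_def\<close>)
    have "mdeg a = d" using Suc.prems unfolding m mdeg_add by simp
    then have IH: "mfact a * lookup (dual_form v ^ d) a = fact d * monom_val (vec_nth v) a" by (rule Suc.IH)
    have l: "lookup (coord k * dual_form v ^ d) m = lookup (dual_form v ^ d) a"
      unfolding m lookup_mult_monomial by simp
    have "mfact m * (vec_nth v k * lookup (coord k * dual_form v ^ d) m)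
        = of_nat (Suc (lookup a k)) * vec_nth v k * (mfact a * lookup (dual_form v ^ d) a)"
      unfolding l by (simp only: m mfact_add_single mult_ac)
    also have "\<dots> = of_nat (lookup m k) * (fact d * monom_val (vec_nth v) m)"
      unfolding IH by (simp add: m lookup_add monom_val_add monom_val_single mult_ac)
    finally show ?thesis .
  qed
  have "dual_form v ^ Suc d = (\<Sum>k\<in>UNIV. cscale (vec_nth v k) (coord k * dual_form v ^ d))"
    by (subst (1) power_Suc, subst (1) dual_form_eq) (simp add: sum_distrib_right cscale_mult_left)
  then have "mfact m * lookup (dual_form v ^ Suc d) m
      = (\<Sum>k\<in>UNIV. mfact m * (vec_nth v k * lookup (coord k * dual_form v ^ d) m))"
    by (simp add: lookup_sum sum_distrib_left)
  also have "\<dots> = of_nat (mdeg m) * (fact d * monom_val (vec_nth v) m)"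
    unfolding part mdeg_def by (simp add: sum_distrib_right)
  finally show ?case using Suc.prems by (simp add: mult_ac)
qed

subsection \<open>Iterated derivatives of monomials\<close>

definition falling_fact :: "nat \<Rightarrow> nat \<Rightarrow> nat" where
  "falling_fact x a = (\<Prod>i<a. x - i)"

lemma falling_fact_eq_0: "a > x \<Longrightarrow> falling_fact x a = 0"
  unfolding falling_fact_def by (rule prod_zero) auto

lemma falling_fact_self: "falling_fact x x = fact x"
proof -
  have "falling_fact x x = (\<Prod>i<x. Suc i)"
    unfolding falling_fact_def by (rule prod.reindex_bij_witness[of _ "\<lambda>i. x - Suc i" "\<lambda>i. x - Suc i"]) auto
  then show ?thesis by (simp add: fact_prod_Suc lessThan_atLeast0)
qed

lemma falling_fact_pred: "falling_fact (Suc x) x = fact (Suc x)"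
proof -
  have "falling_fact (Suc x) (Suc x) = falling_fact (Suc x) x * 1" by (simp add: falling_fact_def)
  then show ?thesis using falling_fact_self[of "Suc x"] by simp
qed

lemma partial_deriv_single:
  "partial_deriv k (single m c) = single (m - single k 1) (of_nat (lookup m k) * c)"
  by (cases "c = 0") (simp_all add: partial_deriv_def)

lemma partial_deriv_pow:
  "(partial_deriv k ^^ a) (single m c) = single (m - single k a) (of_nat (falling_fact (lookup m k) a) * c)"
proof (induction a)
  case (Suc a)
  have "m - single k a - single k 1 = m - single k (Suc a)"
    by (rule poly_mapping_eqI) (simp add: lookup_minus lookup_single when_def)
  moreover have "lookup (m - single k a) k = lookup m k - a" by (simp add: lookup_minus)
  ultimately show ?case
    by (simp add: Suc partial_deriv_single falling_fact_def mult_ac)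
qed (simp add: falling_fact_def)

lemma zero_eq_four: "(0 :: 4) = 4" by simp

lemma iter_deriv_monomial:
  "iter_deriv a (single m 1) = single (m - a) (of_nat (\<Prod>k\<in>UNIV. falling_fact (lookup m k) (lookup a k)))"
proof -
  have m: "m - single 3 (lookup a 3) - single 2 (lookup a 2) - single 1 (lookup a 1) - single 4 (lookup a 4) = m - a"
  proof (rule poly_mapping_eqI)
    fix k :: 4
    show "lookup (m - single 3 (lookup a 3) - single 2 (lookup a 2) - single 1 (lookup a 1) - single 4 (lookup a 4)) k
        = lookup (m - a) k"
      using exhaust_4[of k] by (auto simp: lookup_minus lookup_single when_def)
  qed
  have p: "(\<Prod>k\<in>UNIV. f k) = f 1 * f 2 * f 3 * f 4" for f :: "4 \<Rightarrow> nat"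
    unfolding UNIV_4 by (simp add: mult_ac)
  show ?thesis
    unfolding iter_deriv_def zero_eq_four partial_deriv_pow m p
    by (simp add: lookup_minus lookup_single when_def mult_ac)
qed

text \<open>The derivative of a monomial \<open>m\<close> of degree \<open>d + 1\<close> by a monomial \<open>a\<close> of degree \<open>d\<close> is zero unless
  \<open>m = a x\<^sub>k\<close> for some \<open>k\<close>, and then it is \<open>m! x\<^sub>k\<close>. This is the dual of multiplication by \<open>L\<^sub>Q\<close>.\<close>

lemma eval_iter_deriv:
  assumes a: "mdeg a = d" and m: "mdeg m = Suc d"
  shows "eval (vec_nth Q) (iter_deriv a (single m 1)) = mfact m * lookup (single a 1 * dual_form Q) m"
    and "iter_deriv a (single m 1) \<in> forms 1"
proof -
  let ?goal = "eval (vec_nth Q) (iter_deriv a (single m 1)) = mfact m * lookup (single a 1 * dual_form Q) m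
    \<and> iter_deriv a (single m 1) \<in> forms 1"
  have ?goal
  proof (cases "\<forall>k. lookup a k \<le> lookup m k")
    case True
    then have ma: "m = a + (m - a)" by (intro monomial_diff_add) blast
    then have "mdeg (m - a) = Suc 0" using a m by (metis Suc_eq_plus1 add_left_cancel mdeg_add One_nat_def)
    then obtain k b where kb: "m - a = single k 1 + b" "mdeg b = 0" by (rule monomial_pred)
    then have "b = 0" by (intro poly_mapping_eqI) (simp add: mdeg_def)
    then have e: "m - a = single k 1" using kb by simp
    then have mk: "m = a + single k 1" using ma by simp
    have "falling_fact (lookup m j) (lookup a j) = fact (lookup m j)" for j
      unfolding mk by (cases "j = k") (simp_all add: lookup_add lookup_single when_def falling_fact_self falling_fact_pred)
    then have "of_nat (\<Prod>k\<in>UNIV. falling_fact (lookup m k) (lookup a k)) = mfact m" by (simp add: mfact_def)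
    then have d: "iter_deriv a (single m 1) = single (single k 1) (mfact m)"
      unfolding iter_deriv_monomial e by simp
    have "lookup (single a 1 * dual_form Q) m = lookup (dual_form Q) (single k 1)"
      unfolding mk lookup_mult_monomial by simp
    also have "\<dots> = vec_nth Q k"
    proof -
      have "single k 1 = single j (1::nat) \<longleftrightarrow> k = j" for j :: 4
        by (metis lookup_single_eq lookup_single_not_eq zero_neq_one)
      then show ?thesis by (simp add: lookup_dual_form)
    qed
    finally have "lookup (single a 1 * dual_form Q) m = vec_nth Q k" .
    then show ?thesis unfolding d using forms_single[of "single k 1" "mfact m"] by (simp add: eval_single monom_val_single)
  next
    case False
    then obtain k where k: "lookup m k < lookup a k" by (auto simp: not_le)
    then have z: "(\<Prod>k\<in>UNIV. falling_fact (lookup m k) (lookup a k)) = 0"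
      by (intro prod_zero) (auto intro: falling_fact_eq_0 exI[of _ k])
    have "iter_deriv a (single m 1) = 0" unfolding iter_deriv_monomial z by simp
    moreover have "m \<noteq> a + b" for b using k by (metis lookup_add le_add1 not_le)
    then have "lookup (single a 1 * dual_form Q) m = 0" by (rule lookup_mult_single_other)
    ultimately show ?thesis by simp
  qed
  then show "eval (vec_nth Q) (iter_deriv a (single m 1)) = mfact m * lookup (single a 1 * dual_form Q) m"
    "iter_deriv a (single m 1) \<in> forms 1" by auto
qed

subsection \<open>Evaluating maximal minors\<close>

text \<open>A maximal minor is nonzero at a point if and only if the rows without one entry are independent.
  In this form the rows can be treated as polynomials.\<close>

lemma eval_sminor_nonzero_iff:
  assumes j: "j \<le> m"
  shows "eval x (sminor m A j) \<noteq> 0 \<longleftrightarrow>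
    (\<forall>c. (\<forall>k\<le>m. k \<noteq> j \<longrightarrow> (\<Sum>i<m. c i * eval x (A i k)) = 0) \<longrightarrow> (\<forall>i<m. c i = 0))"
proof -
  let ?M = "mat_delete (bordered m A (\<lambda>_. 0)) m j"
  let ?N = "map_mat (eval x) ?M"
  have N: "?N \<in> carrier_mat m m" by (rule carrier_matI) (auto simp: bordered_def)
  have entry: "?N $$ (i, k) = eval x (A i (insert_index j k))" if "i < m" "k < m" for i k
    using that by (auto simp: mat_delete_def bordered_def insert_index_def)
  have "eval x (sminor m A j) = (-1) ^ (m + j) * Determinant.det ?N"
    unfolding sminor_def cofactor_def
    by (simp add: eval.hom_mult eval.hom_power eval.hom_uminus eval.hom_det)
  then have "eval x (sminor m A j) \<noteq> 0 \<longleftrightarrow> Determinant.det ?N \<noteq> 0" by simp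
  also have "\<dots> \<longleftrightarrow> (\<forall>c. (\<forall>k<m. (\<Sum>i<m. c i * ?N $$ (i, k)) = 0) \<longrightarrow> (\<forall>i<m. c i = 0))"
    by (rule det_nonzero_iff[OF N])
  also have "\<dots> \<longleftrightarrow> (\<forall>c. (\<forall>k\<le>m. k \<noteq> j \<longrightarrow> (\<Sum>i<m. c i * eval x (A i k)) = 0) \<longrightarrow> (\<forall>i<m. c i = 0))"
  proof -
    have "(\<forall>k<m. (\<Sum>i<m. c i * ?N $$ (i, k)) = 0) \<longleftrightarrow>
        (\<forall>k\<le>m. k \<noteq> j \<longrightarrow> (\<Sum>i<m. c i * eval x (A i k)) = 0)" for c
    proof -
      have "(\<Sum>i<m. c i * ?N $$ (i, k)) = (\<Sum>i<m. c i * eval x (A i (insert_index j k)))" if "k < m" for k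
        using that entry by (intro sum.cong) simp_all
      then have "(\<forall>k<m. (\<Sum>i<m. c i * ?N $$ (i, k)) = 0) \<longleftrightarrow>
          (\<forall>k<m. (\<Sum>i<m. c i * eval x (A i (insert_index j k))) = 0)" by simp
      also have "\<dots> \<longleftrightarrow> (\<forall>k\<in>insert_index j ` {..<m}. (\<Sum>i<m. c i * eval x (A i k)) = 0)" by auto
      also have "insert_index j ` {..<m} = {k. k \<le> m \<and> k \<noteq> j}"
      proof (intro subset_antisym subsetI)
        fix k assume "k \<in> {k. k \<le> m \<and> k \<noteq> j}"
        then have k: "k \<le> m" "k \<noteq> j" by auto
        show "k \<in> insert_index j ` {..<m}"
        proof (cases "k < j")
          case True
          then show ?thesis using j by (intro image_eqI[of _ _ k]) (auto simp: insert_index_def)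
        next
          case False
          then show ?thesis using k by (intro image_eqI[of _ _ "k - 1"]) (auto simp: insert_index_def)
        qed
      qed (use j in \<open>auto simp: insert_index_def split: if_splits\<close>)
      finally show ?thesis by blast
    qed
    then show ?thesis by simp
  qed
  finally show ?thesis .
qed

section \<open>The Weddle scheme as a locus of maximal minors\<close>

subsection \<open>Submatrices and ranks\<close>

lemma (in vec_space) rank_le_rows:
  assumes "A \<in> carrier_mat n nc" shows "rank A \<le> n"
proof -
  obtain S where S: "maximal S (\<lambda>T. T \<subseteq> set (cols A) \<and> lin_indpt T)"
    using maximal_exists[of "(\<lambda>T. T \<subseteq> set (cols A) \<and> lin_indpt T)" "card (set (cols A))" "{}"]
    by (meson List.finite_set card_mono empty_iff empty_subsetI finite_lin_indpt2 rev_finite_subset)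
  then have "S \<subseteq> set (cols A)" "lin_indpt S" by (auto simp: maximal_def)
  moreover have "set (cols A) \<subseteq> carrier_vec n" using cols_dim assms by blast
  ultimately have "card S \<le> dim" using li_le_dim(2)[OF fin_dim] by auto
  then show ?thesis using rank_card_indpt[OF assms S] dim_is_n by simp
qed

lemma card_less_omit:
  assumes "j \<le> m" "k < m"
  shows "card {a \<in> {..<Suc m} - {j}. a < insert_index j k} = k"
proof (cases "k < j")
  case True
  then have "{a \<in> {..<Suc m} - {j}. a < insert_index j k} = {..<k}" using assms by auto
  then show ?thesis by simp
next
  case False
  then have "{a \<in> {..<Suc m} - {j}. a < insert_index j k} = {..<Suc k} - {j}" using assms by auto
  then show ?thesis using False by simp
qed

lemma submatrix_eq_mat_delete:
  assumes L: "L \<in> carrier_mat m (Suc m)" and j: "j \<le> m"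
  shows "submatrix L {..<m} ({..<Suc m} - {j}) = mat_delete (bordered m (\<lambda>i k. L $$ (i, k)) (\<lambda>_. 0)) m j"
    (is "?S = ?D")
proof (rule eq_matI)
  have rows: "{i. i < dim_row L \<and> i \<in> {..<m}} = {..<m}" using L by auto
  have cols: "{k. k < dim_col L \<and> k \<in> {..<Suc m} - {j}} = {..<Suc m} - {j}" using L by auto
  have cc: "card ({..<Suc m} - {j}) = m" using j by simp
  have D: "dim_row ?D = m" "dim_col ?D = m" by (simp_all add: bordered_def)
  show "dim_row ?S = dim_row ?D" "dim_col ?S = dim_col ?D"
    unfolding dim_submatrix rows cols D cc by simp_all
  fix i k assume "i < dim_row ?D" "k < dim_col ?D"
  then have ik: "i < m" "k < m" unfolding D .
  have "pick {..<m} (card {a \<in> {..<m}. a < i}) = i" by (rule pick_card_in_set) (use ik in simp)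
  moreover have "{a \<in> {..<m}. a < i} = {..<i}" using ik by auto
  ultimately have pi: "pick {..<m} i = i" by simp
  have "pick ({..<Suc m} - {j}) (card {a \<in> {..<Suc m} - {j}. a < insert_index j k}) = insert_index j k"
    by (rule pick_card_in_set) (use ik in \<open>auto simp: insert_index_def\<close>)
  then have pk: "pick ({..<Suc m} - {j}) k = insert_index j k" unfolding card_less_omit[OF j ik(2)] .
  have "?S $$ (i, k) = L $$ (pick {..<m} i, pick ({..<Suc m} - {j}) k)"
    by (rule submatrix_index) (unfold rows cols cc, use ik in simp_all)
  then show "?S $$ (i, k) = ?D $$ (i, k)"
    unfolding pi pk using ik j by (auto simp: mat_delete_def bordered_def insert_index_def)
qed

lemma det_submatrix_sminor:
  assumes "L \<in> carrier_mat m (Suc m)" "j \<le> m"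
  shows "Determinant.det (submatrix L {..<m} ({..<Suc m} - {j})) = (-1) ^ (m + j) * sminor m (\<lambda>i k. L $$ (i, k)) j"
proof -
  have "(-1) ^ (m + j) * ((-1) ^ (m + j) * x) = x" for x :: mpoly4
    by (simp add: mult.assoc[symmetric] power_add[symmetric])
  then show ?thesis unfolding submatrix_eq_mat_delete[OF assms] sminor_def cofactor_def by simp
qed

text \<open>For minors of size \<open>m\<close> there is only one choice of rows, and a choice of columns omits one of them.\<close>

lemma minors_ideal_eq:
  assumes L: "L \<in> carrier_mat m (Suc m)"
  shows "minors_ideal m L = minor_ideal m (\<lambda>i k. L $$ (i, k))"
  unfolding minors_ideal_def
proof (rule genideal_eqI)
  let ?A = "\<lambda>i k. L $$ (i, k)"
  let ?S = "{Determinant.det (submatrix L I J) | I J.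
     I \<subseteq> {..<dim_row L} \<and> J \<subseteq> {..<dim_col L} \<and> card I = m \<and> card J = m}"
  show id: "is_idl (minor_ideal m ?A)" by (rule adjoin_is_idl[OF is_idl_zero])
  show "?S \<subseteq> minor_ideal m ?A"
  proof
    fix x assume "x \<in> ?S"
    then obtain I J where IJ: "x = Determinant.det (submatrix L I J)" "I \<subseteq> {..<m}" "J \<subseteq> {..<Suc m}"
      "card I = m" "card J = m" using L by auto
    have I: "I = {..<m}" using IJ card_subset_eq[of "{..<m}" I] by simp
    have "card ({..<Suc m} - J) = 1" using IJ by (simp add: card_Diff_subset finite_subset[OF IJ(3)])
    then obtain j where j: "{..<Suc m} - J = {j}" by (rule card_1_singletonE)
    then have J: "J = {..<Suc m} - {j}" "j \<le> m" using IJ(3) by auto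
    have "sminor m ?A j \<in> minor_ideal m ?A" using adjoin_gen[OF is_idl_zero, of j "Suc m"] J(2) by simp
    then show "x \<in> minor_ideal m ?A"
      unfolding IJ(1) I J(1) det_submatrix_sminor[OF L J(2)] by (rule is_idlD(3)[OF id])
  qed
  show "minor_ideal m ?A \<subseteq> K" if K: "is_idl K" "?S \<subseteq> K" for K
  proof (rule adjoin_least[OF K(1)])
    show "{0} \<subseteq> K" using is_idlD(1)[OF K(1)] by simp
    fix j assume "j < Suc m"
    then have j: "j \<le> m" by simp
    have "Determinant.det (submatrix L {..<m} ({..<Suc m} - {j})) \<in> ?S"
      using L j by (intro CollectI exI[of _ "{..<m}"] exI[of _ "{..<Suc m} - {j}"]) auto
    then have "(-1) ^ (m + j) * sminor m ?A j \<in> K" using K(2) det_submatrix_sminor[OF L j] by auto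
    then have "(-1) ^ (m + j) * ((-1) ^ (m + j) * sminor m ?A j) \<in> K" by (rule is_idlD(3)[OF K(1)])
    then show "sminor m ?A j \<in> K" by (simp add: mult.assoc[symmetric] power_add[symmetric])
  qed
qed

lemma rank_of_minor:
  assumes L: "L \<in> carrier_mat m (Suc m)" and j: "j \<le> m"
    and nz: "eval x (sminor m (\<lambda>i k. L $$ (i, k)) j) \<noteq> 0"
  shows "vec_space.rank m (map_mat (eval x) L) = m"
proof (rule order_antisym)
  let ?N = "map_mat (eval x) L"
  have N: "?N \<in> carrier_mat m (Suc m)" using L by simp
  show "vec_space.rank m ?N \<le> m" by (rule vec_space.rank_le_rows[OF N])
  have "submatrix ?N {..<m} ({..<Suc m} - {j}) = map_mat (eval x) (submatrix L {..<m} ({..<Suc m} - {j}))"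
  proof (rule eq_matI)
    fix i k assume "i < dim_row (map_mat (eval x) (submatrix L {..<m} ({..<Suc m} - {j})))"
      "k < dim_col (map_mat (eval x) (submatrix L {..<m} ({..<Suc m} - {j})))"
    then have ik: "i < card {i. i < dim_row L \<and> i \<in> {..<m}}" "k < card {k. k < dim_col L \<and> k \<in> {..<Suc m} - {j}}"
      by (simp_all add: dim_submatrix)
    have "pick {..<m} i < dim_row L" "pick ({..<Suc m} - {j}) k < dim_col L"
      using pick_le[OF ik(1)] pick_le[OF ik(2)] by auto
    then show "submatrix ?N {..<m} ({..<Suc m} - {j}) $$ (i, k)
        = map_mat (eval x) (submatrix L {..<m} ({..<Suc m} - {j})) $$ (i, k)"
      using ik by (simp add: submatrix_def)
  qed (simp_all add: dim_submatrix)
  then have "Determinant.det (submatrix ?N {..<m} ({..<Suc m} - {j}))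
      = eval x (Determinant.det (submatrix L {..<m} ({..<Suc m} - {j})))"
    by (simp add: eval.hom_det)
  also have "\<dots> = (-1) ^ (m + j) * eval x (sminor m (\<lambda>i k. L $$ (i, k)) j)"
    unfolding det_submatrix_sminor[OF L j] by (simp add: eval.hom_mult eval.hom_power eval.hom_uminus)
  finally have "Determinant.det (submatrix ?N {..<m} ({..<Suc m} - {j})) \<noteq> 0" using nz by simp
  from vec_space.rank_gt_minor[OF N this]
  have "card {k. k < Suc m \<and> k \<in> {..<Suc m} - {j}} \<le> vec_space.rank m ?N" .
  moreover have "{k. k < Suc m \<and> k \<in> {..<Suc m} - {j}} = {..<Suc m} - {j}" by auto
  ultimately show "m \<le> vec_space.rank m ?N" using j by simp
qed

subsection \<open>Points in sufficiently general position\<close>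

lemma monomials_list: "set (monomials t) = {m. mdeg m = t}" "distinct (monomials t)"
  "length (monomials t) = (t + 3) choose 3"
  unfolding monomials_def using card_mdeg_eq by simp_all

text \<open>The index \<open>4\<close> is that of \<open>x\<^sub>0\<close>. The monomials \<open>ms j\<close> are pairwise different, as the determinant is
  nonzero, so that together with \<open>m0\<close> they are all monomials of degree \<open>d\<close> in \<open>x\<^sub>1, x\<^sub>2, x\<^sub>3\<close>. The
  determinantal condition says that a unique cone of degree \<open>d\<close> with vertex \<open>[1:0:0:0]\<close> contains
  the points and that \<open>m0\<close> occurs in its equation.\<close>

locale weddle =
  fixes d r :: nat and P :: "nat \<Rightarrow> complex ^ 4" and ms :: "nat \<Rightarrow> 4 \<Rightarrow>\<^sub>0 nat" and m0 :: "4 \<Rightarrow>\<^sub>0 nat"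
  assumes d: "d \<ge> 2" and r: "r + 1 = (d + 2) choose 2"
    and ms: "\<And>j. j < r \<Longrightarrow> mdeg (ms j) = d \<and> lookup (ms j) 4 = 0 \<and> ms j \<noteq> m0"
    and m0: "mdeg m0 = d" "lookup m0 4 = 0"
    and det: "Determinant.det (mat r r (\<lambda>(i, j). monom_val (vec_nth (P i)) (ms j))) \<noteq> 0"
    and no_three: "\<And>i j k. i < r \<Longrightarrow> j < r \<Longrightarrow> k < r \<Longrightarrow> i \<noteq> j \<Longrightarrow> i \<noteq> k \<Longrightarrow> j \<noteq> k \<Longrightarrow>
      P k \<notin> vec.span {P i, P j}"
begin

definition n :: nat where "n = (d + 2) choose 3"
definition m :: nat where "m = r + n"
definition L :: "mpoly4 mat" where "L = interpolation_matrix d r P"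
definition A :: "nat \<Rightarrow> nat \<Rightarrow> mpoly4" where "A i k = L $$ (i, k)"
definition mono :: "nat \<Rightarrow> 4 \<Rightarrow>\<^sub>0 nat" where "mono k = monomials d ! k"
definition mono' :: "nat \<Rightarrow> 4 \<Rightarrow>\<^sub>0 nat" where "mono' i = monomials (d - 1) ! (i - r)"
definition deg :: "nat \<Rightarrow> nat" where "deg i = (if i < r then 0 else 1)"

text \<open>The row \<open>i\<close> of the interpolation matrix, up to a scalar and the factors \<open>mfact\<close> of the
  columns, as a form of degree \<open>d\<close>: a power \<open>L\<^sub>i\<^sup>d\<close> or a monomial times the form dual to \<open>Q\<close>.\<close>

definition rowp :: "complex ^ 4 \<Rightarrow> nat \<Rightarrow> mpoly4" where
  "rowp Q i = (if i < r then dual_form (P i) ^ d else single (mono' i) 1 * dual_form Q)"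

definition wt :: "nat \<Rightarrow> complex" where "wt i = (if i < r then 1 / fact d else 1)"

lemma wt_nonzero [simp]: "wt i \<noteq> 0" by (simp add: wt_def)

lemma len': "length (monomials (d - 1)) = n"
  using d by (simp add: monomials_list n_def)

lemma len: "length (monomials d) = Suc m"
proof -
  obtain b where b: "d = Suc b" using d by (cases d) auto
  have "(d + 3) choose 3 = ((d + 2) choose 2) + ((d + 2) choose 3)"
    by (simp add: b numeral_3_eq_3 numeral_2_eq_2)
  then show ?thesis using r by (simp add: monomials_list m_def n_def)
qed

lemma n_pos: "n \<ge> 1"
  using d by (simp add: n_def Suc_le_eq)

lemma r_ge_5: "r \<ge> 5"
proof -
  have "(4::nat) choose 2 \<le> (d + 2) choose 2" by (rule binomial_right_mono) (use d in simp)
  moreover have "(4::nat) choose 2 = 6" by (simp add: numeral_eq_Suc)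
  ultimately show ?thesis using r by simp
qed

lemma L_carrier: "L \<in> carrier_mat m (Suc m)"
  unfolding L_def interpolation_matrix_def len len' m_def[symmetric] by simp

lemma mdeg_mono: assumes "k \<le> m" shows "mdeg (mono k) = d"
proof -
  have "mono k \<in> set (monomials d)" unfolding mono_def by (rule nth_mem) (use assms len in simp)
  then show ?thesis unfolding monomials_list(1) by simp
qed

lemma mdeg_mono': assumes "r \<le> i" "i < m" shows "mdeg (mono' i) = d - 1"
proof -
  have "i - r < n" using assms unfolding m_def by linarith
  then have "mono' i \<in> set (monomials (d - 1))" unfolding mono'_def by (intro nth_mem) (simp only: len')
  then show ?thesis unfolding monomials_list(1) by simp
qed

lemma mono_surj: assumes "mdeg a = d" obtains k where "k \<le> m" "mono k = a"
proof -
  have "a \<in> set (monomials d)" using assms monomials_list(1) by simp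
  then obtain k where "k < length (monomials d)" "monomials d ! k = a" by (auto simp: in_set_conv_nth)
  then show thesis using that[of k] len by (simp add: mono_def)
qed

lemma mono'_surj: assumes "mdeg a = d - 1" obtains i where "r \<le> i" "i < m" "mono' i = a"
proof -
  have "a \<in> set (monomials (d - 1))" using assms monomials_list(1) by simp
  then obtain k where "k < length (monomials (d - 1))" "monomials (d - 1) ! k = a" by (auto simp: in_set_conv_nth)
  then show thesis using that[of "r + k"] len' by (simp add: mono'_def m_def)
qed

lemma mono'_inj:
  assumes "r \<le> i" "i < m" "r \<le> j" "j < m" shows "mono' i = mono' j \<longleftrightarrow> i = j"
proof -
  have "i - r < n" "j - r < n" using assms unfolding m_def by linarith+
  then have "mono' i = mono' j \<longleftrightarrow> i - r = j - r"
    unfolding mono'_def by (intro nth_eq_iff_index_eq[OF monomials_list(2)]) (simp_all only: len')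
  then show ?thesis using assms by linarith
qed

lemma A_point: "i < r \<Longrightarrow> k \<le> m \<Longrightarrow> A i k = single 0 (monom_val (vec_nth (P i)) (mono k))"
  unfolding A_def L_def interpolation_matrix_def len len'
  by (simp add: mono_def monom4_def eval_single m_def)

lemma A_deriv: "r \<le> i \<Longrightarrow> i < m \<Longrightarrow> k \<le> m \<Longrightarrow> A i k = iter_deriv (mono' i) (single (mono k) 1)"
  unfolding A_def L_def interpolation_matrix_def len len'
  by (simp add: mono_def mono'_def monom4_def m_def)

lemma Suc_d: "Suc (d - 1) = d" using d by simp

lemma A_forms: assumes "i < m" "k \<le> m" shows "A i k \<in> forms (deg i)"
proof (cases "i < r")
  case True
  then show ?thesis using A_point[of i k] assms forms_0_iff by (auto simp: deg_def)
next
  case False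
  then have ri: "r \<le> i" by simp
  have one: "deg i = 1" using False by (simp add: deg_def)
  have "mdeg (mono k) = Suc (d - 1)" unfolding Suc_d by (rule mdeg_mono[OF assms(2)])
  from eval_iter_deriv(2)[OF mdeg_mono'[OF ri assms(1)] this]
  show ?thesis unfolding A_deriv[OF ri assms] one .
qed

lemma sum_deg: "(\<Sum>i<m. deg i) = n"
proof -
  have "(\<Sum>i<m. deg i) = (\<Sum>i\<in>{..<m} - {..<r}. deg i) + (\<Sum>i\<in>{..<r}. deg i)"
    by (rule sum.subset_diff) (auto simp: m_def)
  also have "(\<Sum>i\<in>{..<r}. deg i) = 0" by (simp add: deg_def)
  also have "(\<Sum>i\<in>{..<m} - {..<r}. deg i) = (\<Sum>i\<in>{..<m} - {..<r}. 1)"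
    by (rule sum.cong) (auto simp: deg_def)
  also have "\<dots> = n" by (simp add: card_Diff_subset m_def)
  finally show ?thesis by simp
qed

lemma eval_A:
  assumes "i < m" "k \<le> m"
  shows "eval (vec_nth Q) (A i k) = wt i * mfact (mono k) * lookup (rowp Q i) (mono k)"
proof (cases "i < r")
  case True
  have "wt i * mfact (mono k) * lookup (rowp Q i) (mono k) = 1 / fact d * (fact d * monom_val (vec_nth (P i)) (mono k))"
    using True lookup_dual_form_power[OF mdeg_mono[OF assms(2)], of "P i"] by (simp add: rowp_def wt_def mult.assoc)
  then show ?thesis using A_point[OF True assms(2)] by (simp add: eval_single)
next
  case False
  then have ri: "r \<le> i" by simp
  have "mdeg (mono k) = Suc (d - 1)" using mdeg_mono[OF assms(2)] Suc_d by simp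
  from eval_iter_deriv(1)[OF mdeg_mono'[OF ri assms(1)] this, of Q]
  show ?thesis using False by (simp add: A_deriv[OF ri assms] rowp_def wt_def)
qed

lemma rowp_forms: assumes "i < m" shows "rowp Q i \<in> forms d"
proof (cases "i < r")
  case True
  then show ?thesis using forms_power[OF dual_form_forms, of "P i" d] by (simp add: rowp_def)
next
  case False
  then have "single (mono' i) 1 * dual_form Q \<in> forms (d - 1 + 1)"
    using forms_single[of "mono' i" 1] mdeg_mono'[of i] assms by (intro forms_mult dual_form_forms) simp
  then show ?thesis using False d by (simp add: rowp_def)
qed

text \<open>The factors \<open>mfact\<close> belong to the columns and do not affect relations between rows.\<close>

lemma rows_relation_iff:
  "(\<forall>k\<le>m. (\<Sum>i<m. c i * eval (vec_nth Q) (A i k)) = 0) \<longleftrightarrow> (\<Sum>i<m. cscale (c i * wt i) (rowp Q i)) = 0"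
proof -
  let ?f = "\<Sum>i<m. cscale (c i * wt i) (rowp Q i)"
  have f: "?f \<in> forms d" using rowp_forms by (intro forms_sum forms_cscale) simp
  have "(\<Sum>i<m. c i * eval (vec_nth Q) (A i k)) = mfact (mono k) * lookup ?f (mono k)" if "k \<le> m" for k
    unfolding lookup_sum sum_distrib_left
    by (rule sum.cong) (simp_all add: eval_A[OF _ that])
  then have "(\<forall>k\<le>m. (\<Sum>i<m. c i * eval (vec_nth Q) (A i k)) = 0) \<longleftrightarrow> (\<forall>k\<le>m. lookup ?f (mono k) = 0)"
    by simp
  also have "\<dots> \<longleftrightarrow> ?f = 0"
  proof
    assume z: "\<forall>k\<le>m. lookup ?f (mono k) = 0"
    show "?f = 0"
    proof (rule poly_mapping_eqI)
      fix a
      show "lookup ?f a = lookup 0 a"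
      proof (cases "mdeg a = d")
        case True
        then obtain k where "k \<le> m" "mono k = a" by (rule mono_surj)
        then show ?thesis using z by auto
      next
        case False
        then show ?thesis using f by (auto simp: forms_iff)
      qed
    qed
  qed simp
  finally show ?thesis .
qed

definition Q0 :: "complex ^ 4" where "Q0 = axis 4 1"

lemma Q0_nonzero: "Q0 \<noteq> 0" by (simp add: Q0_def axis_eq_0_iff)

lemma dual_Q0: "dual_form Q0 = coord 4"
proof -
  have "vec_nth Q0 j = (if j = 4 then 1 else (0::complex))" for j by (simp add: Q0_def axis_def)
  then show ?thesis by (simp add: dual_form_eq if_distrib[of "\<lambda>c. cscale c _"] cong: if_cong)
qed

text \<open>At \<open>[1:0:0:0]\<close> the rows of derivatives live on the monomials divisible by \<open>x\<^sub>0\<close>, each row on one of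
  them. The rows of the points are independent on the other monomials, even without \<open>m0\<close>. So the
  minor that omits the column \<open>m0\<close> is nonzero.\<close>

lemma nondegenerate: "\<exists>j\<le>m. eval (vec_nth Q0) (sminor m A j) \<noteq> 0"
proof -
  obtain j where j: "j \<le> m" "mono j = m0" using mono_surj[OF m0(1)] .
  have "eval (vec_nth Q0) (sminor m A j) \<noteq> 0"
    unfolding eval_sminor_nonzero_iff[OF j(1)]
  proof (intro allI impI)
    fix c i assume c: "\<forall>k\<le>m. k \<noteq> j \<longrightarrow> (\<Sum>i<m. c i * eval (vec_nth Q0) (A i k)) = 0" and i: "i < m"
    have col: "(\<Sum>i<m. c i * wt i * lookup (rowp Q0 i) a) = 0" if a: "mdeg a = d" "a \<noteq> m0" for a
    proof -
      obtain k where k: "k \<le> m" "mono k = a" using mono_surj[OF a(1)] .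
      then have "k \<noteq> j" using j a by auto
      then have "(\<Sum>i<m. c i * eval (vec_nth Q0) (A i k)) = 0" using c k by blast
      moreover have "(\<Sum>i<m. c i * eval (vec_nth Q0) (A i k)) = mfact a * (\<Sum>i<m. c i * wt i * lookup (rowp Q0 i) a)"
        unfolding sum_distrib_left k(2)[symmetric]
        by (rule sum.cong) (simp_all add: eval_A[OF _ k(1)])
      ultimately show ?thesis by simp
    qed
    have row': "lookup (rowp Q0 i) a = (if a = mono' i + single 4 1 then 1 else 0)" if "r \<le> i" for i a
      unfolding rowp_def dual_Q0 using that by (simp add: mult_single lookup_single when_def)
    have split: "(\<Sum>i<m. f i) = (\<Sum>i<r. f i) + (\<Sum>i\<in>{r..<m}. f i)" for f :: "nat \<Rightarrow> complex"
      using sum.atLeastLessThan_concat[of 0 r m f] by (simp add: m_def lessThan_atLeast0)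
    have c0: "c i = 0" if "i < r" for i
    proof -
      have "(\<Sum>i<r. c i * monom_val (vec_nth (P i)) (ms k)) = 0" if k: "k < r" for k
      proof -
        have a: "mdeg (ms k) = d" "lookup (ms k) 4 = 0" "ms k \<noteq> m0" using ms[OF k] by auto
        have ne: "ms k \<noteq> mono' i + single 4 1" for i
          using a(2) by (metis add_is_0 lookup_add lookup_single_eq zero_neq_one)
        have "(\<Sum>i\<in>{r..<m}. c i * wt i * lookup (rowp Q0 i) (ms k)) = 0"
          by (rule sum.neutral) (simp add: row' ne[unfolded One_nat_def])
        then have "(\<Sum>i<r. c i * wt i * lookup (rowp Q0 i) (ms k)) = 0"
          using col[OF a(1,3)] unfolding split by simp
        then have "mfact (ms k) * (\<Sum>i<r. c i * wt i * lookup (rowp Q0 i) (ms k)) = 0" by simp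
        moreover have "mfact (ms k) * (\<Sum>i<r. c i * wt i * lookup (rowp Q0 i) (ms k))
            = (\<Sum>i<r. c i * monom_val (vec_nth (P i)) (ms k))"
          unfolding sum_distrib_left
        proof (rule sum.cong)
          fix i assume "i \<in> {..<r}"
          then have ir: "i < r" by simp
          have "mfact (ms k) * lookup (rowp Q0 i) (ms k) = fact d * monom_val (vec_nth (P i)) (ms k)"
            using lookup_dual_form_power[OF a(1), of "P i"] ir by (simp add: rowp_def)
          then have "mfact (ms k) * (c i * wt i * lookup (rowp Q0 i) (ms k)) = c i * wt i * (fact d * monom_val (vec_nth (P i)) (ms k))"
            by (metis (no_types, opaque_lifting) mult.assoc mult.left_commute)
          then show "mfact (ms k) * (c i * wt i * lookup (rowp Q0 i) (ms k)) = c i * monom_val (vec_nth (P i)) (ms k)"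
            using ir by (simp add: wt_def)
        qed simp
        ultimately show ?thesis by simp
      qed
      then have "\<forall>k<r. (\<Sum>i<r. c i * mat r r (\<lambda>(i, j). monom_val (vec_nth (P i)) (ms j)) $$ (i, k)) = 0"
        by simp
      then have "\<forall>i<r. c i = 0"
        by (rule mp[OF spec[OF iffD1[OF det_nonzero_iff[OF mat_carrier] det]]])
      then show ?thesis using that by simp
    qed
    show "c i = 0"
    proof (cases "i < r")
      case False
      then have ri: "r \<le> i" by simp
      let ?a = "mono' i + single 4 1"
      have a: "mdeg ?a = d" using mdeg_mono'[OF ri i] d by (simp add: mdeg_add)
      have "?a \<noteq> m0" using m0(2) by (auto simp: lookup_add)
      then have "(\<Sum>i<r. c i * wt i * lookup (rowp Q0 i) ?a) + (\<Sum>i\<in>{r..<m}. c i * wt i * lookup (rowp Q0 i) ?a) = 0"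
        using col[OF a] unfolding split by simp
      moreover have "(\<Sum>i<r. c i * wt i * lookup (rowp Q0 i) ?a) = 0" by (rule sum.neutral) (simp add: c0)
      moreover have "(\<Sum>k\<in>{r..<m}. c k * wt k * lookup (rowp Q0 k) ?a) = (\<Sum>k\<in>{r..<m}. if k = i then c k else 0)"
        by (rule sum.cong) (use mono'_inj[OF ri i] in \<open>auto simp: row' wt_def\<close>)
      ultimately show ?thesis using ri i by simp
    qed (rule c0)
  qed
  then show ?thesis using j(1) by blast
qed

lemma sminor_in_forms: "j \<le> m \<Longrightarrow> sminor m A j \<in> forms n"
  using sminor_forms[of m A deg j] A_forms sum_deg by simp

lemma weddle_rank: "weddle_rank d r P = m"
proof -
  obtain j where j: "j \<le> m" "eval (vec_nth Q0) (sminor m A j) \<noteq> 0" using nondegenerate by blast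
  have A: "A = (\<lambda>i k. L $$ (i, k))" by (simp add: A_def fun_eq_iff)
  have dr: "dim_row L = m" using L_carrier by simp
  show ?thesis
    unfolding weddle_rank_def L_def[symmetric] dr
    by (rule general_valueI[OF sminor_in_forms[OF j(1)] Q0_nonzero j(2)])
       (rule rank_of_minor[OF L_carrier j(1)], simp add: A)
qed

abbreviation I :: "mpoly4 set" where "I \<equiv> minor_ideal m A"

lemma weddle_ideal_eq: "weddle_ideal d r P = saturation I"
proof -
  have A: "A = (\<lambda>i k. L $$ (i, k))" by (simp add: A_def fun_eq_iff)
  show ?thesis unfolding weddle_ideal_def weddle_rank L_def[symmetric] minors_ideal_eq[OF L_carrier] A ..
qed

lemma rows_independent:
  assumes "j \<le> m" "eval (vec_nth Q) (sminor m A j) \<noteq> 0" "(\<Sum>i<m. cscale (c i) (rowp Q i)) = 0"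
  shows "\<forall>i<m. c i = 0"
proof -
  have "(\<Sum>i<m. cscale (c i / wt i * wt i) (rowp Q i)) = 0" using assms(3) by simp
  then have "\<forall>k\<le>m. (\<Sum>i<m. c i / wt i * eval (vec_nth Q) (A i k)) = 0" unfolding rows_relation_iff .
  then have all: "\<forall>k\<le>m. k \<noteq> j \<longrightarrow> (\<Sum>i<m. c i / wt i * eval (vec_nth Q) (A i k)) = 0" by blast
  have "\<forall>i<m. c i / wt i = 0"
    by (rule mp[OF spec[OF assms(2)[unfolded eval_sminor_nonzero_iff[OF assms(1)]]] all])
  then show ?thesis by simp
qed

lemma rows_dependent:
  assumes "j \<le> m" "(\<Sum>i<m. cscale (c i) (rowp Q i)) = 0" "i < m" "c i \<noteq> 0"
  shows "eval (vec_nth Q) (sminor m A j) = 0"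
  using rows_independent[OF assms(1) _ assms(2)] assms(3,4) by blast

subsection \<open>The expected codimension\<close>

definition J :: "mpoly4 set" where "J = powers_ideal d r P"

lemma J_eq: "J = adjoin {0} r (\<lambda>i. dual_form (P i) ^ d)"
  unfolding J_def powers_ideal_def
proof (rule genideal_eqI)
  show "is_idl (adjoin {0} r (\<lambda>i. dual_form (P i) ^ d))" by (rule adjoin_is_idl[OF is_idl_zero])
  show "{dual_form (P i) ^ d |i. i < r} \<subseteq> adjoin {0} r (\<lambda>i. dual_form (P i) ^ d)"
    using adjoin_gen[OF is_idl_zero, of _ r "\<lambda>i. dual_form (P i) ^ d"] by blast
  show "adjoin {0} r (\<lambda>i. dual_form (P i) ^ d) \<subseteq> K" if "is_idl K" "{dual_form (P i) ^ d |i. i < r} \<subseteq> K" for K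
    using that is_idlD(1)[OF that(1)] by (intro adjoin_least) auto
qed

lemma J_low: "J \<inter> forms (d - 1) = {0}"
proof (intro subset_antisym subsetI)
  fix f assume f: "f \<in> J \<inter> forms (d - 1)"
  then have "f \<in> J" by blast
  then obtain g where g: "f = (\<Sum>i<r. dual_form (P i) ^ d * g i)" unfolding J_eq adjoin_zero_iff by blast
  have "f = hom_component (d - 1) f" using f hom_component_id by auto
  also have "\<dots> = 0"
    unfolding g hom_component_sum
  proof (rule sum.neutral, rule ballI)
    fix i
    have "dual_form (P i) ^ d \<in> forms d" using forms_power[OF dual_form_forms, of "P i" d] by simp
    then show "hom_component (d - 1) (dual_form (P i) ^ d * g i) = 0"
      using hom_component_mult_form[of _ d "d - 1"] d by simp
  qed
  finally show "f \<in> {0}" by simp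
qed (auto simp: J_eq is_idlD(1)[OF adjoin_is_idl[OF is_idl_zero]])

lemma J_degree_d: "J \<inter> forms d = cs.span ((\<lambda>i. dual_form (P i) ^ d) ` {..<r})"
proof (intro subset_antisym)
  have Jid: "is_idl J" unfolding J_eq by (rule adjoin_is_idl[OF is_idl_zero])
  have gen: "dual_form (P i) ^ d \<in> J \<inter> forms d" if "i < r" for i
    using adjoin_gen[OF is_idl_zero that, of "\<lambda>i. dual_form (P i) ^ d"] forms_power[OF dual_form_forms, of "P i" d]
    by (simp add: J_eq)
  show "cs.span ((\<lambda>i. dual_form (P i) ^ d) ` {..<r}) \<subseteq> J \<inter> forms d"
    by (rule cs.span_minimal) (use gen cs.subspace_inter[OF is_idl_subspace[OF Jid] forms_subspace] in auto)
  show "J \<inter> forms d \<subseteq> cs.span ((\<lambda>i. dual_form (P i) ^ d) ` {..<r})"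
  proof
    fix f assume f: "f \<in> J \<inter> forms d"
    then have "f \<in> J" by blast
  then obtain g where g: "f = (\<Sum>i<r. dual_form (P i) ^ d * g i)" unfolding J_eq adjoin_zero_iff by blast
    have "f = hom_component d f" using f hom_component_id by auto
    also have "\<dots> = (\<Sum>i<r. dual_form (P i) ^ d * hom_component 0 (g i))"
      unfolding g hom_component_sum
    proof (rule sum.cong)
      fix i
      have "dual_form (P i) ^ d \<in> forms d" using forms_power[OF dual_form_forms, of "P i" d] by simp
      then show "hom_component d (dual_form (P i) ^ d * g i) = dual_form (P i) ^ d * hom_component 0 (g i)"
        using hom_component_mult_form[of _ d d] by simp
    qed simp
    also have "\<dots> \<in> cs.span ((\<lambda>i. dual_form (P i) ^ d) ` {..<r})"
    proof (rule cs.span_sum)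
      fix i assume i: "i \<in> {..<r}"
      obtain c where "hom_component 0 (g i) = single 0 c" using forms_0_iff hom_component_forms by blast
      then have "dual_form (P i) ^ d * hom_component 0 (g i) = cscale c (dual_form (P i) ^ d)"
        by (simp add: cscale_def mult.commute)
      then show "dual_form (P i) ^ d * hom_component 0 (g i) \<in> cs.span ((\<lambda>i. dual_form (P i) ^ d) ` {..<r})"
        using i by (auto intro: cs.span_scale cs.span_base)
    qed
    finally show "f \<in> cs.span ((\<lambda>i. dual_form (P i) ^ d) ` {..<r})" .
  qed
qed

lemma dim_J: "cdim (J \<inter> forms d) = r"
proof -
  obtain j where j: "j \<le> m" "eval (vec_nth Q0) (sminor m A j) \<noteq> 0" using nondegenerate by blast
  have "cdim (cs.span ((\<lambda>i. dual_form (P i) ^ d) ` {..<r})) = card {..<r}"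
  proof (rule cs.dim_span_family)
    fix c assume c: "(\<Sum>i<r. cscale (c i) (dual_form (P i) ^ d)) = 0"
    let ?c = "\<lambda>i. if i < r then c i else 0"
    have "(\<Sum>i<m. cscale (?c i) (rowp Q0 i)) = (\<Sum>i<r. cscale (c i) (dual_form (P i) ^ d))"
      by (rule sum.mono_neutral_cong_right) (auto simp: m_def rowp_def)
    also note c
    finally have z: "\<forall>i<m. ?c i = 0" by (rule rows_independent[OF j])
    show "\<forall>i\<in>{..<r}. c i = 0"
    proof
      fix i assume i: "i \<in> {..<r}"
      then have "i < m" by (simp add: m_def)
      from z[rule_format, OF this] show "c i = 0" using i by simp
    qed
  qed simp
  then show ?thesis unfolding J_degree_d by simp
qed

text \<open>The numerator of the image of \<open>\<times>L\<^sub>Q\<close> in \<open>[R/J]\<^sub>d\<close> is the row space at \<open>Q\<close>; so the rank of \<open>\<times>L\<^sub>Q\<close> is the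
  rank of the interpolation matrix minus \<open>r\<close>.\<close>

lemma mult_space_eq:
  "{dual_form Q * f + g | f g. f \<in> forms (d - 1) \<and> g \<in> J \<inter> forms d} = cs.span (rowp Q ` {..<m})"
  (is "?S = _")
proof (intro subset_antisym)
  have Jid: "is_idl J" unfolding J_eq by (rule adjoin_is_idl[OF is_idl_zero])
  have "cs.subspace ((\<lambda>f. dual_form Q * f) ` forms (d - 1))"
    by (rule csp.linear_subspace_image[OF linear_cpoly_mult forms_subspace])
  from cs.subspace_sums[OF this cs.subspace_inter[OF is_idl_subspace[OF Jid] forms_subspace[of d]]]
  have sub: "cs.subspace ?S"
  proof -
    assume a: "cs.subspace {x + y |x y. x \<in> (\<lambda>f. dual_form Q * f) ` forms (d - 1) \<and> y \<in> J \<inter> forms d}"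
    have "?S = {x + y |x y. x \<in> (\<lambda>f. dual_form Q * f) ` forms (d - 1) \<and> y \<in> J \<inter> forms d}" by auto
    then show ?thesis using a by simp
  qed
  show "cs.span (rowp Q ` {..<m}) \<subseteq> ?S"
  proof (rule cs.span_minimal[OF _ sub], rule image_subsetI)
    fix i assume "i \<in> {..<m}"
    then have i: "i < m" by simp
    show "rowp Q i \<in> ?S"
    proof (cases "i < r")
      case True
      then have "rowp Q i \<in> J \<inter> forms d"
        unfolding J_degree_d by (auto simp: rowp_def intro: cs.span_base)
      moreover have "rowp Q i = dual_form Q * 0 + rowp Q i" by simp
      ultimately show ?thesis using forms_0 by blast
    next
      case False
      have "rowp Q i = dual_form Q * single (mono' i) 1 + 0" using False by (simp add: rowp_def mult.commute)
      moreover have "single (mono' i) 1 \<in> forms (d - 1)" using forms_single[of "mono' i" 1] mdeg_mono'[of i] False i by simp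
      moreover have "0 \<in> J \<inter> forms d" using is_idlD(1)[OF Jid] by simp
      ultimately show ?thesis by blast
    qed
  qed
  show "?S \<subseteq> cs.span (rowp Q ` {..<m})"
  proof
    fix x assume "x \<in> ?S"
    then obtain f g where fg: "x = dual_form Q * f + g" "f \<in> forms (d - 1)" "g \<in> J \<inter> forms d" by blast
    have "(\<lambda>i. dual_form (P i) ^ d) ` {..<r} \<subseteq> rowp Q ` {..<m}"
      by (auto simp: rowp_def m_def image_iff intro!: bexI)
    then have g: "g \<in> cs.span (rowp Q ` {..<m})" using fg(3) cs.span_mono unfolding J_degree_d by blast
    have "dual_form Q * f = (\<Sum>a\<in>keys f. cscale (lookup f a) (single a 1 * dual_form Q))"
      by (subst cpoly_sum_cscale[of f]) (simp add: sum_distrib_left cscale_mult_right mult.commute)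
    also have "\<dots> \<in> cs.span (rowp Q ` {..<m})"
    proof (intro cs.span_sum cs.span_scale cs.span_base)
      fix a assume "a \<in> keys f"
      then have "mdeg a = d - 1" using fg(2) by (simp add: forms_def)
      then obtain i where i: "r \<le> i" "i < m" "mono' i = a" by (rule mono'_surj)
      then have "single a 1 * dual_form Q = rowp Q i" by (simp add: rowp_def)
      then show "single a 1 * dual_form Q \<in> rowp Q ` {..<m}" using i by blast
    qed
    finally show "x \<in> cs.span (rowp Q ` {..<m})" using g fg(1) cs.span_add by blast
  qed
qed

lemma general_mult_rank: "general_value (\<lambda>Q. mult_rank J d (dual_form Q)) = n"
proof -
  obtain j where j: "j \<le> m" "eval (vec_nth Q0) (sminor m A j) \<noteq> 0" using nondegenerate by blast
  show ?thesis
  proof (rule general_valueI[OF sminor_in_forms[OF j(1)] Q0_nonzero j(2)])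
    fix Q assume Q: "eval (vec_nth Q) (sminor m A j) \<noteq> 0"
    have "cdim (cs.span (rowp Q ` {..<m})) = card {..<m}"
      by (rule cs.dim_span_family) (use rows_independent[OF j(1) Q] in auto)
    then show "mult_rank J d (dual_form Q) = n"
      unfolding mult_rank_def mult_space_eq dim_J by (simp add: m_def)
  qed
qed

text \<open>The matrix of \<open>\<times>L\<^sub>Q\<close> has size \<open>(n + 1) \<times> n\<close> and generic rank \<open>n\<close>.\<close>

lemma expected_codim: "expected_codim d r P = 2"
proof -
  have "cdim {0 :: mpoly4} = 0" using cs.dim_le_card[of "{0}" "{}"] by simp
  then have p: "hilbert_fun J (d - 1) = n"
    unfolding hilbert_fun_def J_low dim_forms n_def using d by simp
  have q: "hilbert_fun J d = n + 1"
    unfolding hilbert_fun_def dim_J dim_forms using len by (simp add: monomials_list m_def)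
  show ?thesis
    unfolding expected_codim_def Let_def J_def[symmetric] p q general_mult_rank by simp
qed

end

section \<open>Ideals of linear subspaces\<close>

lemma eval_dual_form: "eval (vec_nth v) (dual_form w) = (\<Sum>k\<in>UNIV. vec_nth w k * vec_nth v k)"
  unfolding dual_form_eq eval.hom_sum eval_cscale by (simp add: eval_single monom_val_single)

lemma vanishing_ideal_is_idl: "is_idl (vanishing_ideal V)"
  by (auto simp: is_idl_def vanishing_ideal_def eval.hom_add eval.hom_mult)

lemma vanishing_ideal_mono: "V \<subseteq> W \<Longrightarrow> vanishing_ideal W \<subseteq> vanishing_ideal V"
  by (auto simp: vanishing_ideal_def)

text \<open>For \<open>v \<in> V\<close> the values \<open>f(x v)\<close> form a polynomial in \<open>x\<close> that vanishes identically, and its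
  coefficients are the values of the homogeneous components at \<open>v\<close>.\<close>

lemma vanishing_ideal_homogeneous:
  assumes V: "vec.subspace V" shows "homogeneous_ideal (vanishing_ideal V)"
  unfolding homogeneous_ideal_iff
proof (intro conjI ballI allI vanishing_ideal_is_idl)
  fix f t assume f: "f \<in> vanishing_ideal V"
  obtain N where N: "f \<in> polys_le N" using polys_le_exists by blast
  show "hom_component t f \<in> vanishing_ideal V"
    unfolding vanishing_ideal_def
  proof (intro CollectI ballI)
    fix v assume v: "v \<in> V"
    let ?e = "\<lambda>s. eval (vec_nth v) (hom_component s f)"
    have "(\<Sum>s\<le>max N t. ?e s * x ^ s) = 0" for x :: complex
    proof -
      have "x *s v \<in> V" using V v by (rule vec.subspace_scale)
      then have "eval (vec_nth (x *s v)) f = 0" using f by (simp add: vanishing_ideal_def)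
      moreover have "vec_nth (x *s v) = (\<lambda>k. x * vec_nth v k)" by (simp add: fun_eq_iff)
      ultimately have "0 = eval (\<lambda>k. x * vec_nth v k) f" by simp
      also have "f = (\<Sum>s\<le>max N t. hom_component s f)"
        by (rule polys_le_sum_components) (use N polys_le_mono[of N "max N t"] in auto)
      also have "eval (\<lambda>k. x * vec_nth v k) \<dots> = (\<Sum>s\<le>max N t. ?e s * x ^ s)"
        unfolding eval.hom_sum by (rule sum.cong) (simp_all add: eval_form_scale[OF hom_component_forms])
      finally show ?thesis by simp
    qed
    then have "\<forall>s\<le>max N t. ?e s = 0" using polyfun_eq_0[of ?e "max N t"] by blast
    then show "?e t = 0" by simp
  qed
qed

text \<open>On the line through a point where \<open>f\<close> does not vanish and one where \<open>g\<close> does not vanish, both have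
  finitely many zeros.\<close>

lemma vanishing_ideal_prime:
  assumes V: "vec.subspace V" shows "primeideal (vanishing_ideal V) R4"
  unfolding primeideal_R4_iff
proof (intro conjI allI impI vanishing_ideal_is_idl)
  have "1 \<notin> vanishing_ideal V" using vec.subspace_0[OF V] by (auto simp: vanishing_ideal_def)
  then show "vanishing_ideal V \<noteq> UNIV" by blast
  fix f g assume fg: "f * g \<in> vanishing_ideal V"
  show "f \<in> vanishing_ideal V \<or> g \<in> vanishing_ideal V"
  proof (rule ccontr)
    assume "\<not> (f \<in> vanishing_ideal V \<or> g \<in> vanishing_ideal V)"
    then obtain x y where x: "x \<in> V" "eval (vec_nth x) f \<noteq> 0" and y: "y \<in> V" "eval (vec_nth y) g \<noteq> 0"
      by (auto simp: vanishing_ideal_def)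
    let ?h = "\<lambda>k. vec_nth y k - vec_nth x k"
    have "finite {t. eval (\<lambda>k. vec_nth x k + t * ?h k) f = 0}"
      by (rule line_nonzero_cofinite[where s = 0]) (use x in simp)
    moreover have "finite {t. eval (\<lambda>k. vec_nth x k + t * ?h k) g = 0}"
      by (rule line_nonzero_cofinite[where s = 1]) (use y in simp)
    ultimately have fin: "finite ({t. eval (\<lambda>k. vec_nth x k + t * ?h k) f = 0} \<union>
      {t. eval (\<lambda>k. vec_nth x k + t * ?h k) g = 0})" by simp
    obtain t where t: "t \<notin> {t. eval (\<lambda>k. vec_nth x k + t * ?h k) f = 0} \<union>
      {t. eval (\<lambda>k. vec_nth x k + t * ?h k) g = 0}"
      by (rule exE[OF ex_new_if_finite[OF infinite_UNIV_char_0 fin]])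
    have "x + t *s (y - x) \<in> V"
      by (intro vec.subspace_add[OF V] vec.subspace_scale[OF V] vec.subspace_diff[OF V] x y)
    moreover have "vec_nth (x + t *s (y - x)) = (\<lambda>k. vec_nth x k + t * ?h k)"
      by (simp add: fun_eq_iff algebra_simps)
    ultimately have "eval (\<lambda>k. vec_nth x k + t * ?h k) (f * g) = 0"
      using fg unfolding vanishing_ideal_def by (metis (mono_tags, lifting) mem_Collect_eq)
    then show False using t by (simp add: eval.hom_mult)
  qed
qed

lemma lookup_0_eval: "eval (\<lambda>_. 0) f = lookup (f :: mpoly4) 0"
proof (induction f rule: cpoly_induct)
  case (single m c)
  have "monom_val (\<lambda>_. 0) m = (if m = 0 then 1 else (0 :: complex))" for m :: "4 \<Rightarrow>\<^sub>0 nat"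
  proof (cases "m = 0")
    case False
    then obtain k where "k \<in> keys m" by (metis equals0I keys_eq_empty)
    then have "monom_val (\<lambda>_. 0 :: complex) m = 0"
      unfolding monom_val_def by (intro prod_zero) (auto simp: in_keys_iff intro!: bexI[of _ k])
    then show ?thesis using False by simp
  qed simp
  then show ?case by (simp add: eval_single lookup_single when_def)
qed (simp add: eval.hom_add lookup_add)

lemma irrelevant_ideal_is_idl: "is_idl irrelevant_ideal"
  unfolding irrelevant_ideal_def lookup_0_eval[symmetric]
  by (auto simp: is_idl_def eval.hom_add eval.hom_mult)

lemma irrelevant_subset:
  assumes "is_idl K" "\<And>k. coord k \<in> K" shows "irrelevant_ideal \<subseteq> K"
proof
  fix f assume f: "f \<in> irrelevant_ideal"
  have "single m (lookup f m) \<in> K" if "m \<in> keys f" for m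
  proof -
    have "m \<noteq> 0" using that f by (auto simp: irrelevant_ideal_def in_keys_iff)
    then have "mdeg m \<noteq> 0" by (auto simp: mdeg_def poly_mapping_eq_iff fun_eq_iff)
    then obtain t where "mdeg m = Suc t" by (cases "mdeg m") auto
    then obtain k a where m: "m = single k 1 + a" by (rule monomial_pred)
    have "single m (lookup f m) = coord k * single a (lookup f m)" by (simp add: mult_single m)
    then show ?thesis using is_idlD(4)[OF assms(1,2)] by simp
  qed
  then have "(\<Sum>m\<in>keys f. single m (lookup f m)) \<in> K" by (intro is_idl_sum[OF assms(1)])
  then show "f \<in> K" using cpoly_sum_single[of f] by simp
qed

lemma vanishing_ideal_proj_point:
  assumes V: "vec.subspace V" "v \<in> V" "v \<noteq> 0" and I: "I \<subseteq> vanishing_ideal V"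
  shows "vanishing_ideal V \<in> proj_points I"
proof -
  obtain k where k: "vec_nth v k \<noteq> 0"
    using V(3) unfolding Finite_Cartesian_Product.vec_eq_iff by auto
  have "eval (vec_nth v) (coord k) \<noteq> 0" using k by (simp add: eval_single monom_val_single)
  then have "coord k \<notin> vanishing_ideal V" using V(2) unfolding vanishing_ideal_def by blast
  moreover have "coord k \<in> irrelevant_ideal"
  proof -
    have "lookup (coord k) 0 = 0"
      unfolding lookup_0_eval[symmetric] by (simp add: eval_single monom_val_single)
    then show ?thesis by (simp add: irrelevant_ideal_def)
  qed
  ultimately have "\<not> irrelevant_ideal \<subseteq> vanishing_ideal V" by blast
  then show ?thesis
    using vanishing_ideal_prime[OF V(1)] vanishing_ideal_homogeneous[OF V(1)] I by (simp add: proj_points_def)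
qed

text \<open>Take a coordinate of a linear map with kernel \<open>V\<close>.\<close>

lemma separating_form:
  assumes V: "vec.subspace V" and u: "u \<notin> V"
  obtains w where "dual_form w \<in> vanishing_ideal V" "eval (vec_nth u) (dual_form w) \<noteq> 0"
proof -
  interpret vecs: fd_space "(*s) :: complex \<Rightarrow> complex ^ 4 \<Rightarrow> complex ^ 4"
    by (simp add: fd_space_def vec.vector_space_axioms)
  obtain h :: "complex ^ 4 \<Rightarrow> complex ^ 4" where h: "Vector_Spaces.linear (*s) (*s) h" "\<And>x. h x = 0 \<longleftrightarrow> x \<in> V"
    by (rule vecs.exists_quotient_map[OF V]) (rule that)
  have "h u \<noteq> 0" using h(2) u by simp
  then obtain k where k: "vec_nth (h u) k \<noteq> 0"
    unfolding Finite_Cartesian_Product.vec_eq_iff by auto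
  define w where "w = vec_nth (matrix h) k"
  have e: "eval (vec_nth x) (dual_form w) = vec_nth (h x) k" for x
    unfolding eval_dual_form w_def matrix_works[OF h(1), of x, symmetric] by (simp add: matrix_vector_mult_def)
  show thesis
  proof (rule that[of w])
    show "dual_form w \<in> vanishing_ideal V"
      unfolding vanishing_ideal_def
    proof (intro CollectI ballI)
      fix v assume "v \<in> V"
      then have "h v = 0" using h(2) by simp
      then show "eval (vec_nth v) (dual_form w) = 0" unfolding e by simp
    qed
    show "eval (vec_nth u) (dual_form w) \<noteq> 0" unfolding e by (rule k)
  qed
qed

lemma chain_dim_ge:
  assumes "\<forall>i\<le>n. c i \<in> S" "\<forall>i<n. c i \<subset> c (Suc i)"
  shows "ereal (real n) \<le> chain_dim S"
  unfolding chain_dim_def by (rule Sup_upper) (use assms in blast)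

text \<open>If \<open>f g\<close> lies in every point, the scheme is covered by the zero loci of \<open>f\<close> and \<open>g\<close>, and one of
  them is everything. Hence the intersection of all points is prime.\<close>

lemma irreducible_generic_point:
  assumes "scheme_irreducible I"
  shows "\<Inter>(proj_points I) \<in> proj_points I"
proof -
  let ?S = "proj_points I"
  have ne: "?S \<noteq> {}" and irr: "\<And>J K. homogeneous_ideal J \<Longrightarrow> homogeneous_ideal K \<Longrightarrow>
        ?S \<subseteq> proj_points J \<union> proj_points K \<Longrightarrow> ?S \<subseteq> proj_points J \<or> ?S \<subseteq> proj_points K"
    using assms unfolding scheme_irreducible_def by blast+
  have q: "is_idl q" "homogeneous_ideal q" "q \<noteq> UNIV" "\<And>a b. a * b \<in> q \<Longrightarrow> a \<in> q \<or> b \<in> q"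
    "\<not> irrelevant_ideal \<subseteq> q" "I \<subseteq> q" "primeideal q R4" if "q \<in> ?S" for q
    using that unfolding proj_points_def primeideal_R4_iff by blast+
  obtain q0 where q0: "q0 \<in> ?S" using ne by blast
  have id: "is_idl (\<Inter>?S)" using q(1) unfolding is_idl_def by blast
  have hom: "homogeneous_ideal (\<Inter>?S)"
    unfolding homogeneous_ideal_iff using id q(2) unfolding homogeneous_ideal_iff by blast
  have hom0: "homogeneous_ideal {0}"
    by (auto simp: homogeneous_ideal_iff is_idl_zero hom_component_eq_restr)
  have "primeideal (\<Inter>?S) R4"
  proof (rule homogeneous_primeI[OF hom])
    show "\<Inter>?S \<noteq> UNIV" using q(3)[OF q0] q0 by blast
    fix f g s t assume fg: "f \<in> forms s" "g \<in> forms t" "f * g \<in> \<Inter>?S"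
    let ?P = "\<lambda>f. adjoin {0} 1 (\<lambda>_. f)"
    have hP: "homogeneous_ideal (?P f)" "homogeneous_ideal (?P g)"
      by (rule adjoin_homogeneous[OF hom0], rule fg(1), rule adjoin_homogeneous[OF hom0], rule fg(2))
    have mem: "q \<in> proj_points (?P x)" if "q \<in> ?S" "x \<in> q" for q x
    proof -
      have "?P x \<subseteq> q" by (rule adjoin_least[OF q(1)[OF that(1)]]) (use that is_idlD(1)[OF q(1)[OF that(1)]] in auto)
      then show ?thesis using that(1) unfolding proj_points_def by blast
    qed
    have mem': "x \<in> \<Inter>?S" if sub: "?S \<subseteq> proj_points (?P x)" for x
    proof
      fix q assume "q \<in> ?S"
      then have "q \<in> proj_points (?P x)" using sub by blast
      then have "?P x \<subseteq> q" unfolding proj_points_def by blast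
      moreover have "x \<in> ?P x" using adjoin_gen[OF is_idl_zero, of 0 1 "\<lambda>_. x"] by simp
      ultimately show "x \<in> q" by blast
    qed
    have "?S \<subseteq> proj_points (?P f) \<union> proj_points (?P g)"
    proof
      fix p assume p: "p \<in> ?S"
      then have "f * g \<in> p" using fg(3) by blast
      from q(4)[OF p this] show "p \<in> proj_points (?P f) \<union> proj_points (?P g)"
        using mem[OF p] by blast
    qed
    from irr[OF hP this] show "f \<in> \<Inter>?S \<or> g \<in> \<Inter>?S" using mem' by blast
  qed
  moreover have "\<not> irrelevant_ideal \<subseteq> \<Inter>?S" using q(5)[OF q0] q0 by blast
  moreover have "I \<subseteq> \<Inter>?S" using q(6) by blast
  ultimately show ?thesis using hom by (simp add: proj_points_def)
qed

section \<open>Saturation\<close>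

lemma saturation_superset: "I \<subseteq> saturation I"
proof
  fix f assume f: "f \<in> I"
  have "\<forall>m. mdeg m = 0 \<longrightarrow> monom4 m * f \<in> I"
  proof (intro allI impI)
    fix m :: "4 \<Rightarrow>\<^sub>0 nat" assume "mdeg m = 0"
    then have "m = 0" by (intro poly_mapping_eqI) (simp add: mdeg_def)
    then show "monom4 m * f \<in> I" using f by (simp add: monom4_def)
  qed
  then show "f \<in> saturation I" unfolding saturation_def by blast
qed

text \<open>The power \<open>l\<^sup>N\<close> is a combination of monomials of degree \<open>N\<close>, and it can be cancelled.\<close>

lemma saturation_eq:
  assumes I: "is_idl I" and l: "l \<in> forms 1" "\<And>g. l * g \<in> I \<Longrightarrow> g \<in> I"
  shows "saturation I = I"
proof (intro subset_antisym saturation_superset subsetI)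
  fix f assume "f \<in> saturation I"
  then obtain N where N: "\<And>m. mdeg m = N \<Longrightarrow> single m 1 * f \<in> I"
    by (auto simp: saturation_def monom4_def)
  have "l ^ N \<in> forms N" using forms_power[OF l(1), of N] by simp
  then have "(\<Sum>m\<in>keys (l ^ N). cscale (lookup (l ^ N) m) (single m 1 * f)) \<in> I"
    by (intro is_idl_sum[OF I] is_idl_cscale[OF I] N) (auto simp: forms_def)
  also have "(\<Sum>m\<in>keys (l ^ N). cscale (lookup (l ^ N) m) (single m 1 * f)) = l ^ N * f"
    by (subst (3) cpoly_sum_cscale) (simp add: sum_distrib_right cscale_mult_left)
  finally have "l ^ N * f \<in> I" .
  then show "f \<in> I" by (induction N) (auto simp: mult.assoc intro: l(2))
qed

text \<open>A relevant prime omits some variable, whose powers can be cancelled modulo it.\<close>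

lemma proj_points_saturation: "proj_points (saturation I) = proj_points I"
proof (intro subset_antisym subsetI)
  fix p assume "p \<in> proj_points (saturation I)"
  then show "p \<in> proj_points I" using saturation_superset unfolding proj_points_def by blast
next
  fix p assume p: "p \<in> proj_points I"
  then have id: "is_idl p" and prime: "\<And>a b. a * b \<in> p \<Longrightarrow> a \<in> p \<or> b \<in> p" and I: "I \<subseteq> p"
    unfolding proj_points_def primeideal_R4_iff by blast+
  have "p \<noteq> UNIV" using p unfolding proj_points_def primeideal_R4_iff by blast
  then have p1: "1 \<notin> p" using is_idlD(3)[OF id, of 1] by auto
  obtain k where k: "coord k \<notin> p"
    using irrelevant_subset[OF id] p unfolding proj_points_def by blast
  have pow: "coord k ^ N \<notin> p" for N
    by (induction N) (use p1 k prime in auto)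
  have "saturation I \<subseteq> p"
  proof
    fix f assume "f \<in> saturation I"
    then obtain N where N: "\<And>m. mdeg m = N \<Longrightarrow> single m 1 * f \<in> I"
      by (auto simp: saturation_def monom4_def)
    have "coord k ^ N * f \<in> p" unfolding coord_power using N[of "single k N"] I by auto
    then show "f \<in> p" using prime pow by blast
  qed
  then show "p \<in> proj_points (saturation I)" using p unfolding proj_points_def by blast
qed

section \<open>The Weddle curve\<close>

context weddle
begin

lemma I_homogeneous: "homogeneous_ideal I"
  by (rule minor_ideal_homogeneous[of m A deg]) (rule A_forms)

lemma I_id: "is_idl I" by (rule adjoin_is_idl[OF is_idl_zero])

lemma nonzero_minor: "\<exists>j\<le>m. sminor m A j \<noteq> 0"
  using nondegenerate by fastforce

lemma points_independent:
  assumes "i < r" "j < r" "i \<noteq> j" shows "P j \<notin> vec.span {P i}" "P i \<noteq> 0"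
proof -
  obtain k where k: "k < r" "k \<noteq> i" "k \<noteq> j"
  proof -
    have "\<exists>k\<in>{0, 1, 2}. k \<noteq> i \<and> k \<noteq> j" by auto
    then obtain k where k: "k \<in> {0, 1, 2}" "k \<noteq> i" "k \<noteq> j" by blast
    have "k < r" using k(1) r_ge_5 by auto
    then show thesis using that k by blast
  qed
  have "vec.span {P i} \<subseteq> vec.span {P i, P k}" by (rule vec.span_mono) auto
  then show "P j \<notin> vec.span {P i}" using no_three[of i k j] assms k by auto
  show "P i \<noteq> 0"
  proof
    assume "P i = 0"
    then have "P i \<in> vec.span {P j, P k}" by (simp add: vec.span_zero)
    then show False using no_three[of j k i] assms k by auto
  qed
qed

lemma card_point_set: "card (point_set r P) = r"
proof -
  have "point_set r P = (\<lambda>i. vec.span {P i}) ` {..<r}" by (auto simp: point_set_def)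
  moreover have "inj_on (\<lambda>i. vec.span {P i}) {..<r}"
  proof (rule inj_onI, rule ccontr)
    fix i j assume ij: "i \<in> {..<r}" "j \<in> {..<r}" "vec.span {P i} = vec.span {P j}" "i \<noteq> j"
    have "P j \<in> vec.span {P i}" unfolding ij(3) by (rule vec.span_base) simp
    then show False using points_independent(1)[of i j] ij by simp
  qed
  ultimately show ?thesis by (simp add: card_image)
qed

lemma card_joining_lines: "card (joining_lines r P) = r choose 2"
proof -
  let ?T = "{(i, j). i < j \<and> j < r}"
  have eq: "joining_lines r P = (\<lambda>(i, j). vec.span {P i, P j}) ` ?T" by (auto simp: joining_lines_def)
  have inj: "inj_on (\<lambda>(i, j). vec.span {P i, P j}) ?T"
  proof (rule inj_onI, clarify)
    fix i j k l assume ij: "i < j" "j < r" and kl: "k < l" "l < r"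
      and eq: "vec.span {P i, P j} = vec.span {P k, P l}"
    have mem: "t = i \<or> t = j" if "t = k \<or> t = l" for t
    proof (rule ccontr)
      assume t: "\<not> (t = i \<or> t = j)"
      have "P t \<in> vec.span {P i, P j}" unfolding eq by (rule vec.span_base) (use that in auto)
      then show False using no_three[of i j t] ij kl t that by auto
    qed
    show "i = k \<and> j = l" using mem[of k] mem[of l] ij kl by auto
  qed
  have "card ?T = r choose 2"
  proof -
    have "bij_betw (\<lambda>(i, j). {i, j}) ?T {S. S \<subseteq> {..<r} \<and> card S = 2}"
      unfolding bij_betw_def
    proof
      show "inj_on (\<lambda>(i, j). {i, j}) ?T" by (auto simp: inj_on_def doubleton_eq_iff)
      show "(\<lambda>(i, j). {i, j}) ` ?T = {S. S \<subseteq> {..<r} \<and> card S = 2}"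
      proof (intro subset_antisym subsetI)
        fix S assume "S \<in> {S. S \<subseteq> {..<r} \<and> card S = 2}"
        then obtain x y where xy: "S = {x, y}" "x \<noteq> y" "x < r" "y < r" by (auto simp: card_2_iff)
        show "S \<in> (\<lambda>(i, j). {i, j}) ` ?T"
        proof (cases "x < y")
          case True
          then show ?thesis using xy by (intro image_eqI[of _ _ "(x, y)"]) auto
        next
          case False
          then show ?thesis using xy by (intro image_eqI[of _ _ "(y, x)"]) auto
        qed
      qed auto
    qed
    then have "card ?T = card {S. S \<subseteq> {..<r} \<and> card S = 2}" by (rule bij_betw_same_card)
    also have "\<dots> = r choose 2" using n_subsets[of "{..<r}" 2] by simp
    finally show ?thesis .
  qed
  then show ?thesis unfolding eq card_image[OF inj] .
qed

lemma dim_joining_line: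
  assumes "i < j" "j < r" shows "vec.dim (vec.span {P i, P j}) = 2"
proof -
  have notin: "P j \<notin> vec.span {P i}" and "P i \<noteq> 0" using points_independent[of i j] assms by auto
  then have "vec.independent {P i}" by (simp add: vec.dependent_single)
  with notin have ind: "vec.independent {P j, P i}" by (rule vec.independent_insertI)
  have ne: "P i \<noteq> P j" using notin vec.span_base[of "P i" "{P i}"] by auto
  show ?thesis using vec.dim_span_eq_card_independent[OF ind] ne by (simp add: insert_commute)
qed

lemma multiple_of_dual_form:
  assumes "f \<in> forms (d - 1)"
  obtains c where "dual_form Q * f = (\<Sum>i<m. cscale (c i) (rowp Q i))" "\<forall>i<r. c i = 0"
proof -
  let ?c = "\<lambda>i. if i < r then 0 else lookup f (mono' i)"
  have inj: "inj_on mono' {r..<m}" using mono'_inj by (auto simp: inj_on_def)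
  have img: "keys f \<subseteq> mono' ` {r..<m}"
  proof
    fix a assume "a \<in> keys f"
    then have "mdeg a = d - 1" using assms by (simp add: forms_def)
    then obtain i where "r \<le> i" "i < m" "mono' i = a" by (rule mono'_surj)
    then show "a \<in> mono' ` {r..<m}" by auto
  qed
  have "dual_form Q * f = (\<Sum>a\<in>keys f. cscale (lookup f a) (single a 1 * dual_form Q))"
    by (subst cpoly_sum_cscale[of f]) (simp add: sum_distrib_left cscale_mult_right mult.commute)
  also have "\<dots> = (\<Sum>a\<in>mono' ` {r..<m}. cscale (lookup f a) (single a 1 * dual_form Q))"
    by (rule sum.mono_neutral_left) (use img in \<open>auto simp: in_keys_iff\<close>)
  also have "\<dots> = (\<Sum>i\<in>{r..<m}. cscale (lookup f (mono' i)) (single (mono' i) 1 * dual_form Q))"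
    by (rule sum.reindex_cong[OF inj refl]) simp
  also have "\<dots> = (\<Sum>i<m. cscale (?c i) (rowp Q i))"
    by (rule sum.mono_neutral_cong_left) (auto simp: rowp_def)
  finally show thesis using that[of ?c] by simp
qed

text \<open>As \<open>L\<^sub>Q = x L\<^sub>a + y L\<^sub>b\<close>, the form \<open>(y L\<^sub>b)\<^sup>d - (-x L\<^sub>a)\<^sup>d\<close> is divisible by \<open>L\<^sub>Q\<close>. This is a relation between
  the rows of the interpolation matrix at \<open>Q\<close>, nontrivial since \<open>y \<noteq> 0\<close>.\<close>

lemma minor_vanishes_collinear:
  assumes ab: "a < r" "b < r" "a \<noteq> b" and Q: "Q = x *s P a + y *s P b" "y \<noteq> 0" and j: "j \<le> m"
  shows "eval (vec_nth Q) (sminor m A j) = 0"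
proof -
  let ?U = "cscale (- x) (dual_form (P a))"
  have "dual_form Q = cscale x (dual_form (P a)) + cscale y (dual_form (P b))"
    unfolding Q(1) dual_form_add dual_form_scale ..
  then have y: "cscale y (dual_form (P b)) = ?U + dual_form Q" by (simp add: cs.scale_minus_left)
  define f where "f = (\<Sum>i<d. ?U ^ (d - Suc i) * (?U + dual_form Q) ^ i)"
  have lin: "?U \<in> forms 1" "?U + dual_form Q \<in> forms 1"
    by (intro forms_add forms_cscale dual_form_forms)+
  have f: "f \<in> forms (d - 1)"
    unfolding f_def
  proof (rule forms_sum)
    fix i assume "i \<in> {..<d}"
    then have deg: "(d - Suc i) * 1 + i * 1 = d - 1" by auto
    show "?U ^ (d - Suc i) * (?U + dual_form Q) ^ i \<in> forms (d - 1)"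
      using forms_mult[OF forms_power[OF lin(1)] forms_power[OF lin(2)], of "d - Suc i" i] unfolding deg .
  qed
  have "(?U + dual_form Q) ^ d - ?U ^ d = (?U + dual_form Q - ?U) * f"
    unfolding f_def by (rule power_diff_sumr2)
  then have "(?U + dual_form Q) ^ d - ?U ^ d = dual_form Q * f"
    unfolding add_diff_cancel_left' .
  moreover have pw: "cscale s g ^ k = cscale (s ^ k) (g ^ k)" for s k and g :: mpoly4
    by (induction k) (simp_all add: cscale_mult_left cscale_mult_right)
  ultimately have rel: "cscale (y ^ d) (dual_form (P b) ^ d) - cscale ((- x) ^ d) (dual_form (P a) ^ d) = dual_form Q * f"
    unfolding y[symmetric] pw by simp
  obtain c where c: "dual_form Q * f = (\<Sum>i<m. cscale (c i) (rowp Q i))" "\<forall>i<r. c i = 0"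
    by (rule multiple_of_dual_form[OF f])
  let ?c = "\<lambda>i. (if i = b then y ^ d else 0) - (if i = a then (- x) ^ d else 0) - c i"
  have abm: "a < m" "b < m" using ab by (auto simp: m_def)
  have "(\<Sum>i<m. cscale (?c i) (rowp Q i)) = (\<Sum>i<m. if i = b then cscale (y ^ d) (rowp Q i) else 0)
      - (\<Sum>i<m. if i = a then cscale ((- x) ^ d) (rowp Q i) else 0) - (\<Sum>i<m. cscale (c i) (rowp Q i))"
    unfolding sum_subtractf[symmetric] by (rule sum.cong) (auto simp: cs.scale_left_diff_distrib)
  also have "\<dots> = cscale (y ^ d) (rowp Q b) - cscale ((- x) ^ d) (rowp Q a) - dual_form Q * f"
    unfolding c(1)[symmetric] using abm by simp
  also have "\<dots> = 0" using rel ab by (simp add: rowp_def)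
  finally have zero: "(\<Sum>i<m. cscale (?c i) (rowp Q i)) = 0" .
  have "?c b \<noteq> 0" using ab Q(2) c(2) by simp
  from rows_dependent[OF j zero abm(2) this] show ?thesis .
qed

lemma I_vanishes_on_lines:
  assumes ab: "a < r" "b < r" "a \<noteq> b"
  shows "I \<subseteq> vanishing_ideal (vec.span {P a, P b})"
proof (rule adjoin_least[OF vanishing_ideal_is_idl])
  show "{0} \<subseteq> vanishing_ideal (vec.span {P a, P b})" using is_idlD(1)[OF vanishing_ideal_is_idl] by simp
  fix j assume "j < Suc m"
  then have j: "j \<le> m" by simp
  show "sminor m A j \<in> vanishing_ideal (vec.span {P a, P b})"
    unfolding vanishing_ideal_def
  proof (intro CollectI ballI)
    fix Q assume "Q \<in> vec.span {P a, P b}"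
    then obtain x where "Q - x *s P a \<in> vec.span {P b}" unfolding vec.span_insert by auto
    then obtain y where "Q - x *s P a = y *s P b" by (auto simp: vec.span_singleton)
    then have Q: "Q = x *s P a + y *s P b" by (simp add: algebra_simps)
    show "eval (vec_nth Q) (sminor m A j) = 0"
    proof (cases "y = 0")
      case False
      then show ?thesis by (rule minor_vanishes_collinear[OF ab Q _ j])
    next
      case y: True
      show ?thesis
      proof (cases "x = 0")
        case False
        have "Q = y *s P b + x *s P a" using Q by (simp add: add.commute)
        then show ?thesis by (rule minor_vanishes_collinear[OF ab(2,1) ab(3)[symmetric] _ False j])
      next
        case True
        then have "Q = 0" using Q y by simp
        then have "vec_nth Q = (\<lambda>k. 0 * vec_nth (P a) k)" by (simp add: fun_eq_iff)
        then show ?thesis using eval_form_scale[OF sminor_in_forms[OF j], of 0 "vec_nth (P a)"] n_pos by simp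
      qed
    qed
  qed
qed

text \<open>The generic point lies strictly below the line through \<open>P 0\<close> and \<open>P 1\<close>, because it is contained in
  the ideal of a second line. Together with the ideal of \<open>P 0\<close> this is a chain of length \<open>2\<close>.\<close>

lemma I_not_irreducible:
  assumes dim: "scheme_dim I = 1"
  shows "\<not> scheme_irreducible I"
proof
  assume irr: "scheme_irreducible I"
  let ?p = "\<Inter>(proj_points I)"
  have p: "?p \<in> proj_points I" by (rule irreducible_generic_point[OF irr])
  have r3: "0 < r" "1 < r" "2 < r" using r_ge_5 by auto
  let ?l1 = "vec.span {P 0, P 1}" and ?l2 = "vec.span {P 0, P 2}" and ?q = "vec.span {P 0}"
  have P0: "P 0 \<noteq> 0" using points_independent(2)[of 0 1] r3 by simp
  have mem: "P 0 \<in> ?l1" "P 0 \<in> ?l2" "P 0 \<in> ?q" "P 1 \<in> ?l1" "P 2 \<in> ?l2" by (auto intro: vec.span_base)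
  have I1: "I \<subseteq> vanishing_ideal ?l1" "I \<subseteq> vanishing_ideal ?l2"
    using I_vanishes_on_lines[of 0 1] I_vanishes_on_lines[of 0 2] r3 by auto
  have "?q \<subseteq> ?l1" by (rule vec.span_mono) auto
  then have l1q: "vanishing_ideal ?l1 \<subseteq> vanishing_ideal ?q" by (rule vanishing_ideal_mono)
  have pts: "vanishing_ideal ?l1 \<in> proj_points I" "vanishing_ideal ?l2 \<in> proj_points I"
    "vanishing_ideal ?q \<in> proj_points I"
    by (rule vanishing_ideal_proj_point[OF vec.subspace_span mem(1) P0 I1(1)],
        rule vanishing_ideal_proj_point[OF vec.subspace_span mem(2) P0 I1(2)],
        rule vanishing_ideal_proj_point[OF vec.subspace_span mem(3) P0 order_trans[OF I1(1) l1q]])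
  have "P 2 \<notin> ?l1" using no_three[of 0 1 2] r3 by simp
  then obtain w where w: "dual_form w \<in> vanishing_ideal ?l1" "eval (vec_nth (P 2)) (dual_form w) \<noteq> 0"
    by (rule separating_form[OF vec.subspace_span])
  then have "dual_form w \<notin> vanishing_ideal ?l2" using mem(5) unfolding vanishing_ideal_def by blast
  then have "dual_form w \<notin> ?p" using pts(2) by blast
  then have s1: "?p \<subset> vanishing_ideal ?l1" using pts(1) w(1) by blast
  have "P 1 \<notin> ?q" using points_independent(1)[of 0 1] r3 by simp
  then obtain w' where w': "dual_form w' \<in> vanishing_ideal ?q" "eval (vec_nth (P 1)) (dual_form w') \<noteq> 0"
    by (rule separating_form[OF vec.subspace_span])
  then have "dual_form w' \<notin> vanishing_ideal ?l1" using mem(4) unfolding vanishing_ideal_def by blast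
  then have s2: "vanishing_ideal ?l1 \<subset> vanishing_ideal ?q" using l1q w'(1) by blast
  let ?c = "\<lambda>i::nat. if i = 0 then ?p else if i = 1 then vanishing_ideal ?l1 else vanishing_ideal ?q"
  have "\<forall>i\<le>2. ?c i \<in> proj_points I" using p pts by simp
  moreover have "\<forall>i<2. ?c i \<subset> ?c (Suc i)" using s1 s2 by (auto simp: less_2_cases_iff)
  ultimately have "ereal (real 2) \<le> scheme_dim I"
    unfolding scheme_dim_def by (rule chain_dim_ge)
  then show False unfolding dim by simp
qed

text \<open>The regular sequence \<open>l\<^sub>0, l\<^sub>1\<close> on \<open>R/I\<close> gives saturation and depth at least \<open>2\<close>; exactness of the
  Hilbert--Burch complex gives the degree and Krull dimension at most \<open>2\<close>.\<close>

lemma weddle_curve: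
  assumes dim: "scheme_dim (weddle_ideal d r P) = 1"
  shows "weddle_ideal d r P = I"
    and "arithmetically_CM (weddle_ideal d r P)"
    and "has_degree (weddle_ideal d r P) ((((d + 2) choose 3) + 1) choose 2)"
    and "\<not> scheme_irreducible (weddle_ideal d r P)"
proof -
  have dimI: "scheme_dim I = 1"
    using dim unfolding weddle_ideal_eq scheme_dim_def proj_points_saturation .
  have "scheme_dim I \<le> ereal (real 1)" unfolding dimI by simp
  from good_of_scheme_dim[OF I_homogeneous this]
  have good: "good 2 I" by (simp add: numeral_2_eq_2)
  obtain l where l: "l 0 \<in> forms 1" "l 1 \<in> forms 1"
    and reg0: "\<And>g. l 0 * g \<in> I \<Longrightarrow> g \<in> I"
    and reg1: "\<And>g. l 1 * g \<in> adjoin I 1 l \<Longrightarrow> g \<in> adjoin I 1 l"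
    and exact: "hb_exact m A {0}"
  proof (rule hilbert_burch[where e = deg, OF good])
    show "A i k \<in> forms (deg i)" if "i < m" "k \<le> m" for i k by (rule A_forms[OF that])
    fix l :: "nat \<Rightarrow> mpoly4"
    assume l: "l 0 \<in> forms 1" "l 1 \<in> forms 1" "\<And>g. l 0 * g \<in> I \<Longrightarrow> g \<in> I"
      "\<And>g. l 1 * g \<in> adjoin I 1 l \<Longrightarrow> g \<in> adjoin I 1 l" "hb_exact m A {0}"
    show thesis by (rule that[OF l])
  qed
  show W: "weddle_ideal d r P = I"
    unfolding weddle_ideal_eq by (rule saturation_eq[OF I_id l(1) reg0])
  have deg1: "deg i \<le> 1" for i by (simp add: deg_def)
  note hb = A_forms deg1 sum_deg[symmetric] exact nonzero_minor
  show "has_degree (weddle_ideal d r P) ((((d + 2) choose 3) + 1) choose 2)"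
    unfolding W using has_degree_minor_ideal[OF hb n_pos] by (simp add: n_def)
  show "\<not> scheme_irreducible (weddle_ideal d r P)"
    unfolding W by (rule I_not_irreducible[OF dimI])
  obtain B where B: "\<And>t. hilbert_fun I t \<le> B * (t + 1)" using hilbert_fun_linear_bound[OF hb] by blast
  have krull: "krull_dim_quot I \<le> 2" by (rule krull_le_2[OF B])
  have gen: "genideal R4 (I \<union> set (take k [l 0, l 1])) = adjoin I k l" if "k \<le> 2" for k
  proof -
    have "k = 0 \<or> k = 1 \<or> k = 2" using that by auto
    then have "set (take k [l 0, l 1]) = l ` {..<k}"
      by (elim disjE) (auto simp: numeral_2_eq_2 lessThan_Suc)
    then show ?thesis using genideal_adjoin[OF I_id, of l k] by simp
  qed
  have irr1: "forms (Suc s) \<subseteq> irrelevant_ideal" for s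
  proof
    fix f assume "f \<in> forms (Suc s)"
    then have "lookup f 0 \<noteq> 0 \<longrightarrow> mdeg 0 = Suc s" unfolding forms_iff by blast
    then show "f \<in> irrelevant_ideal" by (simp add: irrelevant_ideal_def)
  qed
  have Iirr: "I \<subseteq> irrelevant_ideal"
  proof (rule adjoin_least[OF irrelevant_ideal_is_idl])
    show "{0} \<subseteq> irrelevant_ideal" using is_idlD(1)[OF irrelevant_ideal_is_idl] by simp
    show "sminor m A j \<in> irrelevant_ideal" if "j < Suc m" for j
      using sminor_in_forms[of j] that n_pos irr1[of "n - 1"] by auto
  qed
  have lirr: "l 0 \<in> irrelevant_ideal" "l 1 \<in> irrelevant_ideal" using l irr1[of 0] by auto
  have "regular_sequence_mod I [l 0, l 1]"
    unfolding regular_sequence_mod_def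
  proof (intro conjI allI impI)
    have "adjoin I 2 l \<subseteq> irrelevant_ideal"
      by (rule adjoin_least[OF irrelevant_ideal_is_idl Iirr]) (use lirr in \<open>auto simp: less_2_cases_iff\<close>)
    moreover have "1 \<notin> irrelevant_ideal" by (simp add: irrelevant_ideal_def)
    ultimately have "adjoin I 2 l \<noteq> UNIV" by blast
    then show "genideal R4 (I \<union> set [l 0, l 1]) \<noteq> UNIV" using gen[of 2] by simp
    fix k g assume k: "k < length [l 0, l 1]"
      and g: "[l 0, l 1] ! k * g \<in> genideal R4 (I \<union> set (take k [l 0, l 1]))"
    have "k = 0 \<or> k = 1" using k by auto
    then show "g \<in> genideal R4 (I \<union> set (take k [l 0, l 1]))"
    proof
      assume "k = 0"
      then show ?thesis using g reg0 gen[of 0] by simp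
    next
      assume "k = 1"
      then show ?thesis using g reg1 gen[of 1] by simp
    qed
  qed
  then have "ereal (real (length [l 0, l 1])) \<le> depth_quot I"
    unfolding depth_quot_def using lirr by (intro Sup_upper) fastforce
  then have "2 \<le> depth_quot I" by simp
  then show "arithmetically_CM (weddle_ideal d r P)"
    unfolding W arithmetically_CM_def using depth_le_krull[of I] krull by (meson order_antisym order_trans)
qed

end

section \<open>Existence of the general position\<close>

text \<open>Three points are independent if a \<open>3 \<times> 3\<close> minor of their coordinates is nonzero, and coordinate
  points show that this happens.\<close>

lemma general_no_three:
  assumes "i < r" "j < r" "k < r" "i \<noteq> j" "i \<noteq> k" "j \<noteq> k"
  shows "for_general_points r (\<lambda>P. P k \<notin> vec.span {P i, P j})"
proof -
  define idx where "idx a = (if a = 0 then i else if a = 1 then j else k)" for a :: nat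
  define M :: "nat \<Rightarrow> 4 \<Rightarrow>\<^sub>0 nat" where "M a = single (ix a) 1" for a
  define P0 :: "nat \<Rightarrow> complex ^ 4" where "P0 a = axis (if a = j then 2 else if a = k then 3 else 1) 1" for a
  have mv: "monom_val (vec_nth v) (M a) = vec_nth v (ix a)" for v :: "complex ^ 4" and a
    by (simp add: M_def monom_val_single)
  have one: "mat 3 3 (\<lambda>(a, b). monom_val (vec_nth (P0 (idx a))) (M b)) = 1\<^sub>m 3"
  proof (rule eq_matI)
    fix a b assume "a < dim_row (1\<^sub>m 3 :: complex mat)" "b < dim_col (1\<^sub>m 3 :: complex mat)"
    then have ab: "a < 3" "b < 3" by simp_all
    then have "a = 0 \<or> a = 1 \<or> a = 2" "b = 0 \<or> b = 1 \<or> b = 2" by auto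
    then show "mat 3 3 (\<lambda>(a, b). monom_val (vec_nth (P0 (idx a))) (M b)) $$ (a, b) = 1\<^sub>m 3 $$ (a, b)"
      using ab assms by (elim disjE) (simp_all add: mv P0_def idx_def ix_def axis_def)
  qed simp_all
  have "for_general_points r (\<lambda>P. Determinant.det (mat 3 3 (\<lambda>(a, b). monom_val (vec_nth (P (idx a))) (M b))) \<noteq> 0)"
  proof (rule for_general_points_det[where ?P0.0 = P0 and D = 1])
    show "idx a < r" for a using assms by (simp add: idx_def)
    show "mdeg (M a) = 1" for a by (simp add: M_def)
    show "\<forall>a<r. P0 a \<noteq> 0" by (simp add: P0_def axis_eq_0_iff)
    show "Determinant.det (mat 3 3 (\<lambda>(a, b). monom_val (vec_nth (P0 (idx a))) (M b))) \<noteq> 0"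
      unfolding one by simp
  qed
  then show ?thesis
  proof (rule for_general_points_mono)
    fix P :: "nat \<Rightarrow> complex ^ 4"
    let ?N = "mat 3 3 (\<lambda>(a, b). monom_val (vec_nth (P (idx a))) (M b))"
    assume det: "Determinant.det ?N \<noteq> 0"
    show "P k \<notin> vec.span {P i, P j}"
    proof
      assume "P k \<in> vec.span {P i, P j}"
      then obtain x where "P k - x *s P i \<in> vec.span {P j}" unfolding vec.span_insert by auto
      then obtain y where "P k - x *s P i = y *s P j" by (auto simp: vec.span_singleton)
      then have Pk: "P k = x *s P i + y *s P j" by (simp add: algebra_simps)
      let ?c = "\<lambda>a::nat. if a = 0 then x else if a = 1 then y else - 1"
      have "\<forall>b<3. (\<Sum>a<3. ?c a * ?N $$ (a, b)) = 0"
        using Pk by (auto simp: numeral_3_eq_3 mv idx_def)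
      then have "\<forall>a<3. ?c a = 0" by (rule mp[OF spec[OF iffD1[OF det_nonzero_iff[OF mat_carrier] det]]])
      from spec[OF this, of 2] show False by simp
    qed
  qed
qed

text \<open>At the points \<open>[0 : 1 : 2\<^sup>i : 2\<^bsup>i(d+1)\<^esup>]\<close> each monomial takes the values \<open>w\<^sup>i\<close>, with different \<open>w\<close> for
  different monomials because the exponents are digits to the base \<open>d + 1\<close>. So the matrix of values
  is a Vandermonde matrix.\<close>

lemma vandermonde_points:
  assumes ms: "\<And>j. j < r \<Longrightarrow> mdeg (ms j) = d \<and> lookup (ms j) 4 = 0" and inj: "inj_on ms {..<r}"
  shows "for_general_points r (\<lambda>P.
    Determinant.det (mat r r (\<lambda>(i, j). monom_val (vec_nth (P i)) (ms j))) \<noteq> 0)"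
proof (rule for_general_points_det[where idx = "\<lambda>i. i" and D = d])
  define P0 :: "nat \<Rightarrow> complex ^ 4" where
    "P0 i = (\<chi> k. if k = 1 then 1 else if k = 2 then 2 ^ i else if k = 3 then 2 ^ (i * (d + 1)) else 0)" for i
  define ex where "ex j = lookup (ms j) 2 + (d + 1) * lookup (ms j) 3" for j
  show "\<forall>i<r. P0 i \<noteq> 0"
  proof (intro allI impI notI)
    fix i assume "P0 i = 0"
    then have "vec_nth (P0 i) 1 = 0" by simp
    then show False by (simp add: P0_def)
  qed
  have mv: "monom_val (vec_nth (P0 i)) (ms j) = (2 ^ ex j) ^ i" if "j < r" for i j
  proof -
    have "monom_val (vec_nth (P0 i)) (ms j) = (\<Prod>k\<in>UNIV. vec_nth (P0 i) k ^ lookup (ms j) k)"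
      by (rule monom_val_superset) auto
    also have "\<dots> = (2 ^ i) ^ lookup (ms j) 2 * (2 ^ (i * (d + 1))) ^ lookup (ms j) 3"
      using ms[OF that] unfolding UNIV_4 by (simp add: P0_def)
    also have "\<dots> = (2 ^ ex j) ^ i"
      by (simp add: ex_def power_add[symmetric] power_mult[symmetric] algebra_simps)
    finally show ?thesis .
  qed
  have exinj: "i = j" if "i < r" "j < r" "ex i = ex j" for i j
  proof -
    have le: "lookup (ms k) 2 < d + 1" if "k < r" for k using ms[OF that] by (simp add: mdeg_4)
    have m2: "ex k mod (d + 1) = lookup (ms k) 2" "ex k div (d + 1) = lookup (ms k) 3" if "k < r" for k
    proof -
      show "ex k mod (d + 1) = lookup (ms k) 2"
        unfolding ex_def mod_mult_self2 by (rule mod_less[OF le[OF that]])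
      have "d + 1 \<noteq> 0" by simp
      then show "ex k div (d + 1) = lookup (ms k) 3"
        unfolding ex_def using div_less[OF le[OF that]] by (simp only: div_mult_self2 simp_thms add_0_right)
    qed
    have "lookup (ms i) 2 = lookup (ms j) 2" "lookup (ms i) 3 = lookup (ms j) 3"
      using m2[OF that(1)] m2[OF that(2)] that(3) by auto
    moreover from this have "lookup (ms i) 1 = lookup (ms j) 1" "lookup (ms i) 4 = lookup (ms j) 4"
      using ms[OF that(1)] ms[OF that(2)] by (auto simp: mdeg_4)
    ultimately have "ms i = ms j"
      by (intro poly_mapping_eqI) (metis exhaust_4)
    then show ?thesis using inj that by (auto simp: inj_on_def)
  qed
  let ?N = "mat r r (\<lambda>(i, j). monom_val (vec_nth (P0 i)) (ms j))"
  show "Determinant.det ?N \<noteq> 0"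
  proof (rule iffD2[OF det_nonzero_iff[OF mat_carrier]], intro allI impI)
    fix c i assume c: "\<forall>j<r. (\<Sum>i<r. c i * ?N $$ (i, j)) = 0" and i: "i < r"
    \<comment> \<open>A relation between the rows is a polynomial of degree less than \<open>r\<close> with \<open>r\<close> roots.\<close>
    define p where "p = (\<Sum>i<r. Polynomial.monom (c i) i)"
    have root: "poly p (2 ^ ex j) = 0" if "j < r" for j
    proof -
      have "poly p (2 ^ ex j) = (\<Sum>i<r. c i * (2 ^ ex j) ^ i)" by (simp add: p_def poly_sum poly_monom)
      also have "\<dots> = (\<Sum>i<r. c i * ?N $$ (i, j))" by (rule sum.cong) (use that mv in simp_all)
      finally show ?thesis using c that by simp
    qed
    have injw: "inj_on (\<lambda>j. 2 ^ ex j :: complex) {..<r}"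
    proof (rule inj_onI)
      fix a b assume ab: "a \<in> {..<r}" "b \<in> {..<r}" "(2 ^ ex a :: complex) = 2 ^ ex b"
      have "of_nat (2 ^ ex a) = (of_nat (2 ^ ex b) :: complex)" using ab(3) by simp
      then have "(2::nat) ^ ex a = 2 ^ ex b" unfolding of_nat_eq_iff .
      then have "ex a = ex b" by simp
      then show "a = b" using exinj ab by simp
    qed
    have "p = 0"
    proof (rule ccontr)
      assume p: "p \<noteq> 0"
      have "r = card ((\<lambda>j. 2 ^ ex j :: complex) ` {..<r})" using card_image[OF injw] by simp
      also have "\<dots> \<le> card {x. poly p x = 0}"
        by (rule card_mono[OF poly_roots_finite[OF p]]) (use root in auto)
      also have "\<dots> \<le> Polynomial.degree p" by (rule card_poly_roots_bound[OF p])
      also have "\<dots> < r"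
      proof -
        have "Polynomial.degree p \<le> r - 1"
          unfolding p_def by (rule degree_sum_le) (auto intro: order_trans[OF degree_monom_le])
        then show ?thesis using i by simp
      qed
      finally show False by simp
    qed
    moreover have "poly.coeff p i = c i" using i by (simp add: p_def coeff_sum if_distrib cong: if_cong)
    ultimately show "c i = 0" by simp
  qed
qed (use ms in auto)

text \<open>The other monomials of degree \<open>d\<close> are the products of the variable of index \<open>4 = 0\<close> with the
  monomials of degree \<open>d - 1\<close>.\<close>

lemma card_plane_monomials:
  assumes "d \<ge> 1"
  shows "card {m. mdeg m = d \<and> lookup m 4 = 0} = (d + 2) choose 2"
proof -
  let ?S = "{m. mdeg m = d \<and> lookup m 4 = 0}" and ?f = "\<lambda>m. single (4::4) (1::nat) + m"
  obtain b where b: "d = Suc b" using assms by (cases d) auto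
  have "{m. mdeg m = d} = ?S \<union> ?f ` {m. mdeg m = b}"
  proof (intro subset_antisym subsetI)
    fix m :: "4 \<Rightarrow>\<^sub>0 nat" assume m: "m \<in> {m. mdeg m = d}"
    show "m \<in> ?S \<union> ?f ` {m. mdeg m = b}"
    proof (cases "lookup m 4 = 0")
      case False
      have eq: "m = ?f (m - single 4 1)"
        by (rule monomial_diff_add) (use False in \<open>auto simp: lookup_single when_def\<close>)
      have "mdeg m = 1 + mdeg (m - single 4 1)" by (subst eq) (simp add: mdeg_add)
      then have "mdeg (m - single 4 1) = b" using m b by simp
      then show ?thesis using eq by blast
    qed (use m in simp)
  qed (auto simp: mdeg_add b)
  moreover have "?S \<inter> ?f ` {m. mdeg m = b} = {}" by (auto simp: lookup_add)
  ultimately have "card {m :: 4 \<Rightarrow>\<^sub>0 nat. mdeg m = d} = card ?S + card (?f ` {m. mdeg m = b})"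
    using card_Un_disjoint[of ?S "?f ` {m. mdeg m = b}"] card_mdeg_eq(1)[of d] card_mdeg_eq(1)[of b] by simp
  moreover have "card (?f ` {m. mdeg m = b}) = card {m :: 4 \<Rightarrow>\<^sub>0 nat. mdeg m = b}"
    by (rule card_image) simp
  ultimately have "(d + 3) choose 3 = card ?S + ((b + 3) choose 3)"
    by (simp add: card_mdeg_eq(2))
  moreover have "b + 3 = d + 2" using b by simp
  moreover have "(d + 3) choose 3 = ((d + 2) choose 2) + ((d + 2) choose 3)"
    by (simp add: b numeral_3_eq_3 numeral_2_eq_2)
  ultimately show ?thesis by presburger
qed

lemma general_weddle:
  assumes d: "d \<ge> 2" and r: "r + 1 = (d + 2) choose 2"
  obtains ms m0 where "for_general_points r (\<lambda>P. weddle d r P ms m0)"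
proof -
  let ?S = "{m. mdeg m = d \<and> lookup m 4 = 0}"
  have finS: "finite ?S" by (rule finite_subset[OF _ card_mdeg_eq(1)[of d]]) auto
  have cardS: "card ?S = r + 1" using card_plane_monomials[of d] d r by simp
  then have "?S \<noteq> {}" by (metis card.empty add_is_0 one_neq_zero)
  then obtain m0 where m0: "m0 \<in> ?S" by blast
  have "card (?S - {m0}) = r" using cardS m0 finS by (simp add: card_Diff_singleton)
  then obtain ms where ms: "bij_betw ms {..<r} (?S - {m0})"
    using ex_bij_betw_nat_finite[of "?S - {m0}"] finS by (auto simp: lessThan_atLeast0)
  have msj: "mdeg (ms j) = d \<and> lookup (ms j) 4 = 0 \<and> ms j \<noteq> m0" if "j < r" for j
    using bij_betwE[OF ms] that by blast
  let ?T = "{(i, j, k). i < r \<and> j < r \<and> k < r \<and> i \<noteq> j \<and> i \<noteq> k \<and> j \<noteq> k}"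
  have finT: "finite ?T" by (rule finite_subset[of _ "{..<r} \<times> {..<r} \<times> {..<r}"]) auto
  have "for_general_points r (\<lambda>P. \<forall>t\<in>?T. case t of (i, j, k) \<Rightarrow> P k \<notin> vec.span {P i, P j})"
    by (rule for_general_points_ball[OF finT]) (auto intro: general_no_three)
  moreover have "for_general_points r (\<lambda>P. Determinant.det (mat r r (\<lambda>(i, j). monom_val (vec_nth (P i)) (ms j))) \<noteq> 0)"
    by (rule vandermonde_points[where d = d]) (use msj ms in \<open>auto simp: bij_betw_def\<close>)
  ultimately have gen: "for_general_points r (\<lambda>P.
      (\<forall>t\<in>?T. case t of (i, j, k) \<Rightarrow> P k \<notin> vec.span {P i, P j}) \<and>
      Determinant.det (mat r r (\<lambda>(i, j). monom_val (vec_nth (P i)) (ms j))) \<noteq> 0)"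
    by (rule for_general_points_conj)
  have "for_general_points r (\<lambda>P. weddle d r P ms m0)"
  proof (rule for_general_points_mono[OF gen])
    fix P :: "nat \<Rightarrow> complex ^ 4" assume P: "(\<forall>t\<in>?T. case t of (i, j, k) \<Rightarrow> P k \<notin> vec.span {P i, P j}) \<and>
      Determinant.det (mat r r (\<lambda>(i, j). monom_val (vec_nth (P i)) (ms j))) \<noteq> 0"
    show "weddle d r P ms m0"
    proof
      show "P k \<notin> vec.span {P i, P j}"
        if "i < r" "j < r" "k < r" "i \<noteq> j" "i \<noteq> k" "j \<noteq> k" for i j k
        using P that by auto
    qed (use d r msj m0 P in auto)
  qed
  then show thesis by (rule that)
qed

theorem proposition5p3:
  fixes d r :: nat
  assumes "d \<ge> 2" and "r = ((d + 2) choose 2) - 1"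
  shows "for_general_points r (\<lambda>P.
    card (point_set r P) = r \<and>
    expected_codim d r P = 2 \<and>
    (scheme_codim (weddle_ideal d r P) = ereal (real_of_int (expected_codim d r P)) \<longrightarrow>
       scheme_dim (weddle_ideal d r P) = 1 \<and>
       arithmetically_CM (weddle_ideal d r P) \<and>
       has_degree (weddle_ideal d r P) ((((d + 2) choose 3) + 1) choose 2) \<and>
       card (joining_lines r P) = r choose 2 \<and>
       (\<forall>l\<in>joining_lines r P. vec.dim l = 2 \<and> scheme_contains_line (weddle_ideal d r P) l) \<and>
       \<not> scheme_irreducible (weddle_ideal d r P)))"
proof -
  have "(d + 2) choose 2 \<ge> 1" by (simp only: Suc_le_eq One_nat_def zero_less_binomial_iff)
  then have r: "r + 1 = (d + 2) choose 2" using assms(2) by simp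
  obtain ms m0 where gen: "for_general_points r (\<lambda>P. weddle d r P ms m0)"
    by (rule general_weddle[OF assms(1) r])
  show ?thesis
  proof (rule for_general_points_mono[OF gen], intro conjI impI)
    fix P :: "nat \<Rightarrow> complex ^ 4" assume "weddle d r P ms m0"
    then interpret weddle d r P ms m0 .
    show "card (point_set r P) = r" by (rule card_point_set)
    show ec: "expected_codim d r P = 2" by (rule expected_codim)
    assume codim: "scheme_codim (weddle_ideal d r P) = ereal (real_of_int (expected_codim d r P))"
    show dim: "scheme_dim (weddle_ideal d r P) = 1"
    proof (cases "scheme_dim (weddle_ideal d r P)")
      case (real x)
      have "ereal 3 - ereal x = ereal 2" using codim unfolding scheme_codim_def ec real by simp
      then have "x = 1" by simp
      then show ?thesis unfolding real by simp
    qed (use codim in \<open>simp_all add: scheme_codim_def ec\<close>)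
    note curve = weddle_curve[OF dim]
    show "arithmetically_CM (weddle_ideal d r P)" by (rule curve(2))
    show "has_degree (weddle_ideal d r P) ((((d + 2) choose 3) + 1) choose 2)" by (rule curve(3))
    show "\<not> scheme_irreducible (weddle_ideal d r P)" by (rule curve(4))
    show "card (joining_lines r P) = r choose 2" by (rule card_joining_lines)
    show "\<forall>l\<in>joining_lines r P. vec.dim l = 2 \<and> scheme_contains_line (weddle_ideal d r P) l"
    proof
      fix l assume "l \<in> joining_lines r P"
      then obtain i j where ij: "l = vec.span {P i, P j}" "i < j" "j < r" by (auto simp: joining_lines_def)
      then show "vec.dim l = 2 \<and> scheme_contains_line (weddle_ideal d r P) l"
        using dim_joining_line[of i j] I_vanishes_on_lines[of i j]
        unfolding scheme_contains_line_def curve(1) by simp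
    qed
  qed
qed

end
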